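(* Let $X$ be a smooth projective toric variety of dimension $n$ with torus $T$, and let $(L,\phi)$ be a toric invariant Hermitian big line bundle on $X$ with positive volume. Fix a toric invariant admissible flag $(Y_\bullet)$ on $X$. Identify $\phi$ with a convex function $\phi_{\mathbb R}$ on $\mathbb R^n$ by means of the toric invariant rational section of $L$ (and the coordinates) determined by the flag. Then the partial Okounkov body $\Delta(L,\phi)\subseteq\mathbb R^n$ with respect to $(Y_\bullet)$ equals the closure of the image of $\nabla\phi_{\mathbb R}$.
   Context: $(L,\phi)$ toric invariant Hermitian big: $L$ is a $T$-invariant big line bundle and $\phi$ is a singular psh metric on $L$ invariant under the compact torus $T_c\subseteq T$. $\phi=he^{-\varphi}$ with $h$ a smooth metric; $\mathcal I(k\phi)$ is the multiplier ideal sheaf of $f$ with $|f|^2e^{-k\varphi}$ locally integrable; $\mathrm{vol}(L,\phi)=\lim_kk^{-n}h^0(X,L^k\otimes\mathcal I(k\phi))$. Identifications. Let $N$ be the cocharacter lattice, $M$ the character lattice, $\Sigma\subset N_{\mathbb R}$ the fan of $X$. A $T$-invariant admissible flag is, after renumbering the prime $T$-invariant divisors $D_i$, of the form $Y_i=D_1\cap\dots\cap D_i$ ($i\le n$), $Y_n$ a point. Let $v_i\in N$ be the primitive generator of the ray of $D_i$; $v_1,\dots,v_n$ is a basis of $N$, generating a cone $\sigma\in\Sigma$ with affine toric chart $U_\sigma$. $M_{\mathbb R}$ is identified with $\mathbb R^n$ through $\Phi_{\mathbb R}(u)=(\langle u,v_i\rangle)_i$, and the open orbit with $\mathbb C^{*n}$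 with coordinates $z_1,\dots,z_n$ the characters dual to $v_1,\dots,v_n$. Let $D$ be the unique $T$-invariant divisor with $\mathcal O_X(D)=L$ and $D|_{U_\sigma}=0$, and $s_0$ the corresponding $T$-invariant rational section. On the open orbit write $|s_0|_\phi^2=e^{-\phi}$ for a $T_c$-invariant psh function $\phi$ on $\mathbb C^{*n}$; then $\phi_{\mathbb R}(x)=\phi(z)$ with $x_i=\log|z_i|^2$ is convex on $\mathbb R^n$. The image of $\nabla\phi_{\mathbb R}$ is the set of all (sub)gradients of $\phi_{\mathbb R}$. Partial Okounkov body. $\nu$ is the valuation of the flag: $\nu_1(s)$ is the vanishing order along $Y_1$, $\nu_2(s)$ the order along $Y_2$ of the restriction to $Y_1$ of $s$ divided by the $\nu_1(s)$-th power of a local equation of $Y_1$, etc. $\Delta(L,\phi)$ is the Hausdorff limit as $k\to\infty$ of the convex hulls of $\{k^{-1}\nu(s):0\ne s\in\mathrm H^0(X,L^k\otimes\mathcal I(k\phi))\}$ (equivalently, the Hausdorff limit of the Okounkov bodies of any semigroups $S^i$, generating $\mathbb{Z}^{n+1}$ and contained in a common closed convex cone meeting $\{x_{n+1}=0\}$ only at $0$, that converge to $\{(\nu(s),k):k\in\mathbb{N},\,0\neq s\in \mathrm H^0(X,L^k\otimes\mathcal I(k\phi))\}$ in the pseudometric $\limsup_kk^{-n}(|S_k|+|S'_k|-2|S_k\cap S'_k|)$, $S_k=\{x:(x,k)\in S\}$). *)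

theory Defs
  imports "HOL-Analysis.Analysis" "HOL-Library.Function_Algebras"
begin

section \<open>Fans\<close>

text \<open>
  The torus is \<open>T = (\<complex>\<^sup>*)\<^sup>n\<close> with \<open>n = CARD('n)\<close>; its cocharacter lattice \<open>N\<close> is \<open>int ^ 'n\<close>, sitting
  inside \<open>real ^ 'n\<close>.
\<close>

definition real_vec :: "int ^ 'n \<Rightarrow> real ^ 'n" where
  "real_vec u = (\<chi> i. real_of_int (u $ i))"

definition strongly_convex_rational_cone :: "(real ^ 'n) set \<Rightarrow> bool" where
  "strongly_convex_rational_cone \<sigma> \<longleftrightarrow>
     (\<exists>S. finite S \<and> \<sigma> = convex_cone hull (real_vec ` S)) \<and> \<sigma> \<inter> uminus ` \<sigma> = {0}"

definition fan :: "(real ^ 'n) set set \<Rightarrow> bool" where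
  "fan \<Sigma> \<longleftrightarrow> finite \<Sigma> \<and> \<Sigma> \<noteq> {} \<and>
     (\<forall>\<sigma>\<in>\<Sigma>. strongly_convex_rational_cone \<sigma>) \<and>
     (\<forall>\<sigma>\<in>\<Sigma>. \<forall>\<tau>. \<tau> face_of \<sigma> \<and> \<tau> \<noteq> {} \<longrightarrow> \<tau> \<in> \<Sigma>) \<and>
     (\<forall>\<sigma>\<in>\<Sigma>. \<forall>\<tau>\<in>\<Sigma>. (\<sigma> \<inter> \<tau>) face_of \<sigma> \<and> (\<sigma> \<inter> \<tau>) face_of \<tau>)"

text \<open>
  The rows of an invertible integer matrix form a basis of \<open>N\<close>.
\<close>

definition smooth_fan :: "(real ^ 'n) set set \<Rightarrow> bool" where
  "smooth_fan \<Sigma> \<longleftrightarrow> fan \<Sigma> \<and>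
     (\<forall>\<sigma>\<in>\<Sigma>. \<exists>(w :: int ^ 'n ^ 'n) I. invertible w \<and> \<sigma> = convex_cone hull ((\<lambda>i. real_vec (w $ i)) ` I))"

definition complete_fan :: "(real ^ 'n) set set \<Rightarrow> bool" where
  "complete_fan \<Sigma> \<longleftrightarrow> fan \<Sigma> \<and> \<Union>\<Sigma> = UNIV"

section \<open>The toric variety of a smooth complete fan as a glued complex manifold\<close>

text \<open>
  A frame is an \<^emph>\<open>ordered\<close> list \<open>w\<^sub>1, \<dots>, w\<^sub>n\<close> of the primitive ray generators of an \<open>n\<close>-dimensional cone
  \<open>\<sigma>\<close> of the fan (the rows of a matrix). It identifies the affine toric chart \<open>U\<^sub>\<sigma>\<close> with \<open>\<complex>\<^sup>n\<close> through
  the characters \<open>z\<^sub>1, \<dots>, z\<^sub>n\<close> dual to \<open>w\<^sub>1, \<dots>, w\<^sub>n\<close>; the prime invariant divisor of the ray of \<open>w\<^sub>i\<close>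
  is \<open>{z\<^sub>i = 0}\<close> there. All orderings are used, so a cone gives \<open>n!\<close> charts that differ by permutations
  of the coordinates. Since an invariant admissible flag is
  \<open>Y\<^sub>i = D\<^sub>1 \<inter> \<dots> \<inter> D\<^sub>i\<close> for invariant prime divisors \<open>D\<^sub>1, \<dots>, D\<^sub>n\<close> meeting in a point, it is the same
  thing as a frame.
\<close>

definition frames :: "(real ^ 'n) set set \<Rightarrow> (int ^ 'n ^ 'n) set" where
  "frames \<Sigma> = {w. invertible w \<and> convex_cone hull (range (\<lambda>i. real_vec (w $ i))) \<in> \<Sigma>}"

text \<open>
  Row \<open>i\<close> of \<open>frame_change w w'\<close> holds the coordinates of \<open>w\<^sub>i\<close> in the basis \<open>w'\<close>.
  The intersection of two charts is the chart of the common face, i.e. the locus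
  \<open>z\<^sub>i \<noteq> 0\<close> for all \<open>i\<close> such that \<open>w\<^sub>i\<close> is not among the \<open>w'\<^sub>j\<close>. If \<open>z\<^sub>i = 0\<close> there, then \<open>w\<^sub>i\<close> is some
  \<open>w'\<^sub>j\<close> and the exponents of \<open>z\<^sub>i\<close> below are \<open>0\<close> or \<open>1\<close>.
\<close>

definition frame_change :: "int ^ 'n ^ 'n \<Rightarrow> int ^ 'n ^ 'n \<Rightarrow> int ^ 'n ^ 'n" where
  "frame_change w w' = w ** matrix_inv w'"

definition chart_overlap :: "int ^ 'n ^ 'n \<Rightarrow> int ^ 'n ^ 'n \<Rightarrow> (complex ^ 'n) set" where
  "chart_overlap w w' = {z. \<forall>i. w $ i \<notin> range (\<lambda>j. w' $ j) \<longrightarrow> z $ i \<noteq> 0}"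

definition chart_change :: "int ^ 'n ^ 'n \<Rightarrow> int ^ 'n ^ 'n \<Rightarrow> complex ^ 'n \<Rightarrow> complex ^ 'n" where
  "chart_change w w' z = (\<chi> j. \<Prod>i\<in>UNIV. z $ i powi (frame_change w w' $ i $ j))"

definition same_point ::
    "int ^ 'n ^ 'n \<Rightarrow> complex ^ 'n \<Rightarrow> int ^ 'n ^ 'n \<Rightarrow> complex ^ 'n \<Rightarrow> bool" where
  "same_point w z w' z' \<longleftrightarrow> z \<in> chart_overlap w w' \<and> z' = chart_change w w' z"

definition holomorphic_fun :: "(complex ^ 'n \<Rightarrow> complex) \<Rightarrow> bool" where
  "holomorphic_fun f \<longleftrightarrow>
     (\<forall>z. \<exists>D. (f has_derivative D) (at z) \<and> (\<forall>c h. D (c *s h) = c * D h))"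

text \<open>
  A holomorphic embedding of the glued manifold into projective \<open>m\<close>-space, in homogeneous
  coordinates: every holomorphic map from a chart \<open>\<complex>\<^sup>n\<close> lifts to a nowhere vanishing
  tuple of holomorphic functions. The equivalence says that the map is
  well defined and injective, the last clause that it is an immersion. On a compact manifold (complete fan)
  this is a closed embedding.
\<close>

definition projective_embedding ::
    "(real ^ 'n) set set \<Rightarrow> nat \<Rightarrow> (int ^ 'n ^ 'n \<Rightarrow> complex ^ 'n \<Rightarrow> nat \<Rightarrow> complex) \<Rightarrow> bool" where
  "projective_embedding \<Sigma> m F \<longleftrightarrow>
     (\<forall>w\<in>frames \<Sigma>. \<forall>j\<le>m. holomorphic_fun (\<lambda>z. F w z j)) \<and>
     (\<forall>w\<in>frames \<Sigma>. \<forall>z. \<exists>j\<le>m. F w z j \<noteq> 0) \<and>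
     (\<forall>w\<in>frames \<Sigma>. \<forall>w'\<in>frames \<Sigma>. \<forall>z z'.
        same_point w z w' z' \<longleftrightarrow> (\<exists>c. c \<noteq> 0 \<and> (\<forall>j\<le>m. F w z j = c * F w' z' j))) \<and>
     (\<forall>w\<in>frames \<Sigma>. \<forall>z h.
        (\<exists>c. \<forall>j\<le>m. frechet_derivative (\<lambda>x. F w x j) (at z) h = c * F w z j) \<longrightarrow> h = 0)"

definition smooth_projective_fan :: "(real ^ 'n) set set \<Rightarrow> bool" where
  "smooth_projective_fan \<Sigma> \<longleftrightarrow>
     smooth_fan \<Sigma> \<and> complete_fan \<Sigma> \<and> (\<exists>m F. projective_embedding \<Sigma> m F)"

section \<open>Invariant line bundles and their sections\<close>

text \<open>
  An invariant divisor \<open>\<Sum> a(\<rho>) D\<^sub>\<rho>\<close> is given by its coefficients at the primitive ray generators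
  (other values of \<open>a\<close> play no role). The line bundle \<open>L = \<O>(\<Sum> a(\<rho>) D\<^sub>\<rho>)\<close> is trivialized on the chart \<open>w\<close>
  by \<open>\<Prod>\<^sub>i z\<^sub>i ^ (- a(w\<^sub>i))\<close>; a rational function \<open>f\<close>, as a rational section of \<open>L\<close>, is
  \<open>f \<Prod>\<^sub>i z\<^sub>i ^ a(w\<^sub>i)\<close> in this trivialization. The local expressions of a section \<open>s\<close> of \<open>L\<close> in two
  charts are related by \<open>s\<^sub>w(z) = transition a w w' z * s\<^sub>w'(z')\<close>. The exponent of \<open>z\<^sub>i\<close> vanishes
  if \<open>w\<^sub>i\<close> is among the \<open>w'\<^sub>j\<close>.
\<close>

definition transition ::
    "(int ^ 'n \<Rightarrow> int) \<Rightarrow> int ^ 'n ^ 'n \<Rightarrow> int ^ 'n ^ 'n \<Rightarrow> complex ^ 'n \<Rightarrow> complex" where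
  "transition a w w' z =
     (\<Prod>i\<in>UNIV. z $ i powi (a (w $ i) - (\<Sum>j\<in>UNIV. frame_change w w' $ i $ j * a (w' $ j))))"

text \<open>
  Global sections of \<open>L\<^sup>k\<close> as families of local expressions; the value at a matrix that is not a
  frame is set to \<open>0\<close>, so that a section is determined by its local expressions.
\<close>

definition sections ::
    "(real ^ 'n) set set \<Rightarrow> (int ^ 'n \<Rightarrow> int) \<Rightarrow> nat \<Rightarrow> (int ^ 'n ^ 'n \<Rightarrow> complex ^ 'n \<Rightarrow> complex) set" where
  "sections \<Sigma> a k = {s.
     (\<forall>w\<in>frames \<Sigma>. holomorphic_fun (s w)) \<and>
     (\<forall>w. w \<notin> frames \<Sigma> \<longrightarrow> s w = 0) \<and>
     (\<forall>w\<in>frames \<Sigma>. \<forall>w'\<in>frames \<Sigma>. \<forall>z\<in>chart_overlap w w'.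
        s w z = transition a w w' z ^ k * s w' (chart_change w w' z))}"

definition scale_section ::
    "complex \<Rightarrow> (int ^ 'n ^ 'n \<Rightarrow> complex ^ 'n \<Rightarrow> complex) \<Rightarrow> int ^ 'n ^ 'n \<Rightarrow> complex ^ 'n \<Rightarrow> complex" where
  "scale_section c s = (\<lambda>w z. c * s w z)"

lemma vector_space_scale_section: "vector_space scale_section"
  by unfold_locales (auto simp: scale_section_def fun_eq_iff algebra_simps)

definition section_dim :: "(int ^ 'n ^ 'n \<Rightarrow> complex ^ 'n \<Rightarrow> complex) set \<Rightarrow> nat" where
  "section_dim V = vector_space.dim scale_section V"

definition big_bundle :: "(real ^ 'n) set set \<Rightarrow> (int ^ 'n \<Rightarrow> int) \<Rightarrow> bool" where
  "big_bundle \<Sigma> a \<longleftrightarrow>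
     limsup (\<lambda>k. ereal (real (section_dim (sections \<Sigma> a k)) / real k ^ CARD('n))) > 0"

section \<open>Singular metrics and multiplier ideals\<close>

text \<open>
  The average over the circle \<open>\<theta> \<mapsto> p + e\<^sup>i\<^sup>\<theta> b\<close>, as the difference of the integrals of the
  positive and the negative part. For an upper semicontinuous \<open>u < \<infinity>\<close> the first
  one is finite.
\<close>

definition circle_mean :: "(complex ^ 'n \<Rightarrow> ereal) \<Rightarrow> complex ^ 'n \<Rightarrow> complex ^ 'n \<Rightarrow> ereal" where
  "circle_mean u p b =
     (enn2ereal (\<integral>\<^sup>+ \<theta>\<in>{0..2*pi}. e2ennreal (u (p + cis \<theta> *s b)) \<partial>lborel)
      - enn2ereal (\<integral>\<^sup>+ \<theta>\<in>{0..2*pi}. e2ennreal (- u (p + cis \<theta> *s b)) \<partial>lborel)) / ereal (2 * pi)"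

definition psh :: "(complex ^ 'n \<Rightarrow> ereal) \<Rightarrow> bool" where
  "psh u \<longleftrightarrow>
     (\<forall>z. u z < \<infinity>) \<and> (\<exists>z. u z \<noteq> -\<infinity>) \<and>
     (\<forall>c. open {z. u z < c}) \<and>
     (\<forall>p b. u p \<le> circle_mean u p b)"

text \<open>
  A singular psh metric on \<open>L\<close> is given by its local weights: \<open>|s|\<^sup>2 = |s\<^sub>w|\<^sup>2 exp(- \<phi>\<^sub>w)\<close>
  on the chart \<open>w\<close>. The compact torus acts on every chart through the coordinates of that chart
  and preserves the moduli of the local trivializations.
\<close>

definition psh_metric ::
    "(real ^ 'n) set set \<Rightarrow> (int ^ 'n \<Rightarrow> int) \<Rightarrow> (int ^ 'n ^ 'n \<Rightarrow> complex ^ 'n \<Rightarrow> ereal) \<Rightarrow> bool" where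
  "psh_metric \<Sigma> a \<phi> \<longleftrightarrow>
     (\<forall>w\<in>frames \<Sigma>. psh (\<phi> w)) \<and>
     (\<forall>w\<in>frames \<Sigma>. \<forall>w'\<in>frames \<Sigma>. \<forall>z\<in>chart_overlap w w'.
        \<phi> w z = \<phi> w' (chart_change w w' z) + ereal (ln ((norm (transition a w w' z))\<^sup>2)))"

definition compact_torus_invariant ::
    "(real ^ 'n) set set \<Rightarrow> (int ^ 'n ^ 'n \<Rightarrow> complex ^ 'n \<Rightarrow> ereal) \<Rightarrow> bool" where
  "compact_torus_invariant \<Sigma> \<phi> \<longleftrightarrow>
     (\<forall>w\<in>frames \<Sigma>. \<forall>t z. (\<forall>i. norm (t $ i) = 1) \<longrightarrow> \<phi> w (\<chi> i. t $ i * z $ i) = \<phi> w z)"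

definition toric_hermitian_big ::
    "(real ^ 'n) set set \<Rightarrow> (int ^ 'n \<Rightarrow> int) \<Rightarrow> (int ^ 'n ^ 'n \<Rightarrow> complex ^ 'n \<Rightarrow> ereal) \<Rightarrow> bool" where
  "toric_hermitian_big \<Sigma> a \<phi> \<longleftrightarrow>
     big_bundle \<Sigma> a \<and> psh_metric \<Sigma> a \<phi> \<and> compact_torus_invariant \<Sigma> \<phi>"

fun exp_ereal :: "ereal \<Rightarrow> ennreal" where
  "exp_ereal (ereal r) = ennreal (exp r)"
| "exp_ereal PInfty = \<infinity>"
| "exp_ereal MInfty = 0"

text \<open>The germ of \<open>f\<close> at \<open>p\<close> lies in the multiplier ideal of the weight \<open>u\<close>.\<close>

definition in_multiplier_ideal ::
    "(complex ^ 'n \<Rightarrow> ereal) \<Rightarrow> complex ^ 'n \<Rightarrow> (complex ^ 'n \<Rightarrow> complex) \<Rightarrow> bool" where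
  "in_multiplier_ideal u p f \<longleftrightarrow>
     (\<exists>r>0. (\<integral>\<^sup>+ z\<in>ball p r. ennreal ((norm (f z))\<^sup>2) * exp_ereal (- u z) \<partial>lborel) < \<infinity>)"

text \<open>\<open>H\<^sup>0(X, L\<^sup>k \<otimes> I(k\<phi>))\<close>\<close>

definition multiplier_sections ::
    "(real ^ 'n) set set \<Rightarrow> (int ^ 'n \<Rightarrow> int) \<Rightarrow> (int ^ 'n ^ 'n \<Rightarrow> complex ^ 'n \<Rightarrow> ereal) \<Rightarrow> nat
      \<Rightarrow> (int ^ 'n ^ 'n \<Rightarrow> complex ^ 'n \<Rightarrow> complex) set" where
  "multiplier_sections \<Sigma> a \<phi> k =
     {s \<in> sections \<Sigma> a k. \<forall>w\<in>frames \<Sigma>. \<forall>p. in_multiplier_ideal (\<lambda>z. ereal (real k) * \<phi> w z) p (s w)}"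

definition metric_volume ::
    "(real ^ 'n) set set \<Rightarrow> (int ^ 'n \<Rightarrow> int) \<Rightarrow> (int ^ 'n ^ 'n \<Rightarrow> complex ^ 'n \<Rightarrow> ereal) \<Rightarrow> real" where
  "metric_volume \<Sigma> a \<phi> =
     lim (\<lambda>k. real (section_dim (multiplier_sections \<Sigma> a \<phi> k)) / real k ^ CARD('n))"

section \<open>The valuation of a flag and the partial Okounkov body\<close>

definition vanishing_order :: "'n \<Rightarrow> (complex ^ 'n \<Rightarrow> complex) \<Rightarrow> nat" where
  "vanishing_order i f =
     (GREATEST m. \<exists>g. holomorphic_fun g \<and> (\<forall>z. f z = z $ i ^ m * g z))"

definition leading_restriction ::
    "'n \<Rightarrow> (complex ^ 'n \<Rightarrow> complex) \<Rightarrow> complex ^ 'n \<Rightarrow> complex" where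
  "leading_restriction i f =
     (let g = (SOME g. holomorphic_fun g \<and> (\<forall>z. f z = z $ i ^ vanishing_order i f * g z))
      in (\<lambda>z. g (\<chi> j. if j = i then 0 else z $ j)))"

text \<open>
  A function on \<open>{z\<^sub>i = 0}\<close> is encoded as a function on \<open>\<complex>\<^sup>n\<close> that does not depend on \<open>z\<^sub>i\<close>.
\<close>

fun iterated_orders :: "'n list \<Rightarrow> (complex ^ 'n \<Rightarrow> complex) \<Rightarrow> 'n \<Rightarrow> nat" where
  "iterated_orders [] f = (\<lambda>_. 0)"
| "iterated_orders (i # is) f =
     (iterated_orders is (leading_restriction i f))(i := vanishing_order i f)"

text \<open>
  The divisors of a flag \<open>v\<close> are ordered by their indices, the linear order of the index type \<open>'n\<close>
  playing the role of \<open>1 < \<dots> < n\<close>. The point \<open>Y\<^sub>n\<close> is the origin of the chart \<open>v\<close>.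
\<close>

definition flag_valuation ::
    "int ^ 'n::{finite,linorder} ^ 'n::{finite,linorder} \<Rightarrow> (int ^ 'n::{finite,linorder} ^ 'n::{finite,linorder} \<Rightarrow> complex ^ 'n::{finite,linorder} \<Rightarrow> complex) \<Rightarrow> 'n::{finite,linorder} \<Rightarrow> nat" where
  "flag_valuation v s = iterated_orders (sorted_list_of_set UNIV) (s v)"

definition okounkov_level ::
    "(real ^ 'n::{finite,linorder}) set set \<Rightarrow> (int ^ 'n::{finite,linorder} \<Rightarrow> int) \<Rightarrow> (int ^ 'n::{finite,linorder} ^ 'n::{finite,linorder} \<Rightarrow> complex ^ 'n::{finite,linorder} \<Rightarrow> ereal)
      \<Rightarrow> int ^ 'n::{finite,linorder} ^ 'n::{finite,linorder} \<Rightarrow> nat \<Rightarrow> (real ^ 'n::{finite,linorder}) set" where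
  "okounkov_level \<Sigma> a \<phi> v k =
     convex hull ((\<lambda>s. \<chi> i. real (flag_valuation v s i) / real k) ` (multiplier_sections \<Sigma> a \<phi> k - {0}))"

text \<open>Convergence in the Hausdorff metric on nonempty compact sets.\<close>

definition hausdorff_converges :: "(nat \<Rightarrow> 'a::metric_space set) \<Rightarrow> 'a set \<Rightarrow> bool" where
  "hausdorff_converges A K \<longleftrightarrow> compact K \<and> K \<noteq> {} \<and>
     (\<forall>\<epsilon>>0. \<forall>\<^sub>F k in sequentially.
        (\<forall>x\<in>A k. \<exists>y\<in>K. dist x y < \<epsilon>) \<and> (\<forall>y\<in>K. \<exists>x\<in>A k. dist x y < \<epsilon>))"

definition partial_okounkov_body ::
    "(real ^ 'n::{finite,linorder}) set set \<Rightarrow> (int ^ 'n::{finite,linorder} \<Rightarrow> int) \<Rightarrow> (int ^ 'n::{finite,linorder} ^ 'n::{finite,linorder} \<Rightarrow> complex ^ 'n::{finite,linorder} \<Rightarrow> ereal)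
      \<Rightarrow> int ^ 'n::{finite,linorder} ^ 'n::{finite,linorder} \<Rightarrow> (real ^ 'n::{finite,linorder}) set" where
  "partial_okounkov_body \<Sigma> a \<phi> v = (THE K. hausdorff_converges (okounkov_level \<Sigma> a \<phi> v) K)"

section \<open>The convex function of an invariant metric\<close>

text \<open>
  The invariant divisor \<open>D\<close> linearly equivalent to \<open>\<Sum> a(\<rho>) D\<^sub>\<rho>\<close> that vanishes on the chart \<open>v\<close>.
  It is \<open>\<Sum> a(\<rho>) D\<^sub>\<rho> + div(\<chi>\<^sup>m)\<close> with \<open>\<langle>m, v\<^sub>j\<rangle> = - a(v\<^sub>j)\<close>; the row vector
  \<open>\<rho> v* matrix_inv v\<close> holds the coordinates of \<open>\<rho>\<close> in the basis \<open>v\<close>.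
\<close>

definition normalized_divisor :: "(int ^ 'n \<Rightarrow> int) \<Rightarrow> int ^ 'n ^ 'n \<Rightarrow> int ^ 'n \<Rightarrow> int" where
  "normalized_divisor a v \<rho> = a \<rho> - (\<Sum>j\<in>UNIV. (\<rho> v* matrix_inv v) $ j * a (v $ j))"

text \<open>
  The local expression on the chart \<open>w\<close> of the rational section \<open>1\<close> of \<open>\<O>(\<Sum> d(\<rho>) D\<^sub>\<rho>)\<close>.
  Linearly equivalent invariant divisors have the same \<open>transition\<close> functions, and multiplication by
  the character relating them is the identity on local expressions; so for
  \<open>d = normalized_divisor a v\<close> this is also the local expression of the corresponding rational section
  \<open>s\<^sub>0\<close> of \<open>L\<close>.
\<close>

definition canonical_section :: "(int ^ 'n \<Rightarrow> int) \<Rightarrow> int ^ 'n ^ 'n \<Rightarrow> complex ^ 'n \<Rightarrow> complex" where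
  "canonical_section d w z = (\<Prod>i\<in>UNIV. z $ i powi d (w $ i))"

text \<open>\<open>- log |s\<^sub>0|\<^sup>2\<close> on the open orbit, in the coordinates of the chart \<open>v\<close>.\<close>

definition orbit_weight ::
    "(int ^ 'n \<Rightarrow> int) \<Rightarrow> (int ^ 'n ^ 'n \<Rightarrow> complex ^ 'n \<Rightarrow> ereal) \<Rightarrow> int ^ 'n ^ 'n \<Rightarrow> complex ^ 'n \<Rightarrow> ereal" where
  "orbit_weight a \<phi> v z =
     \<phi> v z - ereal (ln ((norm (canonical_section (normalized_divisor a v) v z))\<^sup>2))"

text \<open>
  Evaluated at the positive real point with \<open>log |z\<^sub>i|\<^sup>2 = x\<^sub>i\<close>; by invariance any other such point
  gives the same value. An invariant psh weight is finite on the open orbit.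
\<close>

definition potential ::
    "(int ^ 'n \<Rightarrow> int) \<Rightarrow> (int ^ 'n ^ 'n \<Rightarrow> complex ^ 'n \<Rightarrow> ereal) \<Rightarrow> int ^ 'n ^ 'n \<Rightarrow> real ^ 'n \<Rightarrow> real" where
  "potential a \<phi> v x =
     real_of_ereal (orbit_weight a \<phi> v (\<chi> i. complex_of_real (exp (x $ i / 2))))"

definition subgradient_image :: "('a::real_inner \<Rightarrow> real) \<Rightarrow> 'a set" where
  "subgradient_image f = {p. \<exists>x. \<forall>y. f y \<ge> f x + p \<bullet> (y - x)}"

end

theory Submission
  imports Defs "HOL-Complex_Analysis.Cauchy_Integral_Formula" "HOL-Computational_Algebra.Polynomial"
begin

text \<open>
  Put \<open>f = \<phi>\<^sub>\<real>\<close> and let \<open>D\<close> be the set of slopes \<open>p\<close> of affine minorants of \<open>f\<close>; it is convex and has the same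
  closure as the set of subgradients. A section of \<open>L\<^sup>k\<close> is a Laurent polynomial on the orbit, and its valuation is one
  of its exponents. If \<open>\<alpha>/k \<in> D\<close>, then \<open>|z\<^sup>\<alpha>|\<^sup>2 exp (- k \<phi>)\<close> is bounded, so \<open>z\<^sup>\<alpha>\<close> is a section of
  \<open>L\<^sup>k \<otimes> I(k\<phi>)\<close>. Conversely, if \<open>z\<^sup>\<alpha>\<close> occurs in such a section, integrability on the charts of a
  finite set of cones covering \<open>N\<^sub>\<real>\<close> gives \<open>\<langle>\<alpha>, x\<rangle> - k f(x) \<le> C + c |x|\<close> with \<open>c\<close> independent of \<open>k\<close> and \<open>\<alpha>\<close>, so
  \<open>\<alpha>/k\<close> is within \<open>O(1/k)\<close> of \<open>D\<close>. Hence the valuation polytopes converge to the closure of \<open>D\<close> as soon as \<open>D\<close> has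
  interior points, and otherwise the exponents lie within bounded distance of a hyperplane and the volume is \<open>0\<close>.
\<close>

section \<open>Convexity of invariant plurisubharmonic functions in logarithmic coordinates\<close>

text \<open>A plurisubharmonic weight is given only as an upper semicontinuous function with the
  circle mean inequality. Convexity and finiteness of \<open>f\<close> on the orbit must therefore
  be derived without second derivatives; quadratic test functions at a maximum replace them.
  Characters are isolated not by averaging over the compact torus but by comparing a function with
  its pullback under z_i -> z_i / 2. This map preserves polydiscs and the orbit, scales Lebesgue
  measure by a constant and moves log|z|^2 by a bounded vector, so it respects every condition in
  play: vanishing, boundedness, weighted square integrability. Uniformity of \<open>c\<close> is the
  crucial point. Passing from an integral to a pointwise bound costs the volume of a ball of radius
  about min |z_i|, which is exp(-c|x|) up to a factor, with \<open>c\<close> depending on the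
  dimension and the charts alone. Everything that depends on \<open>k\<close> and \<alpha> enters
  the additive constant \<open>C\<close>, which has no influence on slopes. After division by
  \<open>k\<close> the slope error is \<open>c/k\<close>, and a quadratic perturbation turns the
  approximate minorant into an exact one, enlarging the error to \<open>(2c+1)/k\<close>.\<close>

lemma circle_mean_le:
  fixes u :: "complex ^ 'n \<Rightarrow> ereal" and q :: "real \<Rightarrow> real"
  assumes q: "continuous_on {0..2*pi} q"
    and le: "\<And>\<theta>. \<theta> \<in> {0..2*pi} \<Longrightarrow> u (p + cis \<theta> *s b) \<le> ereal (q \<theta>)"
  shows "circle_mean u p b \<le> ereal (integral {0..2*pi} q / (2*pi))"
proof -
  let ?I = "{0..2*pi}"
  have nn: "(\<integral>\<^sup>+ \<theta>\<in>?I. ennreal (g \<theta>) \<partial>lborel) = ennreal (integral ?I g)"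
    if g: "continuous_on ?I g" "\<And>x. g x \<ge> 0" for g :: "real \<Rightarrow> real"
  proof -
    have si: "set_integrable lborel ?I g"
      by (rule borel_integrable_atLeastAtMost') (rule g)
    have "(\<integral>\<^sup>+ \<theta>\<in>?I. ennreal (g \<theta>) \<partial>lborel) = (\<integral>\<^sup>+ \<theta>. ennreal (indicator ?I \<theta> *\<^sub>R g \<theta>) \<partial>lborel)"
      by (intro nn_integral_cong) (auto simp: indicator_def)
    also have "\<dots> = ennreal (LINT \<theta>:?I|lborel. g \<theta>)"
      unfolding set_lebesgue_integral_def
      using si g(2) by (intro nn_integral_eq_integral) (auto simp: set_integrable_def)
    also have "\<dots> = ennreal (integral ?I g)"
      using set_borel_integral_eq_integral(2)[OF si] by simp
    finally show ?thesis .
  qed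
  \<comment> \<open>The finite bound \<open>P\<close> on the integral of the positive part rules out
    \<infinity> - \<infinity> in the difference that defines the mean; \<open>N\<close> bounds the
    other integral from below.\<close>
  define P where "P = integral ?I (\<lambda>\<theta>. max 0 (q \<theta>))"
  define N where "N = integral ?I (\<lambda>\<theta>. max 0 (- q \<theta>))"
  have c1: "continuous_on ?I (\<lambda>\<theta>. max 0 (q \<theta>))" "continuous_on ?I (\<lambda>\<theta>. max 0 (- q \<theta>))"
    by (intro continuous_intros q)+
  have pn: "P \<ge> 0" "N \<ge> 0"
    unfolding P_def N_def by (intro integral_nonneg integrable_continuous_interval c1; simp)+
  have PN: "integral ?I q = P - N"
    unfolding P_def N_def
    by (subst integral_diff[symmetric])
      (auto intro!: integrable_continuous_interval c1 integral_cong)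
  have A: "(\<integral>\<^sup>+ \<theta>\<in>?I. e2ennreal (u (p + cis \<theta> *s b)) \<partial>lborel) \<le> ennreal P"
    unfolding P_def nn[OF c1(1), simplified, symmetric]
  proof (rule nn_integral_mono)
    fix \<theta>
    have "e2ennreal (u (p + cis \<theta> *s b)) \<le> ennreal (max 0 (q \<theta>))" if "\<theta> \<in> ?I"
      using e2ennreal_mono[OF le[OF that]]
      by (cases "q \<theta> \<ge> 0") (simp_all add: e2ennreal_ereal ennreal_neg)
    then show "e2ennreal (u (p + cis \<theta> *s b)) * indicator ?I \<theta> \<le> ennreal (max 0 (q \<theta>)) * indicator ?I \<theta>"
      by (auto simp: indicator_def)
  qed
  have B: "ennreal N \<le> (\<integral>\<^sup>+ \<theta>\<in>?I. e2ennreal (- u (p + cis \<theta> *s b)) \<partial>lborel)"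
    unfolding N_def nn[OF c1(2), simplified, symmetric]
  proof (rule nn_integral_mono)
    fix \<theta>
    have "ennreal (max 0 (- q \<theta>)) \<le> e2ennreal (- u (p + cis \<theta> *s b))" if "\<theta> \<in> ?I"
    proof -
      have "ereal (- q \<theta>) \<le> - u (p + cis \<theta> *s b)"
        using le[OF that] by (metis ereal_minus_le_minus uminus_ereal.simps(1))
      from e2ennreal_mono[OF this] show ?thesis
        by (cases "- q \<theta> \<ge> 0") (simp_all add: e2ennreal_ereal ennreal_neg)
    qed
    then show "ennreal (max 0 (- q \<theta>)) * indicator ?I \<theta> \<le> e2ennreal (- u (p + cis \<theta> *s b)) * indicator ?I \<theta>"
      by (auto simp: indicator_def)
  qed
  have "enn2ereal (\<integral>\<^sup>+ \<theta>\<in>?I. e2ennreal (u (p + cis \<theta> *s b)) \<partial>lborel)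
      - enn2ereal (\<integral>\<^sup>+ \<theta>\<in>?I. e2ennreal (- u (p + cis \<theta> *s b)) \<partial>lborel) \<le> ereal P - ereal N"
    using A B pn by (intro ereal_minus_mono) (metis enn2ereal_ennreal less_eq_ennreal.rep_eq)+
  then have "circle_mean u p b \<le> (ereal P - ereal N) / ereal (2*pi)"
    unfolding circle_mean_def by (intro ereal_divide_right_mono) auto
  then show ?thesis by (simp add: PN)
qed

text \<open>The mean value property of the harmonic function log |1 + c z|: Cauchy's formula at the
  centre for \<open>Ln (1 + c z)\<close>, holomorphic on the closed disc because |c| < 1. The real
  part of \<open>Ln\<close> appears as the imaginary part of \<open>\<i> * Ln\<close>.\<close>

lemma has_integral_ln_norm_one_plus_cis:
  assumes "\<bar>c\<bar> < 1"
  shows "((\<lambda>\<theta>. ln (norm (1 + of_real c * cis \<theta>))) has_integral 0) {0..2*pi}"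
proof -
  have pos: "Re (1 + of_real c * z) > 0" if "norm z \<le> 1" for z
  proof -
    have "\<bar>Re (of_real c * z)\<bar> \<le> norm (of_real c * z)" by (rule abs_Re_le_cmod)
    also have "\<dots> \<le> \<bar>c\<bar> * 1" unfolding norm_mult using that by (intro mult_mono) auto
    finally show ?thesis using assms by auto
  qed
  have hol: "(\<lambda>z. Ln (1 + of_real c * z)) holomorphic_on cball 0 1"
    using pos by (intro holomorphic_intros) (auto simp: complex_nonpos_Reals_iff, force)
  have "((\<lambda>z. Ln (1 + of_real c * z) / (z - 0)) has_contour_integral
      (2 * of_real pi * \<i> * Ln (1 + of_real c * 0))) (circlepath 0 1)"
    by (rule Cauchy_integral_circlepath_simple[OF hol]) auto
  then have "((\<lambda>t. Ln (1 + of_real c * cis t) / cis t * \<i> * cis t) has_integral 0) {0..2*pi}"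
    unfolding circlepath_def by (subst (asm) has_contour_integral_part_circlepath_iff) auto
  then have "((\<lambda>t. Im (Ln (1 + of_real c * cis t) / cis t * \<i> * cis t)) has_integral Im 0) {0..2*pi}"
    by (rule has_integral_Im)
  moreover have "Im (Ln (1 + of_real c * cis t) / cis t * \<i> * cis t) = ln (norm (1 + of_real c * cis t))" for t
  proof -
    have "1 + of_real c * cis t \<noteq> 0" using pos[of "cis t"] by (metis less_irrefl norm_cis order_refl zero_complex.sel(1))
    then show ?thesis by (simp add: Re_Ln)
  qed
  ultimately show ?thesis by simp
qed

section \<open>Logarithmic coordinates on the open orbit\<close>

definition expv :: "real ^ 'n \<Rightarrow> complex ^ 'n" where
  "expv x = (\<chi> i. complex_of_real (exp (x $ i / 2)))"

definition Lg :: "complex ^ 'n \<Rightarrow> real ^ 'n" where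
  "Lg z = (\<chi> i. ln ((norm (z $ i))\<^sup>2))"

definition orbit :: "(complex ^ 'n) set" where
  "orbit = {z. \<forall>i. z $ i \<noteq> 0}"

lemma expv_in_orbit [simp]: "expv x \<in> orbit"
  by (simp add: orbit_def expv_def)

lemma Lg_expv [simp]: "Lg (expv x) = x"
  by (simp add: vec_eq_iff Lg_def expv_def ln_realpow)

definition rotation_invariant :: "(complex ^ 'n \<Rightarrow> 'b) \<Rightarrow> bool" where
  "rotation_invariant u \<longleftrightarrow> (\<forall>t z. (\<forall>i. norm (t $ i) = 1) \<longrightarrow> u (\<chi> i. t $ i * z $ i) = u z)"

lemma rotation_invariant_eq_expv:
  assumes "rotation_invariant u" "z \<in> orbit"
  shows "u z = u (expv (Lg z))"
proof -
  let ?t = "\<chi> i. z $ i / of_real (norm (z $ i))"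
  have nz: "z $ i \<noteq> 0" for i using assms(2) by (simp add: orbit_def)
  have e: "exp (ln ((norm (z $ i))\<^sup>2) / 2) = norm (z $ i)" for i
    using nz[of i] by (simp add: ln_realpow)
  have "\<forall>i. norm (?t $ i) = 1" using nz by (simp add: norm_divide)
  then have "u (\<chi> i. ?t $ i * expv (Lg z) $ i) = u (expv (Lg z))"
    using assms(1) unfolding rotation_invariant_def by blast
  moreover have "(\<chi> i. ?t $ i * expv (Lg z) $ i) = z"
    using nz by (simp add: vec_eq_iff expv_def Lg_def e)
  ultimately show ?thesis by simp
qed

section \<open>Maxima of upper semicontinuous functions and test functions\<close>

text \<open>If no value were maximal, the open sets \<open>{x. G x < G y}\<close> with
  \<open>y\<close> in \<open>D\<close> would cover \<open>D\<close>; but a point where the largest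
  of the values used in a finite subcover is taken lies outside all of its members.\<close>

lemma upper_semicontinuous_attains_sup:
  fixes G :: "'a::topological_space \<Rightarrow> ereal"
  assumes "compact D" "D \<noteq> {}" and op: "\<And>c. open {x. G x < c}"
  shows "\<exists>x\<in>D. \<forall>y\<in>D. G y \<le> G x"
proof (rule ccontr)
  assume "\<not> ?thesis"
  then have "D \<subseteq> (\<Union>y\<in>D. {x. G x < G y})" by (force simp: not_le)
  with \<open>compact D\<close> obtain Y where Y: "Y \<subseteq> D" "finite Y" "D \<subseteq> (\<Union>y\<in>Y. {x. G x < G y})"
    by (elim compactE_image[where f = "\<lambda>y. {x. G x < G y}"]) (auto intro: op)
  with \<open>D \<noteq> {}\<close> have "Y \<noteq> {}" by auto
  with \<open>finite Y\<close> have "Max (G ` Y) \<in> G ` Y" by simp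
  then obtain y where y: "y \<in> Y" "G y = Max (G ` Y)" by auto
  then obtain y' where "y' \<in> Y" "G y < G y'" using Y by blast
  with y \<open>finite Y\<close> show False by (metis Max_ge finite_imageI image_eqI leD)
qed

text \<open>Inserting real numbers \<open>q\<close> and \<open>m\<close> separates the condition
  into one on \<open>F\<close> and one on \<open>Q\<close>, each open, and the set is the union over
  all admissible pairs.\<close>

lemma upper_semicontinuous_minus_continuous:
  fixes F :: "'a::topological_space \<Rightarrow> ereal" and Q :: "'a \<Rightarrow> real"
  assumes op: "\<And>c. open {x. F x < c}" and Q: "continuous_on UNIV Q"
  shows "open {x. F x - ereal (Q x) < c}"
proof -
  have "{x. F x - ereal (Q x) < c} = (\<Union>(q, m)\<in>{(q, m). ereal m \<le> c}. {x. F x < ereal q} \<inter> {x. q - Q x < m})"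
  proof (intro equalityI subsetI)
    fix x assume "x \<in> {x. F x - ereal (Q x) < c}"
    then obtain m where m: "F x - ereal (Q x) < ereal m" "ereal m < c" using ereal_dense2 by blast
    then have "F x < ereal (Q x + m)" by (cases "F x") auto
    then obtain q where "F x < ereal q" "ereal q < ereal (Q x + m)" using ereal_dense2 by blast
    with m show "x \<in> (\<Union>(q, m)\<in>{(q, m). ereal m \<le> c}. {x. F x < ereal q} \<inter> {x. q - Q x < m})"
      by (intro UN_I[of "(q, m)"]) auto
  next
    fix x assume "x \<in> (\<Union>(q, m)\<in>{(q, m). ereal m \<le> c}. {x. F x < ereal q} \<inter> {x. q - Q x < m})"
    then obtain q m where "ereal m \<le> c" "F x < ereal q" "q - Q x < m" by auto
    then have "F x - ereal (Q x) < ereal m" by (cases "F x") auto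
    with \<open>ereal m \<le> c\<close> show "x \<in> {x. F x - ereal (Q x) < c}" by simp
  qed
  moreover have "open {x. q - Q x < m}" for q m
    by (intro open_Collect_less continuous_intros Q)
  ultimately show ?thesis by (auto intro!: open_UN op)
qed

lemma has_integral_cos_squared: "((\<lambda>\<theta>. (cos \<theta>)\<^sup>2) has_integral pi) {0..2*pi}"
proof -
  have "((\<lambda>\<theta>. (cos \<theta>)\<^sup>2) has_integral (((2*pi)/2 + sin (2*(2*pi))/4) - (0/2 + sin (2*0)/4))) {0..2*pi}"
  proof (rule fundamental_theorem_of_calculus)
    fix x :: real
    have "((\<lambda>\<theta>. \<theta>/2 + sin (2*\<theta>)/4) has_real_derivative (1/2 + cos (2*x)/2)) (at x within {0..2*pi})"
      by (auto intro!: derivative_eq_intros)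
    then show "((\<lambda>\<theta>. \<theta>/2 + sin (2*\<theta>)/4) has_vector_derivative (cos x)\<^sup>2) (at x within {0..2*pi})"
      by (simp add: has_real_derivative_iff_has_vector_derivative cos_double_cos diff_divide_distrib)
  qed simp
  moreover have "sin (2*(2*pi)) = 0" using sin_npi[of 4] by (simp add: mult.commute)
  ultimately show ?thesis by simp
qed

text \<open>
  An upper test function that is strictly concave along \<open>d\<close> in logarithmic coordinates has negative Levi
  form along the disc \<open>z\<^sub>j (1 + \<rho> d\<^sub>j \<zeta>)\<close>, which contradicts the mean value inequality.
\<close>

lemma no_concave_upper_test_function:
  fixes u :: "complex ^ 'n \<Rightarrow> ereal" and x d g :: "real ^ 'n"
  assumes sub: "\<And>p b. u p \<le> circle_mean u p b" and inv: "rotation_invariant u"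
    and fin: "u (expv x) = ereal Fx" and d: "norm d = 1" and r: "r > 0" and \<eta>: "\<eta> > 0" and K: "K \<ge> 0"
    and test: "\<And>\<delta>. norm \<delta> < r \<Longrightarrow>
      u (expv (x + \<delta>)) \<le> ereal (Fx + g \<bullet> \<delta> - \<eta> * (\<delta> \<bullet> d)\<^sup>2 + K * (norm (\<delta> - (\<delta> \<bullet> d) *\<^sub>R d))\<^sup>2)"
  shows False
proof -
  define C where "C = 4 * real CARD('n)"
  have C: "C > 0" by (simp add: C_def)
  \<comment> \<open>The third bound keeps the disc inside the range of the test inequality; the
    fourth makes the error of order \<rho>^4 smaller than the gain \<eta> \<rho>^2 from strict
    concavity.\<close>
  obtain \<rho> where \<rho>: "0 < \<rho>" "\<rho> < 1/2" "2*\<rho> + C * \<rho>\<^sup>2 < r" "(\<eta> + K) * C\<^sup>2 * \<rho>\<^sup>2 < \<eta>"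
  proof -
    have "((\<lambda>\<rho>. 2*\<rho> + C * \<rho>\<^sup>2) \<longlongrightarrow> 2*0 + C*0\<^sup>2) (at_right 0)" by (intro tendsto_intros)
    then have "\<forall>\<^sub>F \<rho> in at_right 0. 2*\<rho> + C * \<rho>\<^sup>2 < r" using r by (intro order_tendstoD) auto
    moreover have "((\<lambda>\<rho>. (\<eta> + K) * C\<^sup>2 * \<rho>\<^sup>2) \<longlongrightarrow> (\<eta> + K) * C\<^sup>2 * 0\<^sup>2) (at_right 0)" by (intro tendsto_intros)
    then have "\<forall>\<^sub>F \<rho> in at_right 0. (\<eta> + K) * C\<^sup>2 * \<rho>\<^sup>2 < \<eta>" using \<eta> by (intro order_tendstoD) auto
    moreover have "((\<lambda>\<rho>. \<rho>) \<longlongrightarrow> (0::real)) (at_right 0)" by (intro tendsto_intros)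
    then have "\<forall>\<^sub>F \<rho> in at_right 0. \<rho> < (1/2::real)" by (intro order_tendstoD) auto
    moreover have "\<forall>\<^sub>F \<rho> in at_right 0. (0::real) < \<rho>" by (rule eventually_at_right_less)
    ultimately have "\<forall>\<^sub>F \<rho> in at_right 0. 0 < \<rho> \<and> \<rho> < 1/2 \<and> 2*\<rho> + C * \<rho>\<^sup>2 < r \<and> (\<eta> + K) * C\<^sup>2 * \<rho>\<^sup>2 < \<eta>"
      by eventually_elim simp
    from eventually_happens'[OF _ this] show ?thesis using that by auto
  qed
  \<comment> \<open>\<open>\<delta> \<theta>\<close> is the displacement in logarithmic coordinates
    along the circle with radius vector \<open>b\<close>; its linear part is
    \<open>2 * \<rho> * cos \<theta>\<close> times \<open>d\<close>, and \<open>e \<theta>\<close>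
    is the remainder, of order \<rho>^2.\<close>
  define \<delta> where "\<delta> \<theta> = (\<chi> j. 2 * ln (norm (1 + of_real (\<rho> * d $ j) * cis \<theta>)))" for \<theta>
  define e where "e \<theta> = \<delta> \<theta> - (2 * \<rho> * cos \<theta>) *\<^sub>R d" for \<theta>
  define b where "b = (\<chi> j. complex_of_real (\<rho> * d $ j * exp (x $ j / 2)))"
  have dj: "\<bar>d $ j\<bar> \<le> 1" for j using component_le_norm_cart[of d j] d by simp
  have \<rho>d: "\<bar>\<rho> * d $ j\<bar> \<le> \<rho>" for j
    using mult_left_mono[OF dj[of j], of \<rho>] \<rho> by (simp add: abs_mult)
  have \<rho>d': "\<bar>\<rho> * d $ j\<bar> < 1/2" for j using \<rho>d[of j] \<rho> by linarith
  have nz: "1 + of_real (\<rho> * d $ j) * cis \<theta> \<noteq> 0" for j \<theta>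
  proof
    assume "1 + of_real (\<rho> * d $ j) * cis \<theta> = 0"
    then have "of_real (\<rho> * d $ j) * cis \<theta> = -1" by (simp add: eq_neg_iff_add_eq_0 add.commute)
    then have "norm (of_real (\<rho> * d $ j) * cis \<theta>) = 1" by simp
    then show False using \<rho>d'[of j] by (simp add: norm_mult abs_mult)
  qed
  have ej: "\<bar>e \<theta> $ j\<bar> \<le> 4 * \<rho>\<^sup>2" for \<theta> j
  proof -
    let ?w = "of_real (\<rho> * d $ j) * cis \<theta>"
    have nw: "norm ?w = \<bar>\<rho> * d $ j\<bar>" by (simp add: norm_mult abs_mult)
    have "\<bar>Re (Ln (1 + ?w) - ?w)\<bar> \<le> norm (Ln (1 + ?w) - ?w)" by (rule abs_Re_le_cmod)
    also have "\<dots> \<le> (norm ?w)\<^sup>2 / (1 - norm ?w)"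
      using \<rho>d'[of j] by (intro Ln_approx_linear) (simp only: nw)
    also have "\<dots> \<le> \<rho>\<^sup>2 / (1/2)"
      using \<rho>d'[of j] \<rho>d[of j] \<rho> unfolding nw by (intro frac_le power_mono) auto
    finally have "\<bar>ln (norm (1 + ?w)) - \<rho> * d $ j * cos \<theta>\<bar> \<le> 2 * \<rho>\<^sup>2"
      using nz[of j \<theta>] by (simp add: Re_Ln)
    then have "\<bar>2 * (ln (norm (1 + ?w)) - \<rho> * d $ j * cos \<theta>)\<bar> \<le> 4 * \<rho>\<^sup>2"
      unfolding abs_mult by simp
    moreover have "e \<theta> $ j = 2 * (ln (norm (1 + ?w)) - \<rho> * d $ j * cos \<theta>)"
      by (simp add: e_def \<delta>_def right_diff_distrib)
    ultimately show ?thesis by simp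
  qed
  have ne: "norm (e \<theta>) \<le> C * \<rho>\<^sup>2" for \<theta>
  proof -
    have "norm (e \<theta>) \<le> (\<Sum>j\<in>UNIV. \<bar>e \<theta> $ j\<bar>)" by (rule norm_le_l1_cart)
    also have "\<dots> \<le> (\<Sum>j\<in>(UNIV::'n set). 4 * \<rho>\<^sup>2)" by (intro sum_mono ej)
    also have "\<dots> = C * \<rho>\<^sup>2" by (simp add: C_def)
    finally show ?thesis .
  qed
  have \<delta>e: "\<delta> \<theta> = (2 * \<rho> * cos \<theta>) *\<^sub>R d + e \<theta>" for \<theta> by (simp add: e_def)
  have n\<delta>: "norm (\<delta> \<theta>) < r" for \<theta>
  proof -
    have "norm (\<delta> \<theta>) \<le> norm ((2 * \<rho> * cos \<theta>) *\<^sub>R d) + norm (e \<theta>)"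
      unfolding \<delta>e by (rule norm_triangle_ineq)
    also have "norm ((2 * \<rho> * cos \<theta>) *\<^sub>R d) \<le> 2 * \<rho>"
      using \<rho> d by (simp add: abs_mult mult_left_le)
    finally show ?thesis using ne[of \<theta>] \<rho> by linarith
  qed
  \<comment> \<open>The linear term keeps the exact \<open>\<delta>\<close>, whose components have
    mean 0. Linearising it would leave an error of order \<rho>^2, as large as the gain.\<close>
  define q where "q \<theta> = Fx + (\<Sum>j\<in>UNIV. g $ j * \<delta> \<theta> $ j) - 2 * \<eta> * \<rho>\<^sup>2 * (cos \<theta>)\<^sup>2 + (\<eta> + K) * (C * \<rho>\<^sup>2)\<^sup>2" for \<theta>
  have bound: "u (expv x + cis \<theta> *s b) \<le> ereal (q \<theta>)" for \<theta>
  proof -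
    have comp: "(expv x + cis \<theta> *s b) $ j = of_real (exp (x $ j / 2)) * (1 + of_real (\<rho> * d $ j) * cis \<theta>)" for j
      by (simp add: expv_def b_def algebra_simps)
    have orb: "expv x + cis \<theta> *s b \<in> orbit"
      unfolding orbit_def using nz[of _ \<theta>] by (simp only: comp mem_Collect_eq) simp
    have "Lg (expv x + cis \<theta> *s b) $ j = (x + \<delta> \<theta>) $ j" for j
    proof -
      have "ln ((norm ((expv x + cis \<theta> *s b) $ j))\<^sup>2)
          = ln ((exp (x $ j / 2) * norm (1 + of_real (\<rho> * d $ j) * cis \<theta>))\<^sup>2)"
        unfolding comp norm_mult by simp
      also have "\<dots> = x $ j + 2 * ln (norm (1 + of_real (\<rho> * d $ j) * cis \<theta>))"
        using nz[of j \<theta>] by (simp add: ln_realpow ln_mult)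
      finally show ?thesis by (simp add: Lg_def \<delta>_def)
    qed
    then have "Lg (expv x + cis \<theta> *s b) = x + \<delta> \<theta>" by (simp add: vec_eq_iff)
    with rotation_invariant_eq_expv[OF inv orb]
    have "u (expv x + cis \<theta> *s b) = u (expv (x + \<delta> \<theta>))" by simp
    also have "\<dots> \<le> ereal (Fx + g \<bullet> \<delta> \<theta> - \<eta> * (\<delta> \<theta> \<bullet> d)\<^sup>2 + K * (norm (\<delta> \<theta> - (\<delta> \<theta> \<bullet> d) *\<^sub>R d))\<^sup>2)"
      by (rule test[OF n\<delta>])
    also have "\<dots> \<le> ereal (q \<theta>)"
    proof -
      have dd: "d \<bullet> d = 1" using d by (simp add: norm_eq_1)
      define h where "h = e \<theta> \<bullet> d"
      have h: "\<delta> \<theta> \<bullet> d = 2 * \<rho> * cos \<theta> + h" by (simp add: \<delta>e inner_add_left dd h_def)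
      have perp: "\<delta> \<theta> - (\<delta> \<theta> \<bullet> d) *\<^sub>R d = e \<theta> - h *\<^sub>R d"
        unfolding h by (simp add: \<delta>e algebra_simps)
      have "(norm (e \<theta> - h *\<^sub>R d))\<^sup>2 = (norm (e \<theta>))\<^sup>2 - h\<^sup>2"
        unfolding power2_norm_eq_inner by (simp add: inner_diff_left inner_diff_right dd h_def inner_commute power2_eq_square)
      also have "\<dots> \<le> (C * \<rho>\<^sup>2)\<^sup>2"
        using power_mono[OF ne[of \<theta>] norm_ge_zero, of 2] zero_le_power2[of h] by linarith
      finally have 1: "K * (norm (e \<theta> - h *\<^sub>R d))\<^sup>2 \<le> K * (C * \<rho>\<^sup>2)\<^sup>2" using K by (rule mult_left_mono)
      have "\<bar>h\<bar> \<le> norm (e \<theta>) * norm d" unfolding h_def by (rule Cauchy_Schwarz_ineq2)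
      then have "\<bar>h\<bar> \<le> C * \<rho>\<^sup>2" using ne[of \<theta>] d by simp
      then have h2: "h\<^sup>2 \<le> (C * \<rho>\<^sup>2)\<^sup>2"
        using power_mono[of "\<bar>h\<bar>" "C * \<rho>\<^sup>2" 2] by simp
      \<comment> \<open>With A = 2 \<rho> cos \<theta>, the inequality (A + 2h)^2 \<ge> 0 is
        equivalent to (A + h)^2 \<ge> A^2/2 - h^2: half of the quadratic term survives the
        remainder.\<close>
      have "0 \<le> (2 * \<rho> * cos \<theta> + 2 * h)\<^sup>2" by simp
      then have "2 * \<rho>\<^sup>2 * (cos \<theta>)\<^sup>2 - (C * \<rho>\<^sup>2)\<^sup>2 \<le> (2 * \<rho> * cos \<theta> + h)\<^sup>2"
        using h2 by (simp add: power2_eq_square algebra_simps)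
      from mult_left_mono[OF this, of \<eta>] \<eta>
      have "\<eta> * (2 * \<rho>\<^sup>2 * (cos \<theta>)\<^sup>2 - (C * \<rho>\<^sup>2)\<^sup>2) \<le> \<eta> * (\<delta> \<theta> \<bullet> d)\<^sup>2" by (simp add: h)
      moreover have "g \<bullet> \<delta> \<theta> = (\<Sum>j\<in>UNIV. g $ j * \<delta> \<theta> $ j)" by (simp add: inner_vec_def)
      ultimately show ?thesis using 1 unfolding q_def perp by (simp add: algebra_simps)
    qed
    finally show ?thesis .
  qed
  have I0: "((\<lambda>\<theta>. \<delta> \<theta> $ j) has_integral 0) {0..2*pi}" for j
  proof -
    have "\<bar>\<rho> * d $ j\<bar> < 1" using \<rho>d'[of j] by linarith
    from has_integral_mult_right[OF has_integral_ln_norm_one_plus_cis[OF this], of 2]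
    show ?thesis by (simp add: \<delta>_def)
  qed
  have const: "((\<lambda>\<theta>. c) has_integral (2 * pi * c)) {0..2*pi}" for c :: real
    using has_integral_const_real[of c 0 "2*pi"] by simp
  have "(q has_integral (2*pi*Fx + (\<Sum>j\<in>UNIV. g $ j * 0) - 2 * \<eta> * \<rho>\<^sup>2 * pi + 2*pi*((\<eta> + K) * (C * \<rho>\<^sup>2)\<^sup>2))) {0..2*pi}"
    unfolding q_def
    by (intro has_integral_add has_integral_diff const has_integral_sum has_integral_mult_right
        has_integral_cos_squared I0) auto
  then have Iq: "integral {0..2*pi} q = 2*pi*Fx - 2 * \<eta> * \<rho>\<^sup>2 * pi + 2*pi*((\<eta> + K) * (C * \<rho>\<^sup>2)\<^sup>2)"
    by (simp add: integral_unique)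
  have cont: "continuous_on {0..2*pi} q"
    unfolding q_def \<delta>_def using nz
    by (auto intro!: continuous_intros simp: cis_conv_exp)
  have "ereal Fx \<le> circle_mean u (expv x) b" using sub fin by metis
  also have "\<dots> \<le> ereal (integral {0..2*pi} q / (2*pi))"
    by (intro circle_mean_le cont bound)
  finally have "Fx \<le> integral {0..2*pi} q / (2*pi)" by simp
  also have "\<dots> = Fx - \<eta> * \<rho>\<^sup>2 + (\<eta> + K) * (C * \<rho>\<^sup>2)\<^sup>2"
    unfolding Iq by (simp add: field_simps)
  finally have "\<eta> * \<rho>\<^sup>2 \<le> ((\<eta> + K) * C\<^sup>2 * \<rho>\<^sup>2) * \<rho>\<^sup>2" by (simp add: power2_eq_square mult_ac)
  with \<rho>(1,4) show False by (simp add: mult_less_cancel_right_pos leD)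
qed

text \<open>A maximum principle argument. If the inequality failed, \<open>u\<close> minus a
  quadratic \<open>Q\<close> would attain its maximum over a cylinder around the segment at an
  interior point, where \<open>Q\<close> is an upper test function strictly concave along the
  segment. \<open>A\<close> and \<open>B\<close> are upper bounds rather than values so that
  -\<infinity> is allowed at the ends.\<close>

lemma psh_log_convex:
  fixes u :: "complex ^ 'n \<Rightarrow> ereal" and a b :: "real ^ 'n"
  assumes psh: "psh u" and inv: "rotation_invariant u"
    and A: "u (expv a) \<le> ereal A" and B: "u (expv b) \<le> ereal B" and s: "0 \<le> s" "s \<le> 1"
  shows "u (expv ((1 - s) *\<^sub>R a + s *\<^sub>R b)) \<le> ereal ((1 - s) * A + s * B)"
proof (rule ccontr)
  assume neg: "\<not> ?thesis"
  let ?x0 = "(1 - s) *\<^sub>R a + s *\<^sub>R b"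
  define F where "F x = u (expv x)" for x
  have lt: "F x < \<infinity>" for x using psh by (simp add: psh_def F_def)
  have usc: "open {x. F x < c}" for c
  proof -
    have "continuous_on UNIV (expv :: real ^ 'n \<Rightarrow> _)"
      unfolding expv_def by (intro continuous_intros) auto
    moreover have "open {z. u z < c}" using psh by (simp add: psh_def)
    ultimately have "open (expv -` {z. u z < c})" by (intro open_vimage)
    then show "open {x. F x < c}" by (simp add: F_def vimage_def)
  qed
  obtain F0 where F0: "F ?x0 = ereal F0"
    using neg lt[of ?x0] by (cases "F ?x0") (auto simp: F_def)
  have gt: "F0 > (1 - s) * A + s * B" using neg F0 by (simp add: F_def)
  have "a \<noteq> b"
  proof
    assume "a = b"
    then have "?x0 = a" "?x0 = b" by (simp_all add: algebra_simps)
    then have "F0 \<le> A" "F0 \<le> B" using F0 A B by (auto simp: F_def)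
    then have "(1 - s) * F0 + s * F0 \<le> (1 - s) * A + s * B" using s by (intro add_mono mult_left_mono) auto
    with gt show False by (simp add: algebra_simps)
  qed
  define l where "l = norm (b - a)"
  define d where "d = (b - a) /\<^sub>R l"
  have l: "l > 0" and d: "norm d = 1" using \<open>a \<noteq> b\<close> by (auto simp: l_def d_def)
  have dd: "d \<bullet> d = 1" using d by (simp add: norm_eq_1)
  have b: "b = a + l *\<^sub>R d" using l by (simp add: d_def)
  \<comment> \<open>A third of the excess: one part is lost to semicontinuity near the ends, one to
    the bump in \<open>Q\<close>, and one remains for the contradiction.\<close>
  define \<mu> where "\<mu> = (F0 - ((1 - s) * A + s * B)) / 3"
  have \<mu>: "\<mu> > 0" using gt by (simp add: \<mu>_def)
  define \<sigma> where "\<sigma> x = (x - a) \<bullet> d" for x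
  define P where "P x = (x - a) - \<sigma> x *\<^sub>R d" for x
  have x_eq: "x = a + \<sigma> x *\<^sub>R d + P x" for x by (simp add: P_def)
  obtain r1 where r1: "r1 > 0" "\<And>x. dist x a < r1 \<Longrightarrow> F x < ereal (A + \<mu>)"
  proof -
    have "a \<in> {x. F x < ereal (A + \<mu>)}" using A \<mu> by (auto simp: F_def intro: le_less_trans)
    with usc obtain r where "r > 0" "ball a r \<subseteq> {x. F x < ereal (A + \<mu>)}" by (meson openE)
    then show ?thesis by (intro that[of r]) (auto simp: dist_commute subset_iff)
  qed
  obtain r2 where r2: "r2 > 0" "\<And>x. dist x b < r2 \<Longrightarrow> F x < ereal (B + \<mu>)"
  proof -
    have "b \<in> {x. F x < ereal (B + \<mu>)}" using B \<mu> by (auto simp: F_def intro: le_less_trans)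
    with usc obtain r where "r > 0" "ball b r \<subseteq> {x. F x < ereal (B + \<mu>)}" by (meson openE)
    then show ?thesis by (intro that[of r]) (auto simp: dist_commute subset_iff)
  qed
  define r where "r = min r1 r2 / 2"
  have r: "r > 0" "r < r1" "r < r2" using r1(1) r2(1) by (auto simp: r_def)
  have c\<sigma>: "continuous_on UNIV \<sigma>" and cP: "continuous_on UNIV P"
    unfolding P_def \<sigma>_def by (intro continuous_intros)+
  define D where "D = {x. 0 \<le> \<sigma> x \<and> \<sigma> x \<le> l \<and> norm (P x) \<le> r}"
  have "compact D"
  proof (rule compact_eq_bounded_closed[THEN iffD2], intro conjI)
    have "norm x \<le> norm a + l + r" if "x \<in> D" for x
    proof -
      have "norm x \<le> norm a + norm (\<sigma> x *\<^sub>R d) + norm (P x)"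
        by (subst x_eq) (intro norm_triangle_le add_mono order_refl)
      then show ?thesis using that d by (auto simp: D_def)
    qed
    then show "bounded D" by (auto simp: bounded_iff)
    have "closed ({x. 0 \<le> \<sigma> x} \<inter> {x. \<sigma> x \<le> l} \<inter> {x. norm (P x) \<le> r})"
      by (intro closed_Int closed_Collect_le continuous_intros c\<sigma> cP)
    moreover have "D = {x. 0 \<le> \<sigma> x} \<inter> {x. \<sigma> x \<le> l} \<inter> {x. norm (P x) \<le> r}" by (auto simp: D_def)
    ultimately show "closed D" by simp
  qed
  have x0: "\<sigma> ?x0 = s * l" "P ?x0 = 0"
  proof -
    have "?x0 - a = (s * l) *\<^sub>R d" by (simp add: b algebra_simps)
    then show "\<sigma> ?x0 = s * l" "P ?x0 = 0" by (simp_all add: \<sigma>_def P_def dd)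
  qed
  have "s * l \<le> l" using s l by simp
  then have x0D: "?x0 \<in> D" using s l r by (simp add: D_def x0)
  then have "D \<noteq> {}" by auto
  obtain M where M: "\<And>x. x \<in> D \<Longrightarrow> F x \<le> ereal M"
  proof -
    obtain y where "y \<in> D" "\<forall>x\<in>D. F x \<le> F y"
      using upper_semicontinuous_attains_sup[OF \<open>compact D\<close> \<open>D \<noteq> {}\<close> usc] by blast
    moreover have "F y \<le> ereal (real_of_ereal (F y))" if "F y \<noteq> -\<infinity>"
      using that lt[of y] by (cases "F y") auto
    moreover have "F y \<noteq> -\<infinity>" using calculation(2) x0D F0 by (metis ereal_less_eq(2) MInfty_neq_ereal(1) ereal_infty_less_eq2(2))
    ultimately show ?thesis using that order_trans by blast
  qed
  \<comment> \<open>Chosen so that \<open>Q\<close> is at least \<open>M\<close> on the lateral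
    boundary of the cylinder, where \<open>norm (P x) = r\<close>.\<close>
  define K where "K = max 0 ((M - min A B) / r\<^sup>2)"
  have K: "K \<ge> 0" "min A B + K * r\<^sup>2 \<ge> M"
  proof -
    have "(M - min A B) / r\<^sup>2 * r\<^sup>2 \<le> K * r\<^sup>2" by (intro mult_right_mono) (auto simp: K_def)
    then show "min A B + K * r\<^sup>2 \<ge> M" using r by simp
  qed (simp add: K_def)
  define \<eta> where "\<eta> = \<mu> / l\<^sup>2"
  have \<eta>: "\<eta> > 0" using \<mu> l by (simp add: \<eta>_def)
  \<comment> \<open>Affine interpolation of \<open>A\<close> and \<open>B\<close> along the segment,
    plus a concave bump that vanishes at both ends, plus a transversal penalty that keeps the
    maximum off the lateral boundary.\<close>
  define Q where "Q x = A + (B - A) / l * \<sigma> x + \<eta> * (\<sigma> x * (l - \<sigma> x)) + K * (norm (P x))\<^sup>2" for x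
  have Qc: "continuous_on UNIV Q" unfolding Q_def by (intro continuous_intros c\<sigma> cP)
  obtain y where y: "y \<in> D" "\<And>x. x \<in> D \<Longrightarrow> F x - ereal (Q x) \<le> F y - ereal (Q y)"
    using upper_semicontinuous_attains_sup[OF \<open>compact D\<close> \<open>D \<noteq> {}\<close>
        upper_semicontinuous_minus_continuous[OF usc Qc]] by blast
  have "F y \<noteq> -\<infinity>" using y(2)[OF x0D] F0 by auto
  then obtain Fy where Fy: "F y = ereal Fy" using lt[of y] by (cases "F y") auto
  have upper: "F x \<le> ereal (Fy + Q x - Q y)" if "x \<in> D" for x
    using y(2)[OF that] lt[of x] Fy by (cases "F x") auto
  have Qx0: "Q ?x0 \<le> F0 - 2 * \<mu>"
  proof -
    have "s * (1 - s) \<le> 1" using s by (intro mult_le_one) auto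
    then have "\<mu> * (s * (1 - s)) \<le> \<mu>" using \<mu> by (simp add: mult_left_le)
    moreover have "\<eta> * (s * l * (l - s * l)) = \<mu> * (s * (1 - s))"
      using l by (simp add: \<eta>_def power2_eq_square field_simps)
    moreover have "(B - A) / l * (s * l) = s * (B - A)" using l by simp
    ultimately have "Q ?x0 \<le> A + s * (B - A) + \<mu>" unfolding Q_def x0 by (simp only: norm_zero power_zero_numeral mult_zero_right add_0_right)
    moreover have "A + s * (B - A) = (1 - s) * A + s * B" by (simp add: algebra_simps)
    ultimately show ?thesis using \<mu> unfolding \<mu>_def by (simp add: field_simps)
  qed
  have gap: "Fy - Q y \<ge> 2 * \<mu>" using upper[OF x0D] F0 Qx0 by simp
  have lin: "min A B \<le> A + (B - A) / l * \<sigma> y"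
  proof -
    define t where "t = \<sigma> y / l"
    have t: "0 \<le> t" "t \<le> 1" using y(1) l by (auto simp: t_def D_def)
    have "min A B = (1 - t) * min A B + t * min A B" by (simp add: algebra_simps)
    also have "\<dots> \<le> (1 - t) * A + t * B" using t by (intro add_mono mult_left_mono) auto
    also have "\<dots> = A + (B - A) / l * \<sigma> y" using l by (simp add: t_def field_simps flip: diff_divide_distrib)
    finally show ?thesis .
  qed
  have \<sigma>y: "0 \<le> \<sigma> y" "\<sigma> y \<le> l" "norm (P y) \<le> r" using y(1) by (auto simp: D_def)
  have bump: "0 \<le> \<eta> * (\<sigma> y * (l - \<sigma> y))" using \<sigma>y \<eta> by simp
  have pen: "0 \<le> K * (norm (P y))\<^sup>2" using K by simp
  have "\<sigma> y \<noteq> 0"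
  proof
    assume 0: "\<sigma> y = 0"
    then have "y = a + P y" using x_eq[of y] by simp
    then have "dist y a = norm (P y)" by (metis add_diff_cancel_left' dist_norm)
    then have "F y < ereal (A + \<mu>)" using \<sigma>y r by (intro r1) auto
    moreover have "Q y \<ge> A" using 0 pen by (simp add: Q_def)
    ultimately show False using Fy gap \<mu> by simp
  qed
  moreover have "\<sigma> y \<noteq> l"
  proof
    assume 0: "\<sigma> y = l"
    then have "y = b + P y" using x_eq[of y] by (simp add: b)
    then have "dist y b = norm (P y)" by (metis add_diff_cancel_left' dist_norm)
    then have "F y < ereal (B + \<mu>)" using \<sigma>y r by (intro r2) auto
    moreover have "Q y \<ge> B" using 0 pen l by (simp add: Q_def)
    ultimately show False using Fy gap \<mu> by simp
  qed
  moreover have "norm (P y) \<noteq> r"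
  proof
    assume 0: "norm (P y) = r"
    have "Q y \<ge> M" using K(2) lin bump unfolding Q_def 0 by linarith
    moreover have "Fy \<le> M" using M[OF y(1)] Fy by simp
    ultimately show False using gap \<mu> by simp
  qed
  ultimately have "y \<in> {x. 0 < \<sigma> x} \<inter> {x. \<sigma> x < l} \<inter> {x. norm (P x) < r}" using \<sigma>y by auto
  moreover have "open ({x. 0 < \<sigma> x} \<inter> {x. \<sigma> x < l} \<inter> {x. norm (P x) < r})"
    by (intro open_Int open_Collect_less continuous_intros c\<sigma> cP)
  ultimately obtain r' where r': "r' > 0" "ball y r' \<subseteq> {x. 0 < \<sigma> x} \<inter> {x. \<sigma> x < l} \<inter> {x. norm (P x) < r}"
    by (meson openE)
  \<comment> \<open>The gradient of \<open>Q\<close> at \<open>y\<close>. As \<open>Q\<close> is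
    quadratic, its expansion at \<open>y\<close> below is exact.\<close>
  define g where "g = ((B - A) / l + \<eta> * (l - 2 * \<sigma> y)) *\<^sub>R d + (2 * K) *\<^sub>R P y"
  show False
  proof (rule no_concave_upper_test_function[where u = u and x = y and d = d and g = g and Fx = Fy and r = r' and \<eta> = \<eta> and K = K])
    show "\<And>p b. u p \<le> circle_mean u p b" using psh by (simp add: psh_def)
    fix \<delta> :: "real ^ 'n" assume "norm \<delta> < r'"
    then have "y + \<delta> \<in> ball y r'" by (simp add: dist_norm)
    then have "y + \<delta> \<in> D" using r'(2) by (auto simp: D_def)
    from upper[OF this] have "u (expv (y + \<delta>)) \<le> ereal (Fy + Q (y + \<delta>) - Q y)" by (simp add: F_def)
    also have "Fy + Q (y + \<delta>) - Q y
        = Fy + g \<bullet> \<delta> - \<eta> * (\<delta> \<bullet> d)\<^sup>2 + K * (norm (\<delta> - (\<delta> \<bullet> d) *\<^sub>R d))\<^sup>2"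
    proof -
      define h where "h = \<delta> \<bullet> d"
      define R where "R = \<delta> - h *\<^sub>R d"
      have \<sigma>1: "\<sigma> (y + \<delta>) = \<sigma> y + h" by (simp add: \<sigma>_def h_def algebra_simps inner_add_left inner_diff_left)
      have P1: "P (y + \<delta>) = P y + R" unfolding P_def \<sigma>1 R_def by (simp add: algebra_simps)
      have "P y \<bullet> d = 0" by (simp add: P_def \<sigma>_def inner_diff_left dd)
      then have PR: "P y \<bullet> R = P y \<bullet> \<delta>" by (simp add: R_def inner_diff_right)
      have "(norm (P y + R))\<^sup>2 = (norm (P y))\<^sup>2 + 2 * (P y \<bullet> \<delta>) + (norm R)\<^sup>2"
        unfolding power2_norm_eq_inner using PR by (simp add: inner_add_left inner_add_right inner_commute)
      moreover have "g \<bullet> \<delta> = ((B - A) / l + \<eta> * (l - 2 * \<sigma> y)) * h + 2 * K * (P y \<bullet> \<delta>)"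
        unfolding g_def h_def inner_add_left inner_scaleR_left by (simp add: inner_commute)
      ultimately show ?thesis
        unfolding Q_def \<sigma>1 P1 R_def[symmetric] h_def[symmetric]
        by (simp add: algebra_simps power2_eq_square add_divide_distrib diff_divide_distrib)
    qed
    finally show "u (expv (y + \<delta>)) \<le> ereal (Fy + g \<bullet> \<delta> - \<eta> * (\<delta> \<bullet> d)\<^sup>2 + K * (norm (\<delta> - (\<delta> \<bullet> d) *\<^sub>R d))\<^sup>2)" .
  qed (use inv Fy d r' \<eta> K in \<open>auto simp: F_def\<close>)
qed

text \<open>If \<open>u\<close> were -\<infinity> at one such point, convexity with arbitrarily low
  bounds there would spread -\<infinity> to every midpoint, hence to the whole orbit. Every point of
  the chart is the centre of a circle inside the orbit, so the mean inequality would make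
  \<open>u\<close> identically -\<infinity>, which \<open>psh\<close> excludes.\<close>

lemma psh_finite_on_orbit:
  fixes u :: "complex ^ 'n \<Rightarrow> ereal"
  assumes psh: "psh u" and inv: "rotation_invariant u"
  shows "\<bar>u (expv x)\<bar> \<noteq> \<infinity>"
proof -
  have lt: "u z < \<infinity>" for z using psh by (simp add: psh_def)
  have "u (expv x) \<noteq> -\<infinity>"
  proof
    assume m: "u (expv x) = -\<infinity>"
    have all: "u (expv y) = -\<infinity>" for y
    proof -
      define w where "w = 2 *\<^sub>R y - x"
      obtain B where B: "u (expv w) \<le> ereal B" using lt[of "expv w"] by (cases "u (expv w)") auto
      have y: "y = (1 - 1/2) *\<^sub>R x + (1/2) *\<^sub>R w" by (simp add: w_def algebra_simps)
      have "u (expv y) \<le> ereal ((1 - 1/2) * A + (1/2) * B)" for A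
        unfolding y by (rule psh_log_convex[OF psh inv _ B]) (auto simp: m)
      from this[of "2 * A - B" for A] have "u (expv y) \<le> ereal A" for A
        by (simp add: field_simps)
      then show ?thesis by (metis ereal_bot)
    qed
    have "u z = -\<infinity>" for z
    proof -
      \<comment> \<open>Each \<open>b $ i\<close> has larger modulus than \<open>z $ i\<close>, so
        no coordinate vanishes on the circle.\<close>
      define b where "b = (\<chi> i. complex_of_real (norm (z $ i) + 1))"
      have orb: "z + cis \<theta> *s b \<in> orbit" for \<theta>
      proof -
        have "z $ i + cis \<theta> * b $ i \<noteq> 0" for i
        proof
          assume "z $ i + cis \<theta> * b $ i = 0"
          then have "norm (z $ i) = norm (cis \<theta> * b $ i)" by (metis add_eq_0_iff norm_minus_cancel)
          also have "\<dots> = norm (z $ i) + 1" by (simp add: b_def norm_mult del: of_real_add)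
          finally show False by simp
        qed
        then show ?thesis by (simp add: orbit_def)
      qed
      have "u (z + cis \<theta> *s b) = -\<infinity>" for \<theta>
        using rotation_invariant_eq_expv[OF inv orb] all by metis
      then have "circle_mean u z b \<le> ereal (integral {0..2*pi} (\<lambda>_. A) / (2*pi))" for A
        by (intro circle_mean_le) auto
      then have "circle_mean u z b \<le> ereal A" for A by simp
      then have "circle_mean u z b = -\<infinity>" by (metis ereal_bot)
      moreover have "u z \<le> circle_mean u z b" using psh by (simp add: psh_def)
      ultimately show ?thesis by simp
    qed
    then show False using psh by (auto simp: psh_def)
  qed
  then show ?thesis using lt[of "expv x"] by auto
qed

section \<open>Laurent polynomials and the flag valuation\<close>

text \<open>By the conventions for \<open>powi\<close> this is the usual polynomial on the whole
  chart when the exponents are nonnegative; with negative exponents it is meaningful on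
  \<open>orbit\<close> only.\<close>

definition mon :: "('n::finite \<Rightarrow> int) \<Rightarrow> complex ^ 'n \<Rightarrow> complex" where
  "mon e z = (\<Prod>i\<in>UNIV. z $ i powi e i)"

definition shrink :: "'n::finite \<Rightarrow> complex ^ 'n \<Rightarrow> complex ^ 'n" where
  "shrink i z = (\<chi> j. if j = i then z $ j / 2 else z $ j)"

definition put :: "complex ^ 'n \<Rightarrow> 'n \<Rightarrow> complex \<Rightarrow> complex ^ 'n" where
  "put z i \<xi> = (\<chi> j. if j = i then \<xi> else z $ j)"

lemma put_nth: "put z i \<xi> $ j = (if j = i then \<xi> else z $ j)"
  by (simp add: put_def)

lemma put_in_orbit [intro]: "z \<in> orbit \<Longrightarrow> \<xi> \<noteq> 0 \<Longrightarrow> put z i \<xi> \<in> orbit"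
  by (simp add: orbit_def put_nth)

lemma put_same [simp]: "put z i (z $ i) = z" and put_put [simp]: "put (put z i \<xi>) i \<xi>' = put z i \<xi>'"
  by (auto simp: vec_eq_iff put_nth)

lemma put_commute: "i \<noteq> j \<Longrightarrow> put (put z i \<xi>) j \<xi>' = put (put z j \<xi>') i \<xi>"
  by (auto simp: vec_eq_iff put_nth)

lemma shrink_in_orbit [intro]: "z \<in> orbit \<Longrightarrow> shrink i z \<in> orbit"
  by (simp add: orbit_def shrink_def)

lemma mon_shrink: "mon e (shrink i z) = (1/2) powi e i * mon e z"
proof -
  have "mon e (shrink i z) = (\<Prod>j\<in>UNIV. (if j = i then (1/2) powi e j else 1) * z $ j powi e j)"
    unfolding mon_def shrink_def
    by (intro prod.cong) (auto simp: power_int_mult_distrib[symmetric])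
  then show ?thesis by (simp add: prod.distrib mon_def)
qed

lemma mon_nonzero: "z \<in> orbit \<Longrightarrow> mon e z \<noteq> 0"
  by (simp add: mon_def orbit_def)

lemma mon_mult: "z \<in> orbit \<Longrightarrow> mon e z * mon e' z = mon (\<lambda>i. e i + e' i) z"
  by (simp add: mon_def orbit_def prod.distrib power_int_add)

lemma half_powi_inject: "(1/2 :: complex) powi a = (1/2) powi b \<longleftrightarrow> a = b"
proof
  assume "(1/2 :: complex) powi a = (1/2) powi b"
  then have "norm ((1/2 :: complex) powi a) = norm ((1/2 :: complex) powi b)" by simp
  then have eq: "(1/2 :: real) powi a = (1/2) powi b" by (simp add: norm_power_int)
  show "a = b"
  proof (rule ccontr)
    assume "a \<noteq> b"
    then consider "a < b" | "b < a" by linarith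
    then show False
      using power_int_strict_decreasing[of a b "1/2 :: real"] power_int_strict_decreasing[of b a "1/2 :: real"] eq
      by cases auto
  qed
qed auto

text \<open>
  Comparing \<open>g\<close> with \<open>g \<circ> shrink i\<close> removes any other monomial, one at a time.
\<close>

lemma monomial_extraction:
  fixes c :: "'a \<Rightarrow> complex" and E :: "'a \<Rightarrow> 'n::finite \<Rightarrow> int"
  assumes scale: "\<And>g b. P g \<Longrightarrow> P (\<lambda>z. b * g z)"
    and diff: "\<And>g h. P g \<Longrightarrow> P h \<Longrightarrow> P (\<lambda>z. g z - h z)"
    and shr: "\<And>g i. P g \<Longrightarrow> P (\<lambda>z. g (shrink i z))"
  shows "finite I \<Longrightarrow> inj_on E I \<Longrightarrow> P (\<lambda>z. \<Sum>k\<in>I. c k * mon (E k) z) \<Longrightarrow> k \<in> I \<Longrightarrow> c k \<noteq> 0 \<Longrightarrow> P (mon (E k))"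
proof (induction "card I" arbitrary: I c rule: less_induct)
  case less
  show ?case
  proof (cases "I = {k}")
    case True
    with less.prems have "P (\<lambda>z. c k * mon (E k) z)" by simp
    from scale[OF this, of "1 / c k"] show ?thesis using less.prems by simp
  next
    case False
    with less.prems obtain l where l: "l \<in> I" "l \<noteq> k" by blast
    then have "E l \<noteq> E k" using less.prems by (auto dest: inj_onD)
    then obtain i where i: "E l i \<noteq> E k i" by auto
    define q where "q m = (1/2 :: complex) powi E m i" for m
    \<comment> \<open>The coefficients of the pullback by \<open>shrink i\<close> minus
      \<open>q l\<close> times the function: the term \<open>l\<close> drops out, and
      \<open>k\<close> survives because \<open>E l\<close> and \<open>E k\<close> differ at
      \<open>i\<close>.\<close>
    define c' where "c' m = c m * (q m - q l)" for m
    have "P (\<lambda>z. (\<Sum>m\<in>I. c m * mon (E m) (shrink i z)) - q l * (\<Sum>m\<in>I. c m * mon (E m) z))"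
      by (intro diff scale shr[OF less.prems(3)] less.prems(3))
    also have "(\<lambda>z. (\<Sum>m\<in>I. c m * mon (E m) (shrink i z)) - q l * (\<Sum>m\<in>I. c m * mon (E m) z))
        = (\<lambda>z. \<Sum>m\<in>I. c' m * mon (E m) z)"
      by (simp add: mon_shrink c'_def q_def sum_distrib_left sum_subtractf algebra_simps)
    also have "\<dots> = (\<lambda>z. \<Sum>m\<in>I - {l}. c' m * mon (E m) z)"
      using less.prems(1) l by (intro ext) (simp add: sum.remove[of I l] c'_def)
    finally have P': "P (\<lambda>z. \<Sum>m\<in>I - {l}. c' m * mon (E m) z)" .
    have "c' k \<noteq> 0" using less.prems i by (auto simp: c'_def q_def half_powi_inject)
    moreover have "card (I - {l}) < card I" using less.prems(1) l by (intro card_Diff1_less)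
    moreover have "inj_on E (I - {l})" using less.prems(2) by (rule inj_on_diff)
    ultimately show ?thesis using less.hyps[of "I - {l}" c'] P' less.prems l by simp
  qed
qed

text \<open>The property passed to \<open>monomial_extraction\<close> is vanishing on the orbit,
  where no monomial has a zero.\<close>

lemma monomials_independent:
  fixes c :: "'a \<Rightarrow> complex" and E :: "'a \<Rightarrow> 'n::finite \<Rightarrow> int"
  assumes "finite I" "inj_on E I" "\<And>z. z \<in> orbit \<Longrightarrow> (\<Sum>k\<in>I. c k * mon (E k) z) = 0" "k \<in> I"
  shows "c k = 0"
proof (rule ccontr)
  assume "c k \<noteq> 0"
  then have "\<forall>z\<in>orbit. mon (E k) z = 0"
    using assms
    by (intro monomial_extraction[where P = "\<lambda>g. \<forall>z\<in>orbit. g z = 0" and I = I and c = c])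
      (auto intro: shrink_in_orbit)
  moreover have "expv 0 \<in> orbit" by simp
  ultimately show False using mon_nonzero by blast
qed

section \<open>From polynomials in each variable separately to Laurent polynomials\<close>

definition laurent_on_orbit :: "(complex ^ 'n \<Rightarrow> complex) \<Rightarrow> bool" where
  "laurent_on_orbit f \<longleftrightarrow> (\<exists>S c. finite S \<and> (\<forall>z\<in>orbit. f z = (\<Sum>e\<in>S. c e * mon e z)))"

lemma laurent_on_orbit_add:
  assumes "laurent_on_orbit f" "laurent_on_orbit g"
  shows "laurent_on_orbit (\<lambda>z. f z + g z)"
proof -
  obtain S c where S: "finite S" "\<forall>z\<in>orbit. f z = (\<Sum>e\<in>S. c e * mon e z)"
    using assms(1) by (auto simp: laurent_on_orbit_def)
  obtain S' c' where S': "finite S'" "\<forall>z\<in>orbit. g z = (\<Sum>e\<in>S'. c' e * mon e z)"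
    using assms(2) by (auto simp: laurent_on_orbit_def)
  define d where "d e = (if e \<in> S then c e else 0) + (if e \<in> S' then c' e else 0)" for e
  have "f z + g z = (\<Sum>e\<in>S \<union> S'. d e * mon e z)" if "z \<in> orbit" for z
  proof -
    have "(\<Sum>e\<in>S. c e * mon e z) = (\<Sum>e\<in>S \<union> S'. (if e \<in> S then c e else 0) * mon e z)"
      using S(1) S'(1) by (intro sum.mono_neutral_cong_left) auto
    moreover have "(\<Sum>e\<in>S'. c' e * mon e z) = (\<Sum>e\<in>S \<union> S'. (if e \<in> S' then c' e else 0) * mon e z)"
      using S(1) S'(1) by (intro sum.mono_neutral_cong_left) auto
    ultimately show ?thesis
      using S(2) S'(2) that by (simp add: d_def distrib_right sum.distrib)
  qed
  then show ?thesis unfolding laurent_on_orbit_def using S(1) S'(1) by blast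
qed

lemma laurent_on_orbit_const: "laurent_on_orbit (\<lambda>_. b)"
  unfolding laurent_on_orbit_def
  by (intro exI[of _ "{\<lambda>_. 0}"] exI[of _ "\<lambda>_. b"]) (simp add: mon_def)

lemma laurent_on_orbit_sum:
  assumes "finite A" "\<And>a. a \<in> A \<Longrightarrow> laurent_on_orbit (f a)"
  shows "laurent_on_orbit (\<lambda>z. \<Sum>a\<in>A. f a z)"
  using assms by (induction A) (auto intro: laurent_on_orbit_add laurent_on_orbit_const)

lemma laurent_on_orbit_cong:
  "laurent_on_orbit f \<Longrightarrow> (\<And>z. z \<in> orbit \<Longrightarrow> g z = f z) \<Longrightarrow> laurent_on_orbit g"
  unfolding laurent_on_orbit_def by simp

lemma laurent_on_orbit_mult_power:
  assumes "laurent_on_orbit f"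
  shows "laurent_on_orbit (\<lambda>z. f z * z $ i ^ m)"
proof -
  obtain S c where S: "finite S" "\<forall>z\<in>orbit. f z = (\<Sum>e\<in>S. c e * mon e z)"
    using assms by (auto simp: laurent_on_orbit_def)
  define b :: "'a \<Rightarrow> int" where "b = (\<lambda>j. if j = i then int m else 0)"
  define T where "T = (\<lambda>e j. e j + b j)"
  have "inj T" by (auto simp: T_def fun_eq_iff intro!: injI)
  have b: "z $ i ^ m = mon b z" for z :: "complex ^ 'a"
  proof -
    have "mon b z = (\<Prod>j\<in>UNIV. if j = i then z $ j ^ m else 1)"
      unfolding mon_def b_def by (intro prod.cong) auto
    then show ?thesis by simp
  qed
  have "f z * z $ i ^ m = (\<Sum>e\<in>T ` S. c (inv T e) * mon e z)" if "z \<in> orbit" for z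
  proof -
    have "f z * z $ i ^ m = (\<Sum>e\<in>S. c e * mon (T e) z)"
      unfolding b using S(2) that by (simp add: sum_distrib_right mult.assoc mon_mult T_def)
    also have "\<dots> = (\<Sum>e\<in>T ` S. c (inv T e) * mon e z)"
      using \<open>inj T\<close> by (subst sum.reindex) (auto intro: inj_on_subset)
    finally show ?thesis .
  qed
  then show ?thesis unfolding laurent_on_orbit_def
    using S(1) by (intro exI[of _ "T ` S"] exI[of _ "\<lambda>e. c (inv T e)"]) auto
qed

text \<open>Lagrange interpolation read dually: \<open>b\<close> lists the coefficients of a
  polynomial \<open>p\<close> that is 1 at \<open>2^m\<close> and 0 at \<open>2^l\<close> for the
  other \<open>l < N\<close>. Since \<open>(2^j)^l = (2^l)^j\<close>, pairing \<open>b\<close> with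
  the values at the nodes \<open>2^j\<close> evaluates \<open>p\<close> at \<open>2^l\<close>. The
  nodes are nonzero, so substituting them for a coordinate does not leave the orbit.\<close>

lemma coefficient_from_values_at_powers_of_2:
  assumes "m < N"
  shows "\<exists>(b :: nat \<Rightarrow> complex) K. \<forall>c. (\<Sum>j\<le>K. b j * (\<Sum>l<N. c l * (2 ^ j) ^ l)) = c m"
proof -
  define q :: "complex poly" where "q = (\<Prod>l\<in>{..<N} - {m}. [:- (2 ^ l), 1:])"
  define p where "p = smult (1 / poly q (2 ^ m)) q"
  have "poly q (2 ^ m) \<noteq> 0"
  proof -
    have "(2 :: complex) ^ m \<noteq> 2 ^ l" if "l \<noteq> m" for l
    proof
      assume "(2 :: complex) ^ m = 2 ^ l"
      then have "norm ((2 :: complex) ^ m) = norm ((2 :: complex) ^ l)" by simp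
      then have "(2 :: real) ^ m = 2 ^ l" by (simp add: norm_power)
      with that show False by simp
    qed
    then show ?thesis by (auto simp: q_def poly_prod)
  qed
  then have p: "poly p (2 ^ l) = (if l = m then 1 else 0)" if "l < N" for l
    using that by (auto simp: p_def q_def poly_prod)
  have "(\<Sum>j\<le>degree p. coeff p j * (\<Sum>l<N. c l * (2 ^ j) ^ l)) = c m" for c
  proof -
    have "(\<Sum>j\<le>degree p. coeff p j * (\<Sum>l<N. c l * (2 ^ j) ^ l))
        = (\<Sum>j\<le>degree p. \<Sum>l<N. c l * (coeff p j * (2 ^ l) ^ j))"
      by (simp add: sum_distrib_left power_mult[symmetric] mult.commute mult.left_commute)
    also have "\<dots> = (\<Sum>l<N. c l * poly p (2 ^ l))"
      by (subst sum.swap) (simp add: poly_altdef sum_distrib_left)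
    also have "\<dots> = (\<Sum>l<N. if l = m then c l else 0)"
      by (intro sum.cong) (auto simp: p)
    also have "\<dots> = c m" using assms by simp
    finally show ?thesis .
  qed
  then show ?thesis by blast
qed

lemma independent_of_all_coordinates:
  assumes "\<And>z i \<xi>. z \<in> orbit \<Longrightarrow> \<xi> \<noteq> 0 \<Longrightarrow> f (put z i \<xi>) = f z" and "z \<in> orbit"
  shows "f z = f (\<chi> i. 1)"
proof -
  have "f (\<chi> j. if j \<in> J then 1 else z $ j) = f z" for J
    using finite[of J]
  proof (induction J rule: finite_induct)
    case (insert i J)
    have "(\<chi> j. if j \<in> insert i J then 1 else z $ j) = put (\<chi> j. if j \<in> J then 1 else z $ j) i 1"
      by (simp add: vec_eq_iff put_nth)
    moreover have "(\<chi> j. if j \<in> J then 1 else z $ j) \<in> orbit" using assms(2) by (simp add: orbit_def)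
    ultimately show ?case using assms(1) insert.IH by simp
  qed simp
  from this[of UNIV] show ?thesis by simp
qed

text \<open>The bound \<open>N\<close> is common to all \<open>z\<close>, so that one linear
  combination of values extracts a given coefficient for every \<open>z\<close>.\<close>

definition polynomial_along :: "nat \<Rightarrow> (complex ^ 'n \<Rightarrow> complex) \<Rightarrow> 'n \<Rightarrow> bool" where
  "polynomial_along N f i \<longleftrightarrow>
     (\<forall>z\<in>orbit. \<exists>c. \<forall>\<xi>. \<xi> \<noteq> 0 \<longrightarrow> f (put z i \<xi>) = (\<Sum>m<N. c m * \<xi> ^ m))"

lemma polynomial_along_lincomb:
  fixes f :: "'a \<Rightarrow> complex ^ 'n \<Rightarrow> complex"
  assumes "\<And>a. a \<in> A \<Longrightarrow> polynomial_along N (f a) i"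
  shows "polynomial_along N (\<lambda>z. \<Sum>a\<in>A. b a * f a z) i"
  unfolding polynomial_along_def
proof
  fix z :: "complex ^ 'n" assume "z \<in> orbit"
  then have "\<forall>a\<in>A. \<exists>c. \<forall>\<xi>. \<xi> \<noteq> 0 \<longrightarrow> f a (put z i \<xi>) = (\<Sum>m<N. c m * \<xi> ^ m)"
    using assms by (auto simp: polynomial_along_def)
  then obtain C where C: "\<forall>a\<in>A. \<forall>\<xi>. \<xi> \<noteq> 0 \<longrightarrow> f a (put z i \<xi>) = (\<Sum>m<N. C a m * \<xi> ^ m)" by metis
  have "(\<Sum>a\<in>A. b a * f a (put z i \<xi>)) = (\<Sum>m<N. (\<Sum>a\<in>A. b a * C a m) * \<xi> ^ m)" if "\<xi> \<noteq> 0" for \<xi>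
  proof -
    have "(\<Sum>a\<in>A. b a * f a (put z i \<xi>)) = (\<Sum>a\<in>A. \<Sum>m<N. b a * C a m * \<xi> ^ m)"
      using C that by (intro sum.cong) (auto simp: sum_distrib_left mult.assoc)
    then show ?thesis by (subst (asm) sum.swap) (simp add: sum_distrib_right)
  qed
  then show "\<exists>c. \<forall>\<xi>. \<xi> \<noteq> 0 \<longrightarrow> (\<Sum>a\<in>A. b a * f a (put z i \<xi>)) = (\<Sum>m<N. c m * \<xi> ^ m)"
    by (intro exI[of _ "\<lambda>m. \<Sum>a\<in>A. b a * C a m"]) simp
qed

lemma polynomial_along_put:
  fixes f :: "complex ^ 'n \<Rightarrow> complex"
  assumes "polynomial_along N f i" "i \<noteq> j" "\<zeta> \<noteq> 0"
  shows "polynomial_along N (\<lambda>z. f (put z j \<zeta>)) i"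
  unfolding polynomial_along_def
proof
  fix z :: "complex ^ 'n" assume "z \<in> orbit"
  with assms(3) have "put z j \<zeta> \<in> orbit" by blast
  with assms(1) obtain c where "\<forall>\<xi>. \<xi> \<noteq> 0 \<longrightarrow> f (put (put z j \<zeta>) i \<xi>) = (\<Sum>m<N. c m * \<xi> ^ m)"
    by (auto simp: polynomial_along_def)
  then show "\<exists>c. \<forall>\<xi>. \<xi> \<noteq> 0 \<longrightarrow> f (put (put z i \<xi>) j \<zeta>) = (\<Sum>m<N. c m * \<xi> ^ m)"
    using put_commute[OF assms(2)] by metis
qed

text \<open>Induction on the set \<open>J\<close> of variables on which \<open>f\<close> may depend.
  The coefficients of \<open>f\<close> as a polynomial in \<open>z $ i\<close> are fixed linear
  combinations of its restrictions to \<open>z $ i = 2^j\<close>; they no longer depend on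
  \<open>z $ i\<close> and inherit the hypotheses in the other variables.\<close>

lemma laurent_if_polynomial_along:
  assumes "\<And>i. i \<in> J \<Longrightarrow> polynomial_along N f i"
    and "\<And>z i \<xi>. z \<in> orbit \<Longrightarrow> i \<notin> J \<Longrightarrow> \<xi> \<noteq> 0 \<Longrightarrow> f (put z i \<xi>) = f z"
  shows "laurent_on_orbit f"
  using finite[of J] assms
proof (induction J arbitrary: f rule: finite_induct)
  case empty
  then have "f z = f (\<chi> i. 1)" if "z \<in> orbit" for z using independent_of_all_coordinates[of f z] that by auto
  then show ?case by (intro laurent_on_orbit_cong[OF laurent_on_orbit_const])
next
  case (insert i J)
  have "\<forall>m. \<exists>(b :: nat \<Rightarrow> complex) K. m < N \<longrightarrow> (\<forall>c. (\<Sum>j\<le>K. b j * (\<Sum>l<N. c l * (2 ^ j) ^ l)) = c m)"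
    using coefficient_from_values_at_powers_of_2 by blast
  then obtain b :: "nat \<Rightarrow> nat \<Rightarrow> complex" and K
    where b: "\<And>m c. m < N \<Longrightarrow> (\<Sum>j\<le>K m. b m j * (\<Sum>l<N. c l * (2 ^ j) ^ l)) = c m" by metis
  define C where "C m z = (\<Sum>j\<le>K m. b m j * f (put z i (2 ^ j)))" for m z
  have "f z = (\<Sum>m<N. C m z * z $ i ^ m)" if z: "z \<in> orbit" for z
  proof -
    obtain c where c: "\<forall>\<xi>. \<xi> \<noteq> 0 \<longrightarrow> f (put z i \<xi>) = (\<Sum>m<N. c m * \<xi> ^ m)"
      using insert.prems(1)[of i] z by (auto simp: polynomial_along_def)
    have "C m z = c m" if "m < N" for m
      unfolding C_def using b[OF that, of c] c by simp
    moreover have "f z = (\<Sum>m<N. c m * z $ i ^ m)"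
      using c[rule_format, of "z $ i"] z by (simp add: orbit_def)
    ultimately show ?thesis by simp
  qed
  moreover have "laurent_on_orbit (C m)" for m
  proof (rule insert.IH)
    show "polynomial_along N (C m) i'" if "i' \<in> J" for i'
      unfolding C_def using that insert.hyps insert.prems(1)
      by (intro polynomial_along_lincomb polynomial_along_put) auto
    show "C m (put z i' \<xi>) = C m z" if "z \<in> orbit" "i' \<notin> J" "\<xi> \<noteq> 0" for z i' \<xi>
    proof (cases "i' = i")
      case False
      have "f (put (put z i' \<xi>) i (2 ^ j)) = f (put z i (2 ^ j))" for j
        using that False insert.prems(2)[of "put z i (2 ^ j)" i' \<xi>]
        by (simp add: put_commute[OF False] put_in_orbit)
      then show ?thesis by (simp add: C_def)
    qed (simp add: C_def)
  qed
  then have "laurent_on_orbit (\<lambda>z. \<Sum>m<N. C m z * z $ i ^ m)"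
    by (intro laurent_on_orbit_sum laurent_on_orbit_mult_power finite_lessThan)
  ultimately show ?case by (rule laurent_on_orbit_cong[rotated])
qed

section \<open>Holomorphic functions on a chart and orders of vanishing of polynomials\<close>

lemma continuous_eq_if_eq_on_orbit:
  fixes f g :: "complex ^ 'n \<Rightarrow> 'b::t2_space"
  assumes "continuous_on UNIV f" "continuous_on UNIV g" and eq: "\<And>z. z \<in> orbit \<Longrightarrow> f z = g z"
  shows "f z = g z"
proof -
  define s where "s k = (\<chi> i. if z $ i = 0 then of_real (inverse (real (Suc k))) else z $ i)" for k
  have "(\<lambda>k. if z $ i = 0 then of_real (inverse (real (Suc k))) else z $ i) \<longlonglongrightarrow> z $ i" for i
  proof (cases "z $ i = 0")
    case True
    have "(\<lambda>k. of_real (inverse (real (Suc k)))) \<longlonglongrightarrow> complex_of_real 0"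
      by (intro tendsto_of_real LIMSEQ_inverse_real_of_nat)
    then show ?thesis by (simp only: True if_True of_real_0 simp_thms)
  qed simp
  then have s: "s \<longlonglongrightarrow> z" by (intro vec_tendstoI) (simp add: s_def)
  have "isCont f z" "isCont g z" using assms(1,2) by (auto simp: continuous_on_eq_continuous_at)
  then have "(\<lambda>k. f (s k)) \<longlonglongrightarrow> f z" "(\<lambda>k. g (s k)) \<longlonglongrightarrow> g z"
    using s by (auto intro: isCont_tendsto_compose)
  moreover have "s k \<in> orbit" for k by (simp add: orbit_def s_def del: of_nat_Suc)
  then have "(\<lambda>k. f (s k)) = (\<lambda>k. g (s k))" using eq by auto
  ultimately show ?thesis using LIMSEQ_unique by metis
qed

lemma holomorphic_fun_imp_continuous: "holomorphic_fun f \<Longrightarrow> continuous_on UNIV f"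
  unfolding holomorphic_fun_def continuous_on_eq_continuous_at[OF open_UNIV]
  using has_derivative_continuous by blast

lemma holomorphic_fun_const: "holomorphic_fun (\<lambda>_. c)"
  unfolding holomorphic_fun_def by (intro allI exI[of _ "\<lambda>_. 0"]) auto

lemma holomorphic_fun_nth: "holomorphic_fun (\<lambda>z. z $ i)"
  unfolding holomorphic_fun_def
  by (intro allI exI[of _ "\<lambda>z. z $ i"]) (auto intro: bounded_linear_imp_has_derivative bounded_linear_vec_nth)

lemma holomorphic_fun_add: "holomorphic_fun f \<Longrightarrow> holomorphic_fun g \<Longrightarrow> holomorphic_fun (\<lambda>z. f z + g z)"
  unfolding holomorphic_fun_def
proof
  fix z assume f: "\<forall>z. \<exists>D. (f has_derivative D) (at z) \<and> (\<forall>c h. D (c *s h) = c * D h)"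
    and g: "\<forall>z. \<exists>D. (g has_derivative D) (at z) \<and> (\<forall>c h. D (c *s h) = c * D h)"
  obtain D where "(f has_derivative D) (at z)" "\<forall>c h. D (c *s h) = c * D h"
    using spec[OF f, of z] by (elim exE conjE)
  moreover obtain D' where "(g has_derivative D') (at z)" "\<forall>c h. D' (c *s h) = c * D' h"
    using spec[OF g, of z] by (elim exE conjE)
  ultimately show "\<exists>D. ((\<lambda>z. f z + g z) has_derivative D) (at z) \<and> (\<forall>c h. D (c *s h) = c * D h)"
    by (intro exI[of _ "\<lambda>h. D h + D' h"] conjI has_derivative_add) (auto simp: algebra_simps)
qed

lemma holomorphic_fun_mult: "holomorphic_fun f \<Longrightarrow> holomorphic_fun g \<Longrightarrow> holomorphic_fun (\<lambda>z. f z * g z)"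
  unfolding holomorphic_fun_def
proof
  fix z assume f: "\<forall>z. \<exists>D. (f has_derivative D) (at z) \<and> (\<forall>c h. D (c *s h) = c * D h)"
    and g: "\<forall>z. \<exists>D. (g has_derivative D) (at z) \<and> (\<forall>c h. D (c *s h) = c * D h)"
  obtain D where "(f has_derivative D) (at z)" "\<forall>c h. D (c *s h) = c * D h"
    using spec[OF f, of z] by (elim exE conjE)
  moreover obtain D' where "(g has_derivative D') (at z)" "\<forall>c h. D' (c *s h) = c * D' h"
    using spec[OF g, of z] by (elim exE conjE)
  ultimately show "\<exists>D. ((\<lambda>z. f z * g z) has_derivative D) (at z) \<and> (\<forall>c h. D (c *s h) = c * D h)"
    by (intro exI[of _ "\<lambda>h. f z * D' h + D h * g z"] conjI has_derivative_mult) (auto simp: algebra_simps)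
qed

lemma holomorphic_fun_power: "holomorphic_fun f \<Longrightarrow> holomorphic_fun (\<lambda>z. f z ^ m)"
  by (induction m) (auto intro: holomorphic_fun_const holomorphic_fun_mult)

lemma holomorphic_fun_sum:
  "finite A \<Longrightarrow> (\<And>a. a \<in> A \<Longrightarrow> holomorphic_fun (f a)) \<Longrightarrow> holomorphic_fun (\<lambda>z. \<Sum>a\<in>A. f a z)"
  by (induction A rule: finite_induct) (auto intro: holomorphic_fun_const holomorphic_fun_add)

lemma holomorphic_fun_prod:
  "finite A \<Longrightarrow> (\<And>a. a \<in> A \<Longrightarrow> holomorphic_fun (f a)) \<Longrightarrow> holomorphic_fun (\<lambda>z. \<Prod>a\<in>A. f a z)"
  by (induction A rule: finite_induct) (auto intro: holomorphic_fun_const holomorphic_fun_mult)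

definition npow :: "('n::finite \<Rightarrow> nat) \<Rightarrow> complex ^ 'n \<Rightarrow> complex" where
  "npow \<alpha> z = (\<Prod>i\<in>UNIV. z $ i ^ \<alpha> i)"

lemma npow_eq_mon: "npow \<alpha> = mon (\<lambda>i. int (\<alpha> i))"
  by (simp add: fun_eq_iff npow_def mon_def)

lemma mon_eq_npow: "(\<And>i. e i \<ge> 0) \<Longrightarrow> mon e = npow (\<lambda>i. nat (e i))"
  by (simp add: npow_eq_mon)

lemma holomorphic_fun_npow: "holomorphic_fun (npow \<alpha>)"
  unfolding npow_def
  by (intro holomorphic_fun_prod holomorphic_fun_power holomorphic_fun_nth) auto

lemma npow_split: "npow \<alpha> z = z $ i ^ \<alpha> i * npow (\<alpha>(i := 0)) z"
proof -
  have "npow \<alpha> z = z $ i ^ \<alpha> i * (\<Prod>j\<in>UNIV - {i}. z $ j ^ \<alpha> j)"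
    unfolding npow_def by (rule prod.remove) auto
  moreover have "npow (\<alpha>(i := 0)) z = z $ i ^ (\<alpha>(i := 0)) i * (\<Prod>j\<in>UNIV - {i}. z $ j ^ (\<alpha>(i := 0)) j)"
    unfolding npow_def by (rule prod.remove) auto
  moreover have "(\<Prod>j\<in>UNIV - {i}. z $ j ^ (\<alpha>(i := 0)) j) = (\<Prod>j\<in>UNIV - {i}. z $ j ^ \<alpha> j)"
    by (intro prod.cong) auto
  ultimately show ?thesis by simp
qed

text \<open>Serves to replace the quotient that \<open>leading_restriction\<close> picks by
  \<open>SOME\<close> with an explicit one: division is possible on the orbit, which is
  dense.\<close>

lemma holomorphic_quotient_unique:
  assumes "holomorphic_fun g" "holomorphic_fun h" "\<And>z. z $ i ^ m * g z = z $ i ^ m * h z"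
  shows "g = h"
proof
  fix z show "g z = h z"
  proof (rule continuous_eq_if_eq_on_orbit)
    fix z :: "complex ^ 'a" assume "z \<in> orbit"
    then show "g z = h z" using assms(3)[of z] by (simp add: orbit_def)
  qed (use assms holomorphic_fun_imp_continuous in auto)
qed

text \<open>The power of \<open>z $ i\<close> with exponent \<open>m\<close> splits off explicitly,
  with quotient \<open>g0\<close>. If a higher power divided \<open>f\<close>, then
  \<open>g0\<close> would vanish on \<open>z $ i = 0\<close>; but its restriction there is the sum
  of the terms of least exponent, nonzero because distinct monomials are independent.\<close>

lemma vanishing_order_polynomial:
  fixes S :: "('n::finite \<Rightarrow> nat) set"
  assumes S: "finite S" "S \<noteq> {}" "\<And>\<alpha>. \<alpha> \<in> S \<Longrightarrow> c \<alpha> \<noteq> 0"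
    and f: "f = (\<lambda>z. \<Sum>\<alpha>\<in>S. c \<alpha> * npow \<alpha> z)" and m: "m = Min ((\<lambda>\<alpha>. \<alpha> i) ` S)"
  shows "vanishing_order i f = m"
    and "leading_restriction i f = (\<lambda>z. \<Sum>\<alpha>\<in>{\<alpha>\<in>S. \<alpha> i = m}. c \<alpha> * npow (\<alpha>(i := 0)) z)"
proof -
  define g0 where "g0 z = (\<Sum>\<alpha>\<in>S. c \<alpha> * (z $ i ^ (\<alpha> i - m) * npow (\<alpha>(i := 0)) z))" for z
  have m_le: "m \<le> \<alpha> i" if "\<alpha> \<in> S" for \<alpha> using that S m by simp
  have hol: "holomorphic_fun g0" unfolding g0_def
    by (intro holomorphic_fun_sum holomorphic_fun_mult holomorphic_fun_const holomorphic_fun_power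
        holomorphic_fun_nth holomorphic_fun_npow S)
  have fg: "f z = z $ i ^ m * g0 z" for z
    unfolding f g0_def sum_distrib_left
  proof (intro sum.cong refl)
    fix \<alpha> assume "\<alpha> \<in> S"
    then have "z $ i ^ \<alpha> i = z $ i ^ m * z $ i ^ (\<alpha> i - m)" using m_le by (simp flip: power_add)
    then show "c \<alpha> * npow \<alpha> z = z $ i ^ m * (c \<alpha> * (z $ i ^ (\<alpha> i - m) * npow (\<alpha>(i := 0)) z))"
      by (simp add: npow_split[of \<alpha> z i])
  qed
  have restr: "g0 (\<chi> j. if j = i then 0 else z $ j) = (\<Sum>\<alpha>\<in>{\<alpha>\<in>S. \<alpha> i = m}. c \<alpha> * npow (\<alpha>(i := 0)) z)" for z
  proof -
    have "npow (\<alpha>(i := 0)) (\<chi> j. if j = i then 0 else z $ j) = npow (\<alpha>(i := 0)) z" for \<alpha>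
      unfolding npow_def by (intro prod.cong) auto
    moreover have "(0 :: complex) ^ (\<alpha> i - m) = (if \<alpha> i = m then 1 else 0)" if "\<alpha> \<in> S" for \<alpha>
      using m_le[OF that] by auto
    ultimately have "g0 (\<chi> j. if j = i then 0 else z $ j)
        = (\<Sum>\<alpha>\<in>S. if \<alpha> i = m then c \<alpha> * npow (\<alpha>(i := 0)) z else 0)"
      unfolding g0_def by (intro sum.cong) auto
    then show ?thesis using S(1) by (simp add: sum.inter_filter)
  qed
  show vo: "vanishing_order i f = m"
    unfolding vanishing_order_def
  proof (rule Greatest_equality)
    show "\<exists>g. holomorphic_fun g \<and> (\<forall>z. f z = z $ i ^ m * g z)" using hol fg by blast
    fix m' assume "\<exists>g. holomorphic_fun g \<and> (\<forall>z. f z = z $ i ^ m' * g z)"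
    then obtain g where g: "holomorphic_fun g" "\<And>z. f z = z $ i ^ m' * g z" by blast
    show "m' \<le> m"
    proof (rule ccontr)
      assume "\<not> m' \<le> m"
      then have m': "z $ i ^ m' = z $ i ^ m * z $ i ^ (m' - m)" for z :: "complex ^ 'n"
        by (simp flip: power_add)
      have "g0 = (\<lambda>z. z $ i ^ (m' - m) * g z)"
      proof (rule holomorphic_quotient_unique[OF hol])
        show "holomorphic_fun (\<lambda>z. z $ i ^ (m' - m) * g z)"
          by (intro holomorphic_fun_mult holomorphic_fun_power holomorphic_fun_nth g)
        show "z $ i ^ m * g0 z = z $ i ^ m * (z $ i ^ (m' - m) * g z)" for z
          using fg[of z] g(2)[of z] by (simp only: m' mult.assoc)
      qed
      then have z0: "(\<Sum>\<alpha>\<in>{\<alpha>\<in>S. \<alpha> i = m}. c \<alpha> * npow (\<alpha>(i := 0)) z) = 0" for z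
        using \<open>\<not> m' \<le> m\<close> by (simp flip: restr)
      have "m \<in> (\<lambda>\<alpha>. \<alpha> i) ` S" unfolding m using S by (intro Min_in) auto
      then obtain \<alpha> where \<alpha>: "\<alpha> \<in> S" "\<alpha> i = m" by auto
      have "c \<alpha> = 0"
      proof (rule monomials_independent[where E = "\<lambda>\<alpha> j. int ((\<alpha>(i := 0)) j)" and I = "{\<alpha>\<in>S. \<alpha> i = m}" and c = c])
        show "inj_on (\<lambda>\<alpha> j. int ((\<alpha>(i := 0)) j)) {\<alpha> \<in> S. \<alpha> i = m}"
        proof (rule inj_onI)
          fix \<alpha> \<beta> assume ab: "\<alpha> \<in> {\<alpha>\<in>S. \<alpha> i = m}" "\<beta> \<in> {\<alpha>\<in>S. \<alpha> i = m}"
            and eq: "(\<lambda>j. int ((\<alpha>(i := 0)) j)) = (\<lambda>j. int ((\<beta>(i := 0)) j))"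
          have "\<alpha> j = \<beta> j" for j
            using ab fun_cong[OF eq, of j] by (cases "j = i") auto
          then show "\<alpha> = \<beta>" by auto
        qed
        show "(\<Sum>\<alpha>\<in>{\<alpha> \<in> S. \<alpha> i = m}. c \<alpha> * mon (\<lambda>j. int ((\<alpha>(i := 0)) j)) z) = 0" for z
          using z0[of z] unfolding npow_eq_mon .
      qed (use S \<alpha> in auto)
      then show False using S \<alpha> by auto
    qed
  qed
  define g where "g = (SOME g. holomorphic_fun g \<and> (\<forall>z. f z = z $ i ^ m * g z))"
  have "holomorphic_fun g \<and> (\<forall>z. f z = z $ i ^ m * g z)"
    unfolding g_def by (rule someI[of _ g0]) (use hol fg in blast)
  then have g: "holomorphic_fun g" "\<And>z. f z = z $ i ^ m * g z" by auto
  have "g = g0"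
    by (rule holomorphic_quotient_unique[OF g(1) hol, where i = i and m = m])
      (simp only: fg[symmetric] g(2)[symmetric])
  then show "leading_restriction i f = (\<lambda>z. \<Sum>\<alpha>\<in>{\<alpha>\<in>S. \<alpha> i = m}. c \<alpha> * npow (\<alpha>(i := 0)) z)"
    unfolding leading_restriction_def vo g_def[symmetric] Let_def by (simp add: restr)
qed

text \<open>Each step keeps the terms of least exponent in the current variable and deletes that
  variable. Deletion is injective on these terms, so nothing cancels and coefficients stay nonzero;
  the process ends at the lexicographically least exponent. The last hypothesis makes
  \<open>S\<close> the singleton of the zero exponent once the list is empty.\<close>

lemma iterated_orders_polynomial:
  fixes S :: "('n::finite \<Rightarrow> nat) set"
  assumes "finite S" "S \<noteq> {}" "\<And>\<alpha>. \<alpha> \<in> S \<Longrightarrow> c \<alpha> \<noteq> 0" "distinct is"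
    and "\<And>\<alpha> j. \<alpha> \<in> S \<Longrightarrow> j \<notin> set is \<Longrightarrow> \<alpha> j = 0"
  shows "iterated_orders is (\<lambda>z. \<Sum>\<alpha>\<in>S. c \<alpha> * npow \<alpha> z) \<in> S"
  using assms
proof (induction "is" arbitrary: S c)
  case Nil
  then obtain \<alpha> where "\<alpha> \<in> S" by blast
  moreover from this have "\<alpha> = (\<lambda>_. 0)" using Nil.prems(5) by (simp add: fun_eq_iff)
  ultimately show ?case by simp
next
  case (Cons i "is")
  let ?f = "\<lambda>z. \<Sum>\<alpha>\<in>S. c \<alpha> * npow \<alpha> z"
  define m where "m = Min ((\<lambda>\<alpha>. \<alpha> i) ` S)"
  define S0 where "S0 = {\<alpha>\<in>S. \<alpha> i = m}"
  define T where "T = (\<lambda>\<alpha>. \<alpha>(i := 0::nat)) ` S0"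
  note vo = vanishing_order_polynomial[where c = c, OF Cons.prems(1-3) refl m_def]
  have inj: "inj_on (\<lambda>\<alpha>. \<alpha>(i := 0)) S0"
  proof (rule inj_onI)
    fix \<alpha> \<beta> assume ab: "\<alpha> \<in> S0" "\<beta> \<in> S0" "\<alpha>(i := 0) = \<beta>(i := 0)"
    have "\<gamma> = (\<gamma>(i := 0))(i := m)" if "\<gamma> \<in> S0" for \<gamma> using that by (auto simp: S0_def)
    from this[OF ab(1)] this[OF ab(2)] ab(3) show "\<alpha> = \<beta>" by simp
  qed
  have lr: "leading_restriction i ?f = (\<lambda>z. \<Sum>\<beta>\<in>T. c (\<beta>(i := m)) * npow \<beta> z)"
  proof -
    have "(\<Sum>\<alpha>\<in>S0. c \<alpha> * npow (\<alpha>(i := 0)) z) = (\<Sum>\<beta>\<in>T. c (\<beta>(i := m)) * npow \<beta> z)" for z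
      unfolding T_def sum.reindex[OF inj] by (intro sum.cong) (auto simp: S0_def)
    then show ?thesis using vo(2) unfolding S0_def[symmetric] by simp
  qed
  have "iterated_orders is (\<lambda>z. \<Sum>\<beta>\<in>T. c (\<beta>(i := m)) * npow \<beta> z) \<in> T"
  proof (rule Cons.IH)
    have "m \<in> (\<lambda>\<alpha>. \<alpha> i) ` S" unfolding m_def using Cons.prems by (intro Min_in) auto
    then show "T \<noteq> {}" by (auto simp: T_def S0_def)
    show "finite T" using Cons.prems(1) by (simp add: T_def S0_def)
    show "c (\<beta>(i := m)) \<noteq> 0" if "\<beta> \<in> T" for \<beta>
      using that Cons.prems(3) by (auto simp: T_def S0_def)
    show "distinct is" using Cons.prems by simp
    show "\<beta> j = 0" if "\<beta> \<in> T" "j \<notin> set is" for \<beta> j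
      using that Cons.prems(5) by (auto simp: T_def S0_def)
  qed
  then obtain \<alpha> where \<alpha>: "\<alpha> \<in> S0" "iterated_orders is (leading_restriction i ?f) = \<alpha>(i := 0)"
    unfolding lr T_def by blast
  then have "iterated_orders (i # is) ?f = \<alpha>"
    by (auto simp: vo(1) S0_def)
  with \<alpha>(1) show ?case by (simp add: S0_def)
qed

section \<open>Slopes of affine minorants, Hausdorff limits and lattice points\<close>

text \<open>The effective domain of the convex conjugate of \<open>f\<close>. It is convex, as the
  hull and hyperplane arguments require, while a set of subgradients is so only up to boundary
  points.\<close>

definition minorant_slopes :: "('a::real_inner \<Rightarrow> real) \<Rightarrow> 'a set" where
  "minorant_slopes f = {p. \<exists>C. \<forall>x. f x \<ge> p \<bullet> x - C}"

lemma convex_minorant_slopes: "convex (minorant_slopes f)"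
proof (rule convexI)
  fix p q :: 'a and u v :: real
  assume "p \<in> minorant_slopes f" "q \<in> minorant_slopes f" and uv: "0 \<le> u" "0 \<le> v" "u + v = 1"
  then obtain C D where C: "\<And>x. f x \<ge> p \<bullet> x - C" and D: "\<And>x. f x \<ge> q \<bullet> x - D"
    by (auto simp: minorant_slopes_def)
  have "f x \<ge> (u *\<^sub>R p + v *\<^sub>R q) \<bullet> x - (u * C + v * D)" for x
  proof -
    have "u * (p \<bullet> x - C) + v * (q \<bullet> x - D) \<le> u * f x + v * f x"
      using uv C D by (intro add_mono mult_left_mono) auto
    also have "\<dots> = f x" using uv by (simp flip: distrib_right)
    finally show ?thesis by (simp add: inner_add_left algebra_simps)
  qed
  then show "u *\<^sub>R p + v *\<^sub>R q \<in> minorant_slopes f" by (auto simp: minorant_slopes_def)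
qed

lemma subgradient_image_subset_minorant_slopes: "subgradient_image f \<subseteq> minorant_slopes f"
proof
  fix p assume "p \<in> subgradient_image f"
  then obtain x where "\<And>y. f y \<ge> f x + p \<bullet> (y - x)" by (auto simp: subgradient_image_def)
  then have "f y \<ge> p \<bullet> y - (p \<bullet> x - f x)" for y by (simp add: inner_diff_right algebra_simps)
  then show "p \<in> minorant_slopes f" by (auto simp: minorant_slopes_def)
qed

text \<open>
  The subgradient is read off at the minimum \<open>x\<^sub>0\<close> of \<open>f - p + \<mu>|x|\<^sup>2/2\<close>: it is \<open>p - \<mu>x\<^sub>0\<close>, and the minimum
  property bounds \<open>\<mu>|x\<^sub>0|\<close> when \<open>\<mu>\<close> is small.
\<close>

lemma subgradient_near_approximate_minorant:
  fixes f :: "'a::euclidean_space \<Rightarrow> real"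
  assumes cvx: "convex_on UNIV f" and \<epsilon>: "0 \<le> \<epsilon>" "2 * \<epsilon> < \<delta>"
    and low: "\<And>x. f x \<ge> p \<bullet> x - \<epsilon> * norm x - C"
  shows "\<exists>q\<in>subgradient_image f. dist p q < \<delta>"
proof -
  define K where "K = f 0 + C"
  have K: "K \<ge> 0" using low[of 0] by (simp add: K_def)
  \<comment> \<open>Dictated by the bound on \<open>\<mu> * r\<close> below:
    \<open>\<mu> * r \<ge> \<delta>\<close> would force
    \<open>\<mu> * (K + 1) \<le> \<mu> * K\<close>. Here \<open>K\<close> is the height of
    \<open>f\<close> above the approximate minorant at the origin.\<close>
  define \<mu> where "\<mu> = (\<delta> / 2 - \<epsilon>) * \<delta> / (K + 1)"
  have \<delta>: "\<delta> > 0" using \<epsilon> by linarith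
  have \<mu>: "\<mu> > 0" using \<epsilon> K \<delta> by (simp add: \<mu>_def)
  define h where "h x = f x - p \<bullet> x + \<mu> / 2 * (norm x)\<^sup>2" for x
  have h_low: "h x \<ge> \<mu> / 2 * (norm x)\<^sup>2 - \<epsilon> * norm x - C" for x
    using low[of x] by (simp add: h_def)
  have cont: "continuous_on UNIV h"
    unfolding h_def using convex_on_continuous[OF open_UNIV cvx] by (intro continuous_intros) auto
  \<comment> \<open>Beyond this radius the quadratic term outweighs
    \<open>\<epsilon> * norm x\<close> and \<open>K\<close> together, so \<open>h\<close> is at
    least \<open>h 0\<close> there and the minimum over the ball is global.\<close>
  define R where "R = max (4 * \<epsilon> / \<mu>) (4 * K / \<mu> + 1)"
  have "4 * \<epsilon> / \<mu> \<ge> 0" using \<mu> \<epsilon> by simp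
  then have R: "R \<ge> 0" by (simp add: R_def)
  have "\<exists>x0\<in>cball 0 R. \<forall>y\<in>cball 0 R. h x0 \<le> h y"
  proof (rule continuous_attains_inf)
    show "cball (0::'a) R \<noteq> {}" using R by simp
  qed (use cont continuous_on_subset in auto)
  then obtain x0 where x0: "\<And>y. norm y \<le> R \<Longrightarrow> h x0 \<le> h y"
    by (metis mem_cball_0)
  have min: "h x0 \<le> h y" for y
  proof (cases "norm y \<le> R")
    case False
    define r where "r = norm y"
    have r: "r > R" "r > 4 * \<epsilon> / \<mu>" "r > 4 * K / \<mu> + 1" using False by (auto simp: r_def R_def)
    have r1: "r \<ge> 1" using r K \<mu> by (smt (verit) divide_nonneg_pos)
    have "\<mu> * r > 4 * \<epsilon>" "\<mu> * r \<ge> 4 * K" using r \<mu> by (simp_all add: field_simps)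
    then have "\<mu> / 4 * r * r \<ge> \<epsilon> * r" "\<mu> / 4 * r * r \<ge> K * r" using r1 by (intro mult_right_mono; simp)+
    moreover have "K * r \<ge> K" using K r1 by (simp add: mult_le_cancel_left1)
    ultimately have "\<mu> / 2 * r\<^sup>2 - \<epsilon> * r \<ge> K" by (simp add: power2_eq_square)
    then have "h y \<ge> f 0" using h_low[of y] by (simp add: K_def r_def)
    moreover have "h x0 \<le> h 0" using R by (intro x0) simp
    ultimately show ?thesis by (simp add: h_def)
  qed (rule x0)
  define r where "r = norm x0"
  have bnd: "\<mu> * r < \<delta>"
  proof (rule ccontr)
    assume "\<not> \<mu> * r < \<delta>"
    then have ge: "\<mu> * r \<ge> \<delta>" by simp
    have r0: "r \<ge> 0" by (simp add: r_def)
    have "\<mu> / 2 * r\<^sup>2 - \<epsilon> * r \<le> K"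
      using min[of 0] h_low[of x0] by (simp add: h_def K_def r_def)
    moreover have "\<delta> / 2 * r \<le> \<mu> / 2 * r\<^sup>2"
      using mult_right_mono[OF ge r0] by (simp add: power2_eq_square)
    ultimately have 1: "(\<delta> / 2 - \<epsilon>) * r \<le> K" by (simp add: algebra_simps)
    have "(\<delta> / 2 - \<epsilon>) * \<delta> \<le> (\<delta> / 2 - \<epsilon>) * (\<mu> * r)" using ge \<epsilon> by (intro mult_left_mono) auto
    also have "\<dots> = \<mu> * ((\<delta> / 2 - \<epsilon>) * r)" by simp
    also have "\<dots> \<le> \<mu> * K" using 1 \<mu> by (intro mult_left_mono) auto
    finally have "\<mu> * (K + 1) \<le> \<mu> * K" using K by (simp add: \<mu>_def)
    with \<mu> show False by simp
  qed
  have "f y \<ge> f x0 + (p - \<mu> *\<^sub>R x0) \<bullet> (y - x0)" for y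
  proof -
    define d where "d = y - x0"
    define B where "B = f y - f x0 - p \<bullet> d + \<mu> * (x0 \<bullet> d)"
    \<comment> \<open>The first order condition at the minimum: compare \<open>h\<close> at
      \<open>x0\<close> with \<open>h\<close> on the segment towards \<open>y\<close> and divide by
      \<open>t\<close>. Letting \<open>t\<close> tend to 0 leaves \<open>B \<ge> 0\<close>, which is
      the subgradient inequality.\<close>
    have ineq: "B + t * (\<mu> / 2 * (norm d)\<^sup>2) \<ge> 0" if t: "0 < t" "t \<le> 1" for t
    proof -
      have "f (x0 + t *\<^sub>R d) = f ((1 - t) *\<^sub>R x0 + t *\<^sub>R y)" by (simp add: d_def algebra_simps)
      also have "\<dots> \<le> (1 - t) * f x0 + t * f y" using t by (intro convex_onD[OF cvx]) auto
      finally have 1: "f (x0 + t *\<^sub>R d) \<le> f x0 + t * (f y - f x0)" by (simp add: algebra_simps)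
      have 2: "(norm (x0 + t *\<^sub>R d))\<^sup>2 = (norm x0)\<^sup>2 + 2 * t * (x0 \<bullet> d) + t * t * (norm d)\<^sup>2"
        unfolding power2_norm_eq_inner by (simp add: inner_add_left inner_add_right inner_commute)
      have 3: "p \<bullet> (x0 + t *\<^sub>R d) = p \<bullet> x0 + t * (p \<bullet> d)" by (simp add: inner_add_right)
      have "h x0 \<le> h (x0 + t *\<^sub>R d)" by (rule min)
      then have "0 \<le> f (x0 + t *\<^sub>R d) - f x0 - t * (p \<bullet> d) + \<mu> / 2 * (2 * t * (x0 \<bullet> d) + t * t * (norm d)\<^sup>2)"
        unfolding h_def 2 3 by (simp add: algebra_simps)
      also have "\<dots> \<le> t * (f y - f x0) - t * (p \<bullet> d) + \<mu> / 2 * (2 * t * (x0 \<bullet> d) + t * t * (norm d)\<^sup>2)"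
        using 1 by simp
      also have "\<dots> = t * (B + t * (\<mu> / 2 * (norm d)\<^sup>2))" by (simp add: B_def algebra_simps)
      finally show ?thesis using t by (simp add: zero_le_mult_iff)
    qed
    have "((\<lambda>t. B + t * (\<mu> / 2 * (norm d)\<^sup>2)) \<longlongrightarrow> B + 0 * (\<mu> / 2 * (norm d)\<^sup>2)) (at_right 0)"
      by (intro tendsto_intros)
    moreover have "\<forall>\<^sub>F t in at_right 0. B + t * (\<mu> / 2 * (norm d)\<^sup>2) \<ge> 0"
      using ineq by (intro eventually_at_rightI[of 0 1]) auto
    ultimately have "B + 0 * (\<mu> / 2 * (norm d)\<^sup>2) \<ge> 0"
      by (rule tendsto_lowerbound) simp
    then show ?thesis by (simp add: B_def d_def inner_diff_left)
  qed
  then have "p - \<mu> *\<^sub>R x0 \<in> subgradient_image f" by (auto simp: subgradient_image_def)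
  moreover have "dist p (p - \<mu> *\<^sub>R x0) < \<delta>" using bnd \<mu> by (simp add: dist_norm r_def)
  ultimately show ?thesis by blast
qed

lemma closure_subgradient_image:
  fixes f :: "'a::euclidean_space \<Rightarrow> real"
  assumes "convex_on UNIV f"
  shows "closure (subgradient_image f) = closure (minorant_slopes f)"
proof
  show "closure (subgradient_image f) \<subseteq> closure (minorant_slopes f)"
    by (intro closure_mono subgradient_image_subset_minorant_slopes)
  have "minorant_slopes f \<subseteq> closure (subgradient_image f)"
  proof
    fix p assume "p \<in> minorant_slopes f"
    then obtain C where "\<And>x. f x \<ge> p \<bullet> x - 0 * norm x - C" by (auto simp: minorant_slopes_def)
    then show "p \<in> closure (subgradient_image f)"
      using subgradient_near_approximate_minorant[OF assms, of 0]
      unfolding closure_approachable by (metis dist_commute mult_zero_right order_refl)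
  qed
  then show "closure (minorant_slopes f) \<subseteq> closure (subgradient_image f)"
    by (simp add: closure_minimal)
qed

text \<open>Difference quotients of a convex function increase along a ray, so the one from
  \<open>x\<close> to \<open>y\<close> is at most the asymptotic slope, and linear growth bounds
  that slope by \<open>L\<close>.\<close>

lemma convex_linear_growth_imp_lipschitz:
  fixes f :: "'a::real_normed_vector \<Rightarrow> real"
  assumes cvx: "convex_on UNIV f" and up: "\<And>x. f x \<le> C + L * norm x" and L: "L \<ge> 0"
  shows "f y - f x \<le> L * norm (y - x)"
proof -
  define K where "K = C + L * norm x - f x"
  have bound: "f y - f x \<le> K / t + L * norm (y - x)" if t: "t \<ge> 1" for t
  proof -
    define w where "w = x + t *\<^sub>R (y - x)"
    have y: "y = (1 - 1 / t) *\<^sub>R x + (1 / t) *\<^sub>R w" using t by (simp add: w_def algebra_simps)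
    have "f y \<le> (1 - 1 / t) * f x + (1 / t) * f w"
      using t unfolding y by (intro convex_onD[OF cvx]) auto
    then have "f y - f x \<le> (f w - f x) / t" by (simp add: field_simps diff_divide_distrib)
    also have "norm w \<le> norm x + t * norm (y - x)"
      unfolding w_def using t by (intro order_trans[OF norm_triangle_ineq]) simp
    then have "f w \<le> C + L * (norm x + t * norm (y - x))"
      using up[of w] L by (meson add_left_mono mult_left_mono order_trans)
    then have "(f w - f x) / t \<le> (K + t * (L * norm (y - x))) / t"
      using t by (intro divide_right_mono) (auto simp: K_def algebra_simps)
    also have "\<dots> = K / t + L * norm (y - x)" using t by (simp add: add_divide_distrib)
    finally show ?thesis .
  qed
  have "((\<lambda>t. K / t + L * norm (y - x)) \<longlongrightarrow> 0 + L * norm (y - x)) at_top"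
    by (intro tendsto_intros tendsto_divide_0[OF tendsto_const] filterlim_at_top_imp_at_infinity filterlim_ident)
  then have "f y - f x \<le> 0 + L * norm (y - x)"
    by (rule tendsto_lowerbound)
      (auto intro!: eventually_mono[OF eventually_ge_at_top[of 1] bound])
  then show ?thesis by simp
qed

section \<open>Hausdorff limits of hulls of rescaled lattice points\<close>

text \<open>Applied in both directions this gives uniqueness of the limit, as \<open>THE\<close> in
  \<open>partial_okounkov_body\<close> requires.\<close>

lemma hausdorff_limit_subset:
  assumes "hausdorff_converges A K" "hausdorff_converges A K'"
  shows "K \<subseteq> K'"
proof
  fix y assume y: "y \<in> K"
  have "\<exists>z\<in>K'. dist z y < \<epsilon>" if "\<epsilon> > 0" for \<epsilon>
  proof -
    have e: "\<epsilon> / 2 > 0" using that by simp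
    have "\<forall>\<^sub>F k in sequentially. \<forall>y\<in>K. \<exists>x\<in>A k. dist x y < \<epsilon> / 2"
      using assms(1) e unfolding hausdorff_converges_def by (blast intro: eventually_mono)
    moreover have "\<forall>\<^sub>F k in sequentially. \<forall>x\<in>A k. \<exists>y\<in>K'. dist x y < \<epsilon> / 2"
      using assms(2) e unfolding hausdorff_converges_def by (blast intro: eventually_mono)
    ultimately have "\<forall>\<^sub>F k in sequentially. \<exists>z\<in>K'. dist z y < \<epsilon>"
    proof eventually_elim
      case (elim k)
      then obtain x where x: "x \<in> A k" "dist x y < \<epsilon> / 2" using y by blast
      then obtain z where "z \<in> K'" "dist x z < \<epsilon> / 2" using elim by blast
      with x show ?case using dist_triangle_half_r[of x z \<epsilon> y] by blast
    qed
    then show ?thesis using eventually_happens'[OF sequentially_bot] by blast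
  qed
  then have "y \<in> closure K'" by (auto simp: closure_approachable)
  then show "y \<in> K'" using assms(2) by (simp add: hausdorff_converges_def compact_imp_closed)
qed

lemma partial_okounkov_body_eqI:
  "hausdorff_converges (okounkov_level \<Sigma> a \<phi> v) K \<Longrightarrow> partial_okounkov_body \<Sigma> a \<phi> v = K"
  unfolding partial_okounkov_body_def
  by (intro the_equality subset_antisym) (auto dest: hausdorff_limit_subset)

text \<open>In one direction, the \<open>c/k\<close>-neighbourhood of a convex set is convex, so it
  contains the hull as soon as it contains \<open>P k\<close>. In the other, an interior point
  \<open>p\<close> of \<open>D\<close> is approximated by rounding \<open>k p\<close> down, which
  gives a point of \<open>D\<close> for large \<open>k\<close>; finitely many balls around interior
  points cover the closure, so one threshold for \<open>k\<close> serves all of it.\<close>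

lemma hausdorff_converges_lattice_hulls:
  fixes P :: "nat \<Rightarrow> (real ^ 'n) set" and D :: "(real ^ 'n) set"
  assumes D: "convex D" "bounded D" "interior D \<noteq> {}"
    and near: "\<And>k x. k > 0 \<Longrightarrow> x \<in> P k \<Longrightarrow> \<exists>y\<in>closure D. dist x y \<le> c / real k"
    and lattice: "\<And>k m. k > 0 \<Longrightarrow> (\<chi> i. real_of_int (m i) / real k) \<in> D \<Longrightarrow> (\<chi> i. real_of_int (m i) / real k) \<in> P k"
  shows "hausdorff_converges (\<lambda>k. convex hull (P k)) (closure D)"
  unfolding hausdorff_converges_def
proof (intro conjI allI impI)
  show "compact (closure D)" using D(2) by (simp add: compact_closure)
  show "closure D \<noteq> {}" using D(3) interior_subset closure_subset by blast
  fix \<epsilon> :: real assume \<epsilon>: "\<epsilon> > 0"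
  have "((\<lambda>k. c / real k) \<longlongrightarrow> 0) sequentially" by (rule lim_const_over_n)
  then have "\<forall>\<^sub>F k in sequentially. c / real k < \<epsilon>" using \<epsilon> by (rule order_tendstoD)
  then have 1: "\<forall>\<^sub>F k in sequentially. \<forall>x\<in>convex hull (P k). \<exists>y\<in>closure D. dist x y < \<epsilon>"
    using eventually_gt_at_top[of 0]
  proof eventually_elim
    case (elim k)
    let ?N = "\<Union>x\<in>closure D. \<Union>y\<in>cball 0 (c / real k). {x + y}"
    have "convex ?N" using D(1) by (intro convex_sums) auto
    moreover have "P k \<subseteq> ?N"
    proof
      fix x assume "x \<in> P k"
      then obtain y where "y \<in> closure D" "dist x y \<le> c / real k" using near elim by blast
      then have "y \<in> closure D" "x - y \<in> cball 0 (c / real k)" "x = y + (x - y)"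
        by (auto simp: dist_norm norm_minus_commute)
      then show "x \<in> ?N" by blast
    qed
    ultimately have "convex hull (P k) \<subseteq> ?N" by (rule hull_minimal[rotated])
    have "\<exists>y\<in>closure D. dist x y < \<epsilon>" if "x \<in> ?N" for x
    proof -
      from that obtain y w where "y \<in> closure D" "w \<in> cball 0 (c / real k)" "x = y + w" by blast
      then show ?thesis using elim by (intro bexI[of _ y]) (auto simp: dist_norm)
    qed
    with \<open>convex hull (P k) \<subseteq> ?N\<close> show ?case by blast
  qed
  \<comment> \<open>This is where interior points enter: a convex set that has some lies in the
    closure of its interior, whereas a set inside a hyperplane may miss all rescaled lattice
    points.\<close>
  have "closure D = closure (interior D)" using convex_closure_interior[OF D(1,3)] by simp
  then have cover: "closure D \<subseteq> (\<Union>p\<in>interior D. ball p (\<epsilon> / 2))"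
  proof (intro subsetI)
    fix y assume "y \<in> closure D"
    with \<open>closure D = closure (interior D)\<close> have "y \<in> closure (interior D)" by simp
    then obtain p where "p \<in> interior D" "dist p y < \<epsilon> / 2"
      using \<epsilon> unfolding closure_approachable by (meson half_gt_zero)
    then show "y \<in> (\<Union>p\<in>interior D. ball p (\<epsilon> / 2))" by auto
  qed
  obtain T where T: "T \<subseteq> interior D" "finite T" "closure D \<subseteq> (\<Union>p\<in>T. ball p (\<epsilon> / 2))"
    using compactE_image[OF _ _ cover] D(2) by (metis compact_closure open_ball)
  have approx: "\<forall>\<^sub>F k in sequentially. \<exists>x\<in>P k. dist x p < \<epsilon> / 2" if p: "p \<in> interior D" for p
  proof -
    obtain r where r: "r > 0" "ball p r \<subseteq> D" using p by (auto simp: mem_interior)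
    define s where "s = min r (\<epsilon> / 2)"
    have s: "s > 0" using r \<epsilon> by (simp add: s_def)
    have "((\<lambda>k. real CARD('n) / real k) \<longlongrightarrow> 0) sequentially" by (rule lim_const_over_n)
    then have "\<forall>\<^sub>F k in sequentially. real CARD('n) / real k < s" using s by (rule order_tendstoD)
    then show ?thesis using eventually_gt_at_top[of 0]
    proof eventually_elim
      case (elim k)
      define m where "m i = \<lfloor>real k * p $ i\<rfloor>" for i
      define x where "x = (\<chi> i. real_of_int (m i) / real k)"
      have "\<bar>x $ i - p $ i\<bar> \<le> 1 / real k" for i
      proof -
        have "\<bar>real_of_int (m i) - real k * p $ i\<bar> \<le> 1" unfolding m_def by linarith
        then have "\<bar>real_of_int (m i) - real k * p $ i\<bar> / real k \<le> 1 / real k"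
          by (intro divide_right_mono) auto
        moreover have "\<bar>real_of_int (m i) - real k * p $ i\<bar> / real k = \<bar>x $ i - p $ i\<bar>"
        proof -
          have "x $ i - p $ i = (real_of_int (m i) - real k * p $ i) / real k"
            using elim by (simp add: x_def field_simps)
          then show ?thesis by simp
        qed
        ultimately show ?thesis by simp
      qed
      then have "(\<Sum>i\<in>UNIV. \<bar>(x - p) $ i\<bar>) \<le> (\<Sum>i\<in>(UNIV::'n set). 1 / real k)"
        by (intro sum_mono) simp
      then have "dist x p \<le> real CARD('n) / real k"
        unfolding dist_norm using norm_le_l1_cart[of "x - p"] by simp
      then have "dist x p < s" using elim by linarith
      moreover from this have "x \<in> D" using r by (auto simp: s_def dist_commute)
      then have "x \<in> P k" using lattice elim unfolding x_def by blast
      ultimately show ?case by (auto simp: s_def)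
    qed
  qed
  then have "\<forall>\<^sub>F k in sequentially. \<forall>p\<in>T. \<exists>x\<in>P k. dist x p < \<epsilon> / 2"
    using T by (intro eventually_ball_finite) auto
  then have 2: "\<forall>\<^sub>F k in sequentially. \<forall>y\<in>closure D. \<exists>x\<in>convex hull (P k). dist x y < \<epsilon>"
  proof eventually_elim
    case (elim k)
    show ?case
    proof
      fix y assume "y \<in> closure D"
      then obtain p where p: "p \<in> T" "dist p y < \<epsilon> / 2" using T(3) by auto
      then obtain x where x: "x \<in> P k" "dist x p < \<epsilon> / 2" using elim by blast
      have "dist x y < \<epsilon>" using dist_triangle_half_r[of p x \<epsilon> y] p x by (simp add: dist_commute)
      then show "\<exists>x\<in>convex hull (P k). dist x y < \<epsilon>" using x by (auto intro!: bexI[of _ x] hull_inc)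
    qed
  qed
  from 1 2 show "\<forall>\<^sub>F k in sequentially. (\<forall>x\<in>convex hull (P k). \<exists>y\<in>closure D. dist x y < \<epsilon>) \<and>
      (\<forall>y\<in>closure D. \<exists>x\<in>convex hull (P k). dist x y < \<epsilon>)"
    by eventually_elim simp
qed

section \<open>Counting lattice points near a hyperplane\<close>

lemma card_nats_of_bounded_spread:
  assumes "\<And>m n. m \<in> X \<Longrightarrow> n \<in> X \<Longrightarrow> m \<le> n + (D::nat)"
  shows "finite X \<and> card X \<le> D + 1"
proof (cases "X = {}")
  case False
  define l where "l = (LEAST m. m \<in> X)"
  have l: "l \<in> X" unfolding l_def using False by (meson LeastI ex_in_conv)
  have "X \<subseteq> {l..l + D}"
    using assms[OF _ l] by (auto simp: l_def intro: Least_le)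
  then show ?thesis using card_mono[of "{l..l + D}" X] finite_subset by fastforce
qed simp

text \<open>Fibre the points over the coordinates other than \<open>i\<close>. There are
  \<open>(M + 1)^(n - 1)\<close> fibres, and on each of them the remaining coordinate varies by at
  most \<open>2 * C / |a i| \<le> D\<close>, so it takes at most \<open>D + 1\<close> values. The
  gain is one power of \<open>M\<close> against the full box.\<close>

lemma card_lattice_points_near_hyperplane:
  fixes a :: "'n::finite \<Rightarrow> real" and M :: nat and b C :: real
  assumes i: "a i \<noteq> 0" and D: "2 * C / \<bar>a i\<bar> \<le> real D"
  defines "X \<equiv> {\<alpha> :: 'n \<Rightarrow> nat. (\<forall>j. \<alpha> j \<le> M) \<and> \<bar>(\<Sum>j\<in>UNIV. a j * real (\<alpha> j)) - b\<bar> \<le> C}"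
  shows "finite X" "card X \<le> (M + 1) ^ (CARD('n) - 1) * (D + 1)"
proof -
  define B where "B = (PiE (UNIV - {i}) (\<lambda>_. {..M}))"
  define F where "F \<beta> = {\<alpha>\<in>X. restrict \<alpha> (UNIV - {i}) = \<beta>}" for \<beta>
  have fib: "finite (F \<beta>) \<and> card (F \<beta>) \<le> D + 1" for \<beta>
  proof -
    have eq: "\<alpha> j = \<beta> j" if "\<alpha> \<in> F \<beta>" "j \<noteq> i" for \<alpha> j
      using that by (auto simp: F_def)
    have inj: "inj_on (\<lambda>\<alpha>. \<alpha> i) (F \<beta>)"
    proof (rule inj_onI)
      fix \<alpha> \<alpha>' assume h: "\<alpha> \<in> F \<beta>" "\<alpha>' \<in> F \<beta>" "\<alpha> i = \<alpha>' i"
      show "\<alpha> = \<alpha>'"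
      proof
        fix j show "\<alpha> j = \<alpha>' j" using h eq[OF h(1), of j] eq[OF h(2), of j] by (cases "j = i") auto
      qed
    qed
    have "m \<le> n + D" if mn: "m \<in> (\<lambda>\<alpha>. \<alpha> i) ` F \<beta>" "n \<in> (\<lambda>\<alpha>. \<alpha> i) ` F \<beta>" for m n
    proof -
      obtain \<alpha> \<alpha>' where h: "\<alpha> \<in> F \<beta>" "m = \<alpha> i" "\<alpha>' \<in> F \<beta>" "n = \<alpha>' i" using mn by blast
      have s: "(\<Sum>j\<in>UNIV. a j * real (\<gamma> j)) = a i * real (\<gamma> i) + (\<Sum>j\<in>UNIV - {i}. a j * real (\<beta> j))"
        if "\<gamma> \<in> F \<beta>" for \<gamma>
      proof -
        have "(\<Sum>j\<in>UNIV - {i}. a j * real (\<gamma> j)) = (\<Sum>j\<in>UNIV - {i}. a j * real (\<beta> j))"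
          using eq[OF that] by (intro sum.cong) auto
        then show ?thesis by (simp add: sum.remove[of UNIV i])
      qed
      have "\<bar>(\<Sum>j\<in>UNIV. a j * real (\<alpha> j)) - b\<bar> \<le> C" "\<bar>(\<Sum>j\<in>UNIV. a j * real (\<alpha>' j)) - b\<bar> \<le> C"
        using h by (auto simp: F_def X_def)
      then have "\<bar>a i * real m - a i * real n\<bar> \<le> 2 * C" unfolding s[OF h(1)] s[OF h(3)] h(2,4) by linarith
      then have "\<bar>a i\<bar> * \<bar>real m - real n\<bar> \<le> 2 * C" by (simp add: abs_mult flip: right_diff_distrib)
      then have "\<bar>real m - real n\<bar> \<le> 2 * C / \<bar>a i\<bar>" using i by (simp add: field_simps)
      with D have "\<bar>real m - real n\<bar> \<le> real D" by linarith
      then show ?thesis by linarith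
    qed
    then have "finite ((\<lambda>\<alpha>. \<alpha> i) ` F \<beta>) \<and> card ((\<lambda>\<alpha>. \<alpha> i) ` F \<beta>) \<le> D + 1"
      by (rule card_nats_of_bounded_spread)
    then show ?thesis using inj by (simp add: card_image finite_image_iff)
  qed
  have finB: "finite B" unfolding B_def by (intro finite_PiE) auto
  have cardB: "card B = (M + 1) ^ (CARD('n) - 1)" unfolding B_def by (simp add: card_PiE card_Diff_singleton)
  have "X \<subseteq> (\<Union>\<beta>\<in>B. F \<beta>)" by (auto simp: X_def F_def B_def)
  moreover have "finite (\<Union>\<beta>\<in>B. F \<beta>)" using finB fib by auto
  ultimately show "finite X" "card X \<le> (M + 1) ^ (CARD('n) - 1) * (D + 1)"
  proof -
    assume sub: "X \<subseteq> (\<Union>\<beta>\<in>B. F \<beta>)" and fin: "finite (\<Union>\<beta>\<in>B. F \<beta>)"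
    show "finite X" using sub fin by (rule finite_subset)
    have "card X \<le> card (\<Union>\<beta>\<in>B. F \<beta>)" using sub fin by (intro card_mono)
    also have "\<dots> \<le> (\<Sum>\<beta>\<in>B. card (F \<beta>))" by (rule card_UN_le[OF finB])
    also have "\<dots> \<le> (\<Sum>\<beta>\<in>B. D + 1)" using fib by (intro sum_mono) auto
    finally show "card X \<le> (M + 1) ^ (CARD('n) - 1) * (D + 1)" by (simp add: cardB)
  qed
qed

section \<open>Charts, transition functions and the potential\<close>

lemma matrix_inv_frame:
  fixes w :: "int ^ 'n ^ 'n"
  assumes "invertible w"
  shows "w ** matrix_inv w = mat 1" "matrix_inv w ** w = mat 1"
proof -
  have "w ** matrix_inv w = mat 1 \<and> matrix_inv w ** w = mat 1"
    unfolding matrix_inv_def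
    by (rule someI_ex[of "\<lambda>A'. w ** A' = mat 1 \<and> A' ** w = mat 1"]) (use assms in \<open>simp add: invertible_def\<close>)
  then show "w ** matrix_inv w = mat 1" "matrix_inv w ** w = mat 1" by auto
qed

lemma frames_invertible: "w \<in> frames \<Sigma> \<Longrightarrow> invertible w"
  by (simp add: frames_def)

lemma frame_change_mult: "invertible w' \<Longrightarrow> frame_change w w' ** w' = w"
  by (simp add: frame_change_def matrix_mul_assoc[symmetric] matrix_inv_frame)

lemma frame_change_inverse:
  assumes "invertible w" "invertible w'"
  shows "frame_change w w' ** frame_change w' w = mat 1"
proof -
  have "w ** matrix_inv w' ** (w' ** matrix_inv w) = w ** (matrix_inv w' ** w') ** matrix_inv w"
    by (simp only: matrix_mul_assoc)
  then show ?thesis using assms by (simp add: frame_change_def matrix_inv_frame)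
qed

text \<open>The character \<open>m\<close>, as a rational section of \<open>L\<^sup>k\<close>, is this monomial in the chart \<open>w\<close>.\<close>

definition expo :: "(int ^ 'n \<Rightarrow> int) \<Rightarrow> nat \<Rightarrow> int ^ 'n ^ 'n \<Rightarrow> int ^ 'n \<Rightarrow> 'n \<Rightarrow> int" where
  "expo a k w m i = int k * a (w $ i) + (w *v m) $ i"

definition transition_exponent :: "(int ^ 'n \<Rightarrow> int) \<Rightarrow> int ^ 'n ^ 'n \<Rightarrow> int ^ 'n ^ 'n \<Rightarrow> 'n \<Rightarrow> int" where
  "transition_exponent a w w' i = a (w $ i) - (\<Sum>j\<in>UNIV. frame_change w w' $ i $ j * a (w' $ j))"

lemma transition_eq_mon: "transition a w w' z = mon (transition_exponent a w w') z"
  by (simp add: transition_def mon_def transition_exponent_def)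

text \<open>The identity \<open>w = frame_change w w' ** w'\<close> transports the pairing with
  \<open>m\<close>; what the twists by \<open>a\<close> leave over is the exponent of the transition
  function.\<close>

lemma expo_change:
  assumes "invertible w'"
  shows "expo a k w m i = int k * transition_exponent a w w' i + (\<Sum>j\<in>UNIV. frame_change w w' $ i $ j * expo a k w' m j)"
proof -
  have "w *v m = frame_change w w' *v (w' *v m)"
    by (simp add: matrix_vector_mul_assoc frame_change_mult[OF assms])
  then have "(w *v m) $ i = (\<Sum>j\<in>UNIV. frame_change w w' $ i $ j * (w' *v m) $ j)"
    by (simp add: matrix_vector_mult_def)
  then show ?thesis
    by (simp add: expo_def transition_exponent_def algebra_simps sum.distrib sum_distrib_left)
qed

lemma expo_inject:
  assumes "invertible w"
  shows "expo a k w m = expo a k w m' \<longleftrightarrow> m = m'"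
proof
  assume eq: "expo a k w m = expo a k w m'"
  have "(w *v m) $ i = (w *v m') $ i" for i using fun_cong[OF eq, of i] by (simp add: expo_def)
  then have "w *v m = w *v m'" by (simp add: vec_eq_iff)
  then have "matrix_inv w *v (w *v m) = matrix_inv w *v (w *v m')" by simp
  then show "m = m'" using assms by (simp add: matrix_vector_mul_assoc matrix_inv_frame)
qed simp

text \<open>The rows of \<open>w\<close> form a basis of the lattice, so every integer vector is the
  exponent of a character. Monomials of an expansion and lattice points of a slope set are both
  turned into characters in this way.\<close>

lemma expo_surj:
  assumes "invertible w"
  shows "\<exists>m. expo a k w m = e"
proof
  have "w *v (matrix_inv w *v (\<chi> i. e i - int k * a (w $ i))) = (\<chi> i. e i - int k * a (w $ i))"
    using assms by (simp add: matrix_vector_mul_assoc matrix_inv_frame)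
  then show "expo a k w (matrix_inv w *v (\<chi> i. e i - int k * a (w $ i))) = e"
    by (simp add: expo_def fun_eq_iff)
qed

text \<open>The reason why identities between charts hold also where \<open>z $ i = 0\<close>: on
  the overlap this happens only over a shared ray.\<close>

lemma frame_change_shared_ray:
  assumes "invertible w'" "w $ i = w' $ j0"
  shows "frame_change w w' $ i $ j = (if j = j0 then 1 else 0)" "transition_exponent a w w' i = 0"
proof -
  have 1: "frame_change w w' $ i $ j = (if j = j0 then 1 else 0)" for j
  proof -
    have "frame_change w w' $ i $ j = (w' ** matrix_inv w') $ j0 $ j"
      using assms(2) by (simp add: frame_change_def matrix_matrix_mult_def)
    then show ?thesis using assms(1) by (simp add: matrix_inv_frame mat_def eq_commute)
  qed
  then show "frame_change w w' $ i $ j = (if j = j0 then 1 else 0)" .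
  show "transition_exponent a w w' i = 0" using assms(2)
    by (simp add: transition_exponent_def 1 if_distrib[of "\<lambda>x. x * _"] cong: if_cong)
qed

lemma power_int_prod: "(\<Prod>i\<in>A. f i) powi n = (\<Prod>i\<in>A. f i powi n)" for f :: "'a \<Rightarrow> complex"
  by (induction A rule: infinite_finite_induct) (auto simp: power_int_mult_distrib)

lemma power_int_sum:
  fixes x :: complex
  assumes "x \<noteq> 0"
  shows "x powi (\<Sum>i\<in>A. f i) = (\<Prod>i\<in>A. x powi f i)"
  by (induction A rule: infinite_finite_induct) (auto simp: power_int_add assms)

lemma mon_transition:
  assumes w': "invertible w'" and z: "z \<in> chart_overlap w w'"
  shows "mon (expo a k w m) z = transition a w w' z ^ k * mon (expo a k w' m) (chart_change w w' z)"
proof -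
  let ?A = "\<lambda>i j. frame_change w w' $ i $ j"
  have T: "transition a w w' z ^ k = (\<Prod>i\<in>UNIV. z $ i powi (int k * transition_exponent a w w' i))"
    by (simp add: transition_eq_mon mon_def mult.commute[of "int k"] power_int_mult flip: prod_power_distrib)
  have "mon (expo a k w' m) (chart_change w w' z)
      = (\<Prod>j\<in>UNIV. \<Prod>i\<in>UNIV. z $ i powi (?A i j * expo a k w' m j))"
    by (simp add: mon_def chart_change_def power_int_prod power_int_mult)
  also have "\<dots> = (\<Prod>i\<in>UNIV. \<Prod>j\<in>UNIV. z $ i powi (?A i j * expo a k w' m j))"
    by (rule prod.swap)
  finally have "transition a w w' z ^ k * mon (expo a k w' m) (chart_change w w' z)
      = (\<Prod>i\<in>UNIV. z $ i powi (int k * transition_exponent a w w' i) * (\<Prod>j\<in>UNIV. z $ i powi (?A i j * expo a k w' m j)))"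
    by (simp only: T prod.distrib)
  also have "\<dots> = (\<Prod>i\<in>UNIV. z $ i powi expo a k w m i)"
  proof (intro prod.cong refl)
    fix i
    show "z $ i powi (int k * transition_exponent a w w' i) * (\<Prod>j\<in>UNIV. z $ i powi (?A i j * expo a k w' m j))
        = z $ i powi expo a k w m i"
    proof (cases "z $ i = 0")
      case False
      then show ?thesis by (simp add: expo_change[OF w', of a k w m i] power_int_add power_int_sum)
    next
      \<comment> \<open>A single factor carries the whole exponent, and the others are
        \<open>0 powi 0 = 1\<close>.\<close>
      case True
      with z obtain j0 where j0: "w $ i = w' $ j0" by (auto simp: chart_overlap_def)
      note A = frame_change_shared_ray[OF w' j0]
      have "(\<Prod>j\<in>UNIV. z $ i powi (?A i j * expo a k w' m j))
          = (\<Prod>j\<in>UNIV. if j = j0 then z $ i powi expo a k w' m j0 else 1)"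
        by (intro prod.cong) (auto simp: A(1))
      moreover have "expo a k w m i = expo a k w' m j0"
        unfolding expo_change[OF w', of a k w m i] by (simp add: A if_distrib[of "\<lambda>x. x * _"] cong: if_cong)
      ultimately show ?thesis by (simp add: A(2))
    qed
  qed
  finally show ?thesis by (simp add: mon_def)
qed

lemma orbit_subset_chart_overlap: "z \<in> orbit \<Longrightarrow> z \<in> chart_overlap w w'"
  by (simp add: orbit_def chart_overlap_def)

lemma chart_change_in_orbit: "z \<in> orbit \<Longrightarrow> chart_change w w' z \<in> orbit"
  by (simp add: orbit_def chart_change_def)

section \<open>Chart changes in logarithmic coordinates and the covering by charts\<close>

definition log_change :: "int ^ 'n ^ 'n \<Rightarrow> int ^ 'n ^ 'n \<Rightarrow> real ^ 'n \<Rightarrow> real ^ 'n" where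
  "log_change w w' x = (\<chi> j. \<Sum>i\<in>UNIV. x $ i * of_int (frame_change w w' $ i $ j))"

lemma linear_log_change: "linear (log_change w w')"
  by (intro linearI) (auto simp: log_change_def vec_eq_iff algebra_simps sum.distrib sum_distrib_left)

lemma log_change_inverse:
  assumes "invertible w" "invertible w'"
  shows "log_change w' w (log_change w w' x) = x"
proof -
  let ?A = "frame_change w w'" and ?B = "frame_change w' w"
  have "log_change w' w (log_change w w' x) $ l = x $ l" for l
  proof -
    have "log_change w' w (log_change w w' x) $ l = (\<Sum>j\<in>UNIV. \<Sum>i\<in>UNIV. x $ i * of_int (?A $ i $ j * ?B $ j $ l))"
      by (simp add: log_change_def sum_distrib_right mult.assoc)
    also have "\<dots> = (\<Sum>i\<in>UNIV. x $ i * of_int ((?A ** ?B) $ i $ l))"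
      by (subst sum.swap) (simp add: matrix_matrix_mult_def sum_distrib_left)
    also have "\<dots> = (\<Sum>i\<in>UNIV. if i = l then x $ i else 0)"
      unfolding frame_change_inverse[OF assms] by (intro sum.cong) (auto simp: mat_def)
    finally show ?thesis by simp
  qed
  then show ?thesis by (simp add: vec_eq_iff)
qed

lemma norm_power_int_exp:
  assumes "z \<noteq> 0"
  shows "ln ((norm (z powi n))\<^sup>2) = of_int n * ln ((norm (z :: complex))\<^sup>2)"
proof -
  have "norm (z powi n) = norm z powr of_int n"
    using assms by (simp add: norm_power_int powr_real_of_int')
  then show ?thesis using assms by (simp add: ln_realpow ln_powr)
qed

lemma ln_norm_mon:
  assumes "z \<in> orbit"
  shows "ln ((norm (mon e z))\<^sup>2) = (\<Sum>i\<in>UNIV. of_int (e i) * Lg z $ i)"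
proof -
  have "ln ((norm (mon e z))\<^sup>2) = ln (\<Prod>i\<in>UNIV. (norm (z $ i powi e i))\<^sup>2)"
    by (simp add: mon_def prod_norm[symmetric] prod_power_distrib)
  also have "\<dots> = (\<Sum>i\<in>UNIV. ln ((norm (z $ i powi e i))\<^sup>2))"
    using assms by (intro ln_prod) (auto simp: orbit_def)
  finally show ?thesis using assms by (simp add: Lg_def norm_power_int_exp orbit_def)
qed

lemma norm_mon_squared:
  assumes "z \<in> orbit"
  shows "(norm (mon e z))\<^sup>2 = exp (\<Sum>i\<in>UNIV. of_int (e i) * Lg z $ i)"
  using ln_norm_mon[OF assms, of e] mon_nonzero[OF assms, of e] by (metis exp_ln zero_less_norm_iff zero_less_power)

lemma Lg_chart_change:
  assumes "z \<in> orbit"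
  shows "Lg (chart_change w w' z) = log_change w w' (Lg z)"
proof -
  have "Lg (chart_change w w' z) $ j = log_change w w' (Lg z) $ j" for j
  proof -
    have "Lg (chart_change w w' z) $ j = ln ((norm (mon (\<lambda>i. frame_change w w' $ i $ j) z))\<^sup>2)"
      by (simp add: Lg_def chart_change_def mon_def)
    then show ?thesis by (simp add: ln_norm_mon[OF assms] log_change_def mult.commute)
  qed
  then show ?thesis by (simp add: vec_eq_iff)
qed

text \<open>A cone that is not spanned by a full basis lies in a proper subspace and is a null set.
  The finitely many full cones have closed union, so its complement is open and negligible, hence
  empty.\<close>

lemma frames_cover:
  fixes \<Sigma> :: "(real ^ 'n) set set"
  assumes "smooth_fan \<Sigma>" "complete_fan \<Sigma>"
  shows "\<exists>W. finite W \<and> W \<subseteq> frames \<Sigma> \<and> (\<forall>y. \<exists>w\<in>W. y \<in> convex_cone hull (range (\<lambda>i. real_vec (w $ i))))"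
proof -
  let ?cone = "\<lambda>w :: int ^ 'n ^ 'n. convex_cone hull (range (\<lambda>i. real_vec (w $ i)))"
  define F where "F = ?cone ` frames \<Sigma>"
  have fin: "finite \<Sigma>" and un: "\<Union>\<Sigma> = UNIV" using assms(2) by (auto simp: complete_fan_def fan_def)
  have F: "F \<subseteq> \<Sigma>" by (auto simp: F_def frames_def)
  then have finF: "finite F" using fin finite_subset by blast
  have small: "negligible \<sigma>" if "\<sigma> \<in> \<Sigma> - F" for \<sigma>
  proof -
    have ex: "\<forall>\<sigma>\<in>\<Sigma>. \<exists>(w :: int ^ 'n ^ 'n) I. invertible w \<and> \<sigma> = convex_cone hull ((\<lambda>i. real_vec (w $ i)) ` I)"
      using assms(1) by (simp add: smooth_fan_def)
    have "\<sigma> \<in> \<Sigma>" using that by simp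
    from bspec[OF ex this]
    obtain w :: "int ^ 'n ^ 'n" and I where w: "invertible w" "\<sigma> = convex_cone hull ((\<lambda>i. real_vec (w $ i)) ` I)"
      by (elim exE conjE) (rule that)
    have "I \<noteq> UNIV"
    proof
      assume "I = UNIV"
      then have "w \<in> frames \<Sigma>" using w that by (simp add: frames_def)
      then have "\<sigma> \<in> F" using w \<open>I = UNIV\<close> by (auto simp: F_def)
      then show False using that by simp
    qed
    let ?V = "(\<lambda>i. real_vec (w $ i)) ` I"
    have "\<sigma> \<subseteq> span ?V"
      unfolding w(2) by (rule hull_minimal) (auto simp: span_superset convex_cone_iff span_0 span_add span_scale)
    moreover have "dim (span ?V) < DIM(real ^ 'n)"
    proof -
      have "dim (span ?V) \<le> card ?V" by (simp add: dim_le_card')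
      also have "\<dots> \<le> card I" by (intro card_image_le) simp
      also have "\<dots> < CARD('n)" using \<open>I \<noteq> UNIV\<close> by (intro psubset_card_mono) auto
      finally show ?thesis by simp
    qed
    ultimately show ?thesis using negligible_lowdim negligible_subset by blast
  qed
  have "closed (\<Union>F)"
    using finF by (intro closed_Union) (auto simp: F_def intro!: closed_convex_cone_hull)
  then have "open (- \<Union>F)" by (rule open_Compl)
  moreover have "- \<Union>F \<subseteq> \<Union>(\<Sigma> - F)" using un by blast
  moreover have "negligible (\<Union>(\<Sigma> - F))" using fin small by (intro negligible_Union) auto
  ultimately have "- \<Union>F = {}" using open_not_negligible negligible_subset by blast
  then have F_un: "\<Union>F = UNIV" by blast
  have "\<forall>\<sigma>\<in>F. \<exists>w. w \<in> frames \<Sigma> \<and> \<sigma> = ?cone w" by (auto simp: F_def)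
  then obtain g where g: "\<And>\<sigma>. \<sigma> \<in> F \<Longrightarrow> g \<sigma> \<in> frames \<Sigma>" "\<And>\<sigma>. \<sigma> \<in> F \<Longrightarrow> \<sigma> = ?cone (g \<sigma>)" by metis
  have "\<exists>w\<in>g ` F. y \<in> ?cone w" for y
  proof -
    have "y \<in> \<Union>F" using F_un by simp
    then obtain \<sigma> where "\<sigma> \<in> F" "y \<in> \<sigma>" by blast
    with g(2)[of \<sigma>] show ?thesis by (intro bexI[of _ "g \<sigma>"]) auto
  qed
  moreover have "finite (g ` F)" "g ` F \<subseteq> frames \<Sigma>" using finF g(1) by auto
  ultimately show ?thesis by blast
qed

lemma convex_cone_hull_range_nonneg_combination:
  fixes f :: "'n::finite \<Rightarrow> 'a::real_vector"
  assumes "y \<in> convex_cone hull (range f)"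
  shows "\<exists>c. (\<forall>i. 0 \<le> c i) \<and> y = (\<Sum>i\<in>UNIV. c i *\<^sub>R f i)"
proof -
  let ?S = "{y. \<exists>c. (\<forall>i. 0 \<le> c i) \<and> y = (\<Sum>i\<in>UNIV. c i *\<^sub>R f i)}"
  have "convex_cone ?S"
    unfolding convex_cone_iff
  proof (intro conjI ballI allI impI)
    show "0 \<in> ?S" by (auto intro!: exI[of _ "\<lambda>_. 0"])
    fix x y assume "x \<in> ?S" "y \<in> ?S"
    then obtain c d where "\<forall>i. 0 \<le> c i" "x = (\<Sum>i\<in>UNIV. c i *\<^sub>R f i)"
      "\<forall>i. 0 \<le> d i" "y = (\<Sum>i\<in>UNIV. d i *\<^sub>R f i)" by auto
    then show "x + y \<in> ?S"
      by (intro CollectI exI[of _ "\<lambda>i. c i + d i"]) (auto simp: scaleR_add_left sum.distrib)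
  next
    fix x and b :: real assume "x \<in> ?S" "0 \<le> b"
    then obtain c where "\<forall>i. 0 \<le> c i" "x = (\<Sum>i\<in>UNIV. c i *\<^sub>R f i)" by auto
    with \<open>0 \<le> b\<close> show "b *\<^sub>R x \<in> ?S"
      by (intro CollectI exI[of _ "\<lambda>i. b * c i"]) (auto simp: scaleR_sum_right)
  qed
  moreover have "range f \<subseteq> ?S"
  proof
    fix x assume "x \<in> range f"
    then obtain j where x: "x = f j" by auto
    have "(\<Sum>i\<in>UNIV. (if i = j then 1 else 0) *\<^sub>R f i) = (\<Sum>i\<in>UNIV. if i = j then f i else 0)"
      by (intro sum.cong) auto
    then show "x \<in> ?S" by (intro CollectI exI[of _ "\<lambda>i. if i = j then 1 else 0"]) (simp add: x)
  qed
  ultimately have "convex_cone hull (range f) \<subseteq> ?S" by (rule hull_minimal[rotated])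
  with assms show ?thesis by blast
qed

text \<open>The condition \<open>x $ i \<le> 0\<close> for all \<open>i\<close> describes the closed
  unit polydisc of the chart \<open>w\<close>. This is the form in which completeness of the fan is
  used below: finitely many such polydiscs cover the orbit.\<close>

lemma log_coordinates_cover:
  fixes \<Sigma> :: "(real ^ 'n) set set"
  assumes "smooth_fan \<Sigma>" "complete_fan \<Sigma>" and v: "v \<in> frames \<Sigma>"
  shows "\<exists>W. finite W \<and> W \<subseteq> frames \<Sigma> \<and> (\<forall>y. \<exists>w\<in>W. \<exists>x. (\<forall>i. x $ i \<le> 0) \<and> y = log_change w v x)"
proof -
  obtain W where W: "finite W" "W \<subseteq> frames \<Sigma>"
    "\<And>y. \<exists>w\<in>W. y \<in> convex_cone hull (range (\<lambda>i. real_vec (w $ i)))"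
    using frames_cover[OF assms(1,2)] by blast
  have "\<exists>w\<in>W. \<exists>x. (\<forall>i. x $ i \<le> 0) \<and> y = log_change w v x" for y
  proof -
    let ?V = "matrix_inv v"
    \<comment> \<open>The sign is reversed because cones consist of nonnegative combinations while
      points of the polydisc have nonpositive logarithms.\<close>
    obtain w where w: "w \<in> W"
      "- (\<Sum>j\<in>UNIV. y $ j *\<^sub>R real_vec (v $ j)) \<in> convex_cone hull (range (\<lambda>i. real_vec (w $ i)))"
      using W(3) by blast
    from convex_cone_hull_range_nonneg_combination[OF w(2)]
    obtain c where c: "\<forall>i. 0 \<le> c i"
      "- (\<Sum>j\<in>UNIV. y $ j *\<^sub>R real_vec (v $ j)) = (\<Sum>i\<in>UNIV. c i *\<^sub>R real_vec (w $ i))" by blast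
    define x where "x = (\<chi> i. - c i)"
    have comp: "(\<Sum>j\<in>UNIV. y $ j * of_int (v $ j $ l)) = (\<Sum>i\<in>UNIV. x $ i * of_int (w $ i $ l))" for l
    proof -
      have "(- (\<Sum>j\<in>UNIV. y $ j *\<^sub>R real_vec (v $ j))) $ l = (\<Sum>i\<in>UNIV. c i *\<^sub>R real_vec (w $ i)) $ l"
        using c(2) by simp
      then show ?thesis by (simp add: real_vec_def x_def sum_negf)
    qed
    have mult: "(\<Sum>l\<in>UNIV. (\<Sum>i\<in>UNIV. u $ i * of_int (b $ i $ l)) * of_int (?V $ l $ j))
        = (\<Sum>i\<in>UNIV. u $ i * of_int ((b ** ?V) $ i $ j))" for b u j
    proof -
      have "(\<Sum>l\<in>UNIV. (\<Sum>i\<in>UNIV. u $ i * of_int (b $ i $ l)) * of_int (?V $ l $ j))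
          = (\<Sum>l\<in>UNIV. \<Sum>i\<in>UNIV. u $ i * of_int (b $ i $ l * ?V $ l $ j))"
        by (simp add: sum_distrib_right mult.assoc)
      then show ?thesis by (subst (asm) sum.swap) (simp add: matrix_matrix_mult_def sum_distrib_left)
    qed
    have "y $ j = log_change w v x $ j" for j
    proof -
      have "(\<Sum>i\<in>UNIV. y $ i * of_int ((v ** ?V) $ i $ j)) = (\<Sum>i\<in>UNIV. x $ i * of_int ((w ** ?V) $ i $ j))"
        unfolding mult[symmetric] comp ..
      moreover have "(\<Sum>i\<in>UNIV. y $ i * of_int ((v ** ?V) $ i $ j)) = (\<Sum>i\<in>UNIV. if i = j then y $ i else 0)"
        unfolding matrix_inv_frame[OF frames_invertible[OF v]] by (intro sum.cong) (auto simp: mat_def)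
      ultimately show ?thesis by (simp add: log_change_def frame_change_def)
    qed
    then have "y = log_change w v x" by (simp add: vec_eq_iff)
    moreover have "\<forall>i. x $ i \<le> 0" using c(1) by (simp add: x_def)
    ultimately show ?thesis using w(1) by blast
  qed
  with W show ?thesis by blast
qed

section \<open>The potential: convexity, growth and slopes\<close>

definition log_transition :: "(int ^ 'n \<Rightarrow> int) \<Rightarrow> int ^ 'n ^ 'n \<Rightarrow> int ^ 'n ^ 'n \<Rightarrow> real ^ 'n \<Rightarrow> real" where
  "log_transition a w v x = (\<Sum>i\<in>UNIV. of_int (transition_exponent a w v i) * x $ i)"

lemma abs_log_transition_le: "\<bar>log_transition a w v x\<bar> \<le> (\<Sum>i\<in>UNIV. \<bar>of_int (transition_exponent a w v i)\<bar>) * norm x"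
proof -
  have "\<bar>log_transition a w v x\<bar> \<le> (\<Sum>i\<in>UNIV. \<bar>of_int (transition_exponent a w v i) * x $ i\<bar>)"
    unfolding log_transition_def by (rule sum_abs)
  also have "\<dots> \<le> (\<Sum>i\<in>UNIV. \<bar>of_int (transition_exponent a w v i)\<bar> * norm x)"
    by (intro sum_mono) (auto simp: abs_mult intro!: mult_left_mono component_le_norm_cart)
  finally show ?thesis by (simp add: sum_distrib_right)
qed

lemma psh_metric_frames:
  assumes "toric_hermitian_big \<Sigma> a \<phi>" "w \<in> frames \<Sigma>"
  shows "psh (\<phi> w)" "rotation_invariant (\<phi> w)"
  using assms
  by (auto simp: toric_hermitian_big_def psh_metric_def compact_torus_invariant_def rotation_invariant_def)

text \<open>The normalized divisor has coefficient 0 at the rays of \<open>v\<close>, so the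
  invariant section is the constant 1 in the trivialization of this chart.\<close>

lemma orbit_weight_eq:
  assumes "invertible v"
  shows "orbit_weight a \<phi> v z = \<phi> v z"
proof -
  have "normalized_divisor a v (v $ i) = 0" for i
  proof -
    have "((v $ i) v* matrix_inv v) $ j = (if i = j then 1 else 0)" for j
    proof -
      have "((v $ i) v* matrix_inv v) $ j = (v ** matrix_inv v) $ i $ j"
        by (simp add: vector_matrix_mult_def matrix_matrix_mult_def mult.commute)
      then show ?thesis using assms by (simp add: matrix_inv_frame mat_def)
    qed
    then show ?thesis
      by (simp add: normalized_divisor_def if_distrib[of "\<lambda>x. x * _"] cong: if_cong)
  qed
  then show ?thesis by (simp add: orbit_weight_def canonical_section_def)
qed

lemma potential_eq:
  assumes "toric_hermitian_big \<Sigma> a \<phi>" and v: "v \<in> frames \<Sigma>"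
  shows "\<phi> v (expv x) = ereal (potential a \<phi> v x)"
proof -
  have "\<bar>\<phi> v (expv x)\<bar> \<noteq> \<infinity>"
    using psh_finite_on_orbit[OF psh_metric_frames[OF assms]] .
  then show ?thesis
    by (simp add: potential_def orbit_weight_eq[OF frames_invertible[OF v]] expv_def[symmetric] ereal_real)
qed

lemma convex_potential:
  assumes "toric_hermitian_big \<Sigma> a \<phi>" and v: "v \<in> frames \<Sigma>"
  shows "convex_on UNIV (potential a \<phi> v)"
proof (rule convex_onI)
  fix t :: real and x y :: "real ^ 'a" assume "0 < t" "t < 1"
  then have "\<phi> v (expv ((1 - t) *\<^sub>R x + t *\<^sub>R y)) \<le> ereal ((1 - t) * potential a \<phi> v x + t * potential a \<phi> v y)"
    by (intro psh_log_convex psh_metric_frames[OF assms]) (auto simp: potential_eq[OF assms])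
  then show "potential a \<phi> v ((1 - t) *\<^sub>R x + t *\<^sub>R y) \<le> (1 - t) * potential a \<phi> v x + t * potential a \<phi> v y"
    by (simp add: potential_eq[OF assms])
qed simp

lemma weight_in_frame:
  assumes big: "toric_hermitian_big \<Sigma> a \<phi>" and v: "v \<in> frames \<Sigma>" and w: "w \<in> frames \<Sigma>" and z: "z \<in> orbit"
  shows "\<phi> w z = ereal (potential a \<phi> v (log_change w v (Lg z)) + log_transition a w v (Lg z))"
proof -
  have "\<phi> w z = \<phi> v (chart_change w v z) + ereal (ln ((norm (transition a w v z))\<^sup>2))"
    using big v w orbit_subset_chart_overlap[OF z]
    unfolding toric_hermitian_big_def psh_metric_def by blast
  also have "\<phi> v (chart_change w v z) = \<phi> v (expv (log_change w v (Lg z)))"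
    using rotation_invariant_eq_expv[OF psh_metric_frames(2)[OF big v] chart_change_in_orbit[OF z]]
    by (simp add: Lg_chart_change[OF z])
  finally show ?thesis
    by (simp add: potential_eq[OF big v] transition_eq_mon ln_norm_mon[OF z] log_transition_def)
qed

definition unit_polydisc :: "(complex ^ 'n) set" where
  "unit_polydisc = {z. \<forall>i. norm (z $ i) \<le> 1}"

lemma compact_unit_polydisc: "compact (unit_polydisc :: (complex ^ 'n) set)"
proof (rule compact_eq_bounded_closed[THEN iffD2], intro conjI)
  have "norm z \<le> real CARD('n)" if "z \<in> unit_polydisc" for z :: "complex ^ 'n"
  proof -
    have "norm z \<le> (\<Sum>i\<in>UNIV. norm (z $ i))" unfolding norm_vec_def by (rule L2_set_le_sum) simp
    also have "\<dots> \<le> (\<Sum>i\<in>(UNIV::'n set). 1)" using that by (intro sum_mono) (simp add: unit_polydisc_def)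
    finally show ?thesis by simp
  qed
  then show "bounded (unit_polydisc :: (complex ^ 'n) set)" by (auto simp: bounded_iff)
  have eq: "unit_polydisc = (\<Inter>i. {z :: complex ^ 'n. norm (z $ i) \<le> 1})" by (auto simp: unit_polydisc_def)
  show "closed (unit_polydisc :: (complex ^ 'n) set)"
    unfolding eq by (intro closed_INT ballI closed_Collect_le continuous_intros)
qed

lemma expv_in_unit_polydisc: "(\<And>i. x $ i \<le> 0) \<Longrightarrow> expv x \<in> unit_polydisc"
  by (simp add: unit_polydisc_def expv_def)

text \<open>The weight of the chart \<open>w\<close> is upper semicontinuous, hence bounded above on
  the compact unit polydisc, points of the boundary divisors included.\<close>

lemma potential_upper_in_frame:
  assumes big: "toric_hermitian_big \<Sigma> a \<phi>" and v: "v \<in> frames \<Sigma>" and w: "w \<in> frames \<Sigma>"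
  shows "\<exists>C. \<forall>x. (\<forall>i. x $ i \<le> 0) \<longrightarrow> potential a \<phi> v (log_change w v x) \<le> C - log_transition a w v x"
proof -
  have psh: "psh (\<phi> w)" by (rule psh_metric_frames[OF big w])
  have "(0 :: complex ^ 'a) \<in> unit_polydisc" by (simp add: unit_polydisc_def)
  then have "unit_polydisc \<noteq> ({} :: (complex ^ 'a) set)" by blast
  with compact_unit_polydisc obtain y where y: "\<And>z. z \<in> unit_polydisc \<Longrightarrow> \<phi> w z \<le> \<phi> w y"
    using upper_semicontinuous_attains_sup[of unit_polydisc "\<phi> w"] psh unfolding psh_def by metis
  have "\<phi> w y < \<infinity>" using psh by (simp add: psh_def)
  then obtain C where C: "\<phi> w y \<le> ereal C" by (cases "\<phi> w y") auto
  have "potential a \<phi> v (log_change w v x) \<le> C - log_transition a w v x" if "\<forall>i. x $ i \<le> 0" for x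
  proof -
    have "\<phi> w (expv x) \<le> ereal C" using y[OF expv_in_unit_polydisc] C that order_trans by blast
    then show ?thesis using weight_in_frame[OF big v w, of "expv x"] by simp
  qed
  then show ?thesis by blast
qed

lemma log_change_bounded: "\<exists>B>0. \<forall>x. norm (log_change w w' x) \<le> B * norm x"
  using linear_bounded_pos[OF linear_log_change[of w w']] by metis

text \<open>Every orbit point lies in the polydisc of one of finitely many charts, where the weight
  is bounded above; the transition term grows linearly, and norms in different charts are
  comparable.\<close>

lemma potential_linear_growth:
  assumes fan: "smooth_fan \<Sigma>" "complete_fan \<Sigma>"
    and big: "toric_hermitian_big \<Sigma> a \<phi>" and v: "v \<in> frames \<Sigma>"
  shows "\<exists>C. \<exists>L\<ge>0. \<forall>x. potential a \<phi> v x \<le> C + L * norm x"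
proof -
  obtain W where W: "finite W" "W \<subseteq> frames \<Sigma>" "\<And>y. \<exists>w\<in>W. \<exists>x. (\<forall>i. x $ i \<le> 0) \<and> y = log_change w v x"
    using log_coordinates_cover[OF fan v] by blast
  have "\<forall>w\<in>W. \<exists>C L. L \<ge> 0 \<and> (\<forall>x. (\<forall>i. x $ i \<le> 0) \<longrightarrow> potential a \<phi> v (log_change w v x) \<le> C + L * norm (log_change w v x))"
  proof
    fix w assume "w \<in> W"
    then have w: "w \<in> frames \<Sigma>" using W by blast
    obtain C where C: "\<And>x. (\<forall>i. x $ i \<le> 0) \<Longrightarrow> potential a \<phi> v (log_change w v x) \<le> C - log_transition a w v x"
      using potential_upper_in_frame[OF big v w] by blast
    obtain B where B: "B > 0" "\<And>x. norm (log_change v w x) \<le> B * norm x" using log_change_bounded[of v w] by blast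
    define T where "T = (\<Sum>i\<in>UNIV. \<bar>real_of_int (transition_exponent a w v i)\<bar>)"
    have T: "T \<ge> 0" by (simp add: T_def sum_nonneg)
    have "potential a \<phi> v (log_change w v x) \<le> C + (T * B) * norm (log_change w v x)" if "\<forall>i. x $ i \<le> 0" for x
    proof -
      have "norm x \<le> B * norm (log_change w v x)"
        using B(2)[of "log_change w v x"] log_change_inverse[OF frames_invertible[OF w] frames_invertible[OF v], of x] by simp
      then have "T * norm x \<le> T * (B * norm (log_change w v x))" using T by (rule mult_left_mono)
      moreover have "- log_transition a w v x \<le> T * norm x" using abs_log_transition_le[of a w v x] by (simp add: T_def)
      ultimately show ?thesis using C[OF that] by simp
    qed
    then show "\<exists>C L. L \<ge> 0 \<and> (\<forall>x. (\<forall>i. x $ i \<le> 0) \<longrightarrow> potential a \<phi> v (log_change w v x) \<le> C + L * norm (log_change w v x))"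
      using T B(1) by (intro exI[of _ C] exI[of _ "T * B"]) auto
  qed
  then obtain C L where CL: "\<And>w. w \<in> W \<Longrightarrow> L w \<ge> 0"
    "\<And>w x. w \<in> W \<Longrightarrow> (\<forall>i. x $ i \<le> 0) \<Longrightarrow> potential a \<phi> v (log_change w v x) \<le> C w + L w * norm (log_change w v x)"
    by metis
  have "potential a \<phi> v y \<le> (\<Sum>w\<in>W. \<bar>C w\<bar>) + (\<Sum>w\<in>W. L w) * norm y" for y
  proof -
    obtain w x where wx: "w \<in> W" "\<forall>i. x $ i \<le> 0" "y = log_change w v x" using W(3) by blast
    have "C w \<le> (\<Sum>w\<in>W. \<bar>C w\<bar>)" using member_le_sum[OF wx(1), of "\<lambda>w. \<bar>C w\<bar>"] W(1) by simp
    moreover have "L w \<le> (\<Sum>w\<in>W. L w)" using member_le_sum[OF wx(1), of L] W(1) CL(1) by simp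
    then have "L w * norm y \<le> (\<Sum>w\<in>W. L w) * norm y" by (rule mult_right_mono) simp
    ultimately show ?thesis using CL(2)[OF wx(1,2)] unfolding wx(3) by linarith
  qed
  moreover have "(\<Sum>w\<in>W. L w) \<ge> 0" using CL(1) by (simp add: sum_nonneg)
  ultimately show ?thesis by blast
qed

text \<open>Used to compare weighted integrands at nearby points and under
  \<open>shrink\<close>.\<close>

lemma potential_lipschitz:
  assumes "smooth_fan \<Sigma>" "complete_fan \<Sigma>" and big: "toric_hermitian_big \<Sigma> a \<phi>" and v: "v \<in> frames \<Sigma>"
  shows "\<exists>L\<ge>0. \<forall>x y. potential a \<phi> v y - potential a \<phi> v x \<le> L * norm (y - x)"
  using potential_linear_growth[OF assms] convex_linear_growth_imp_lipschitz[OF convex_potential[OF big v]] by metis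

text \<open>Along the ray through \<open>p\<close> the minorant has slope \<open>norm p\<close>,
  which cannot exceed the growth rate \<open>L\<close>.\<close>

lemma bounded_minorant_slopes:
  fixes f :: "'a::real_inner \<Rightarrow> real"
  assumes f: "\<And>x. f x \<le> C + L * norm x" and L: "L \<ge> 0"
  shows "bounded (minorant_slopes f)"
proof -
  have "norm p \<le> L" if p: "p \<in> minorant_slopes f" for p
  proof (rule ccontr)
    assume "\<not> norm p \<le> L"
    then have gt: "norm p - L > 0" by simp
    obtain D where D: "\<And>x. f x \<ge> p \<bullet> x - D" using p by (auto simp: minorant_slopes_def)
    have "s * (norm p * (norm p - L)) \<le> C + D" if "s \<ge> 0" for s
    proof -
      have "s * (norm p)\<^sup>2 - D \<le> f (s *\<^sub>R p)" using D[of "s *\<^sub>R p"] by (simp add: power2_norm_eq_inner)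
      also have "\<dots> \<le> C + L * (s * norm p)" using f[of "s *\<^sub>R p"] that by simp
      finally show ?thesis by (simp add: power2_eq_square algebra_simps)
    qed
    moreover have pos: "norm p * (norm p - L) > 0" using gt L by (intro mult_pos_pos) linarith+
    define s where "s = (\<bar>C + D\<bar> + 1) / (norm p * (norm p - L))"
    have "s \<ge> 0" using pos by (auto simp: s_def intro!: divide_nonneg_pos)
    moreover have "s * (norm p * (norm p - L)) = \<bar>C + D\<bar> + 1"
      using pos unfolding s_def times_divide_eq_left by (metis nonzero_mult_div_cancel_right less_irrefl)
    ultimately have "\<bar>C + D\<bar> + 1 \<le> C + D" by metis
    then show False by simp
  qed
  then show ?thesis by (auto simp: bounded_iff)
qed

text \<open>
  For \<open>p = \<alpha>/k\<close> these are the inequalities saying that the character of \<open>\<alpha>\<close> is a regular section of \<open>L\<^sup>k\<close>.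
\<close>

lemma minorant_slopes_polytope:
  assumes big: "toric_hermitian_big \<Sigma> a \<phi>" and v: "v \<in> frames \<Sigma>" and w: "w \<in> frames \<Sigma>"
    and p: "p \<in> minorant_slopes (potential a \<phi> v)"
  shows "0 \<le> of_int (transition_exponent a w v i) + (\<Sum>j\<in>UNIV. of_int (frame_change w v $ i $ j) * p $ j)"
proof -
  let ?b = "of_int (transition_exponent a w v i) + (\<Sum>j\<in>UNIV. of_int (frame_change w v $ i $ j) * p $ j)"
  obtain C where C: "\<And>x. (\<forall>i. x $ i \<le> 0) \<Longrightarrow> potential a \<phi> v (log_change w v x) \<le> C - log_transition a w v x"
    using potential_upper_in_frame[OF big v w] by blast
  obtain D where D: "\<And>x. potential a \<phi> v x \<ge> p \<bullet> x - D" using p by (auto simp: minorant_slopes_def)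
  have bound: "s * (- ?b) \<le> C + D" if s: "s \<ge> 0" for s
  proof -
    \<comment> \<open>As \<open>s\<close> grows, the point approaches the divisor of the ray
      \<open>w $ i\<close>; comparing the two bounds on the potential there controls the order of
      vanishing along this divisor.\<close>
    define x :: "real ^ 'a" where "x = (\<chi> l. if l = i then - s else 0)"
    have 1: "log_change w v x $ j = - s * of_int (frame_change w v $ i $ j)" for j
      by (simp add: log_change_def x_def if_distrib[of "\<lambda>x. x * _"] cong: if_cong)
    have 2: "log_transition a w v x = - s * of_int (transition_exponent a w v i)"
      by (simp add: log_transition_def x_def if_distrib[of "\<lambda>x. _ * x"] cong: if_cong)
    have "p \<bullet> log_change w v x = - s * (\<Sum>j\<in>UNIV. of_int (frame_change w v $ i $ j) * p $ j)"
      by (simp add: inner_vec_def 1 sum_distrib_left mult_ac sum_negf)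
    moreover have "p \<bullet> log_change w v x - D \<le> C - log_transition a w v x"
      using D[of "log_change w v x"] C[of x] s by (force simp: x_def)
    ultimately show ?thesis unfolding 2 by (simp add: algebra_simps)
  qed
  show ?thesis
  proof (rule ccontr)
    assume "\<not> 0 \<le> ?b"
    then have pos: "- ?b > 0" by simp
    have "(\<bar>C + D\<bar> + 1) / (- ?b) * (- ?b) \<le> C + D" using pos by (intro bound divide_nonneg_pos) auto
    moreover have "(\<bar>C + D\<bar> + 1) / (- ?b) * (- ?b) = \<bar>C + D\<bar> + 1" using pos by (intro nonzero_divide_eq_eq[THEN iffD1, symmetric]) auto
    ultimately show False by linarith
  qed
qed

section \<open>Expansion of sections into characters\<close>

text \<open>The value 0 off the frames is the normalization demanded by
  \<open>sections\<close>.\<close>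

definition char_section :: "(real ^ 'n) set set \<Rightarrow> (int ^ 'n \<Rightarrow> int) \<Rightarrow> nat \<Rightarrow> int ^ 'n \<Rightarrow> int ^ 'n ^ 'n \<Rightarrow> complex ^ 'n \<Rightarrow> complex" where
  "char_section \<Sigma> a k m w = (if w \<in> frames \<Sigma> then mon (expo a k w m) else 0)"

lemma holomorphic_fun_mon: "(\<And>i. e i \<ge> 0) \<Longrightarrow> holomorphic_fun (mon e)"
  by (simp add: mon_eq_npow holomorphic_fun_npow)

lemma char_section_in_sections:
  assumes "\<And>w i. w \<in> frames \<Sigma> \<Longrightarrow> expo a k w m i \<ge> 0"
  shows "char_section \<Sigma> a k m \<in> sections \<Sigma> a k"
  using assms
  by (auto simp: sections_def char_section_def intro!: holomorphic_fun_mon mon_transition frames_invertible)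

lemma section_transition:
  assumes "s \<in> sections \<Sigma> a k" "w \<in> frames \<Sigma>" "w' \<in> frames \<Sigma>" "z \<in> chart_overlap w w'"
  shows "s w z = transition a w w' z ^ k * s w' (chart_change w w' z)"
  using assms unfolding sections_def by blast

lemma holomorphic_along_coordinate:
  assumes "holomorphic_fun f"
  shows "(\<lambda>\<xi>. f (put z i \<xi>)) holomorphic_on UNIV"
proof -
  have "\<exists>f'. ((\<lambda>\<xi>. f (put z i \<xi>)) has_field_derivative f') (at \<xi>)" for \<xi>
  proof -
    obtain D where D: "(f has_derivative D) (at (put z i \<xi>))" "\<forall>c h. D (c *s h) = c * D h"
      using spec[OF assms[unfolded holomorphic_fun_def], of "put z i \<xi>"] by (elim exE conjE)
    define p0 where "p0 = put z i 0"
    have put_eq: "put z i = (\<lambda>\<xi>. p0 + \<xi> *s axis i 1)"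
      by (auto simp: fun_eq_iff vec_eq_iff put_nth axis_def p0_def)
    have "bounded_linear (\<lambda>\<xi>::complex. \<xi> *s (axis i 1 :: complex ^ 'a))"
      by (intro linear_conv_bounded_linear[THEN iffD1] linearI)
        (auto simp: vec_eq_iff algebra_simps)
    then have "((\<lambda>\<xi>. p0 + \<xi> *s axis i 1) has_derivative (\<lambda>h. 0 + h *s axis i 1)) (at \<xi>)"
      by (intro has_derivative_add has_derivative_const bounded_linear_imp_has_derivative)
    then have "(put z i has_derivative (\<lambda>h. h *s axis i 1)) (at \<xi>)"
      unfolding put_eq[symmetric] by simp
    from has_derivative_compose[OF this D(1)]
    have "((\<lambda>\<xi>. f (put z i \<xi>)) has_derivative (\<lambda>h. D (axis i 1) * h)) (at \<xi>)"
      by (simp add: D(2) mult.commute)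
    then show ?thesis unfolding has_field_derivative_def by blast
  qed
  then show ?thesis unfolding holomorphic_on_def field_differentiable_def by simp
qed

lemma norm_Lg_put:
  assumes "norm \<xi> \<ge> 1"
  shows "norm (Lg (put z i \<xi>)) \<le> (\<Sum>j\<in>UNIV. \<bar>Lg z $ j\<bar>) + 2 * ln (norm \<xi>)"
proof -
  have ln: "ln (norm \<xi>) \<ge> 0" using assms by simp
  have "norm (Lg (put z i \<xi>)) \<le> (\<Sum>j\<in>UNIV. \<bar>Lg (put z i \<xi>) $ j\<bar>)" by (rule norm_le_l1_cart)
  also have "\<dots> \<le> (\<Sum>j\<in>UNIV. \<bar>Lg z $ j\<bar> + (if j = i then 2 * ln (norm \<xi>) else 0))"
  proof (rule sum_mono)
    fix j
    have "\<xi> \<noteq> 0" using assms by auto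
    then have "ln ((norm \<xi>)\<^sup>2) = 2 * ln (norm \<xi>)" by (simp add: ln_realpow)
    then show "\<bar>Lg (put z i \<xi>) $ j\<bar> \<le> \<bar>Lg z $ j\<bar> + (if j = i then 2 * ln (norm \<xi>) else 0)"
      using ln by (simp add: Lg_def put_nth)
  qed
  finally show ?thesis by (simp add: sum.distrib)
qed

lemma norm_transition:
  assumes "z \<in> orbit"
  shows "norm (transition a w w' z) = exp (log_transition a w w' (Lg z) / 2)"
proof -
  have "(norm (transition a w w' z))\<^sup>2 = (exp (log_transition a w w' (Lg z) / 2))\<^sup>2"
    using norm_mon_squared[OF assms, of "transition_exponent a w w'"]
    by (simp add: transition_eq_mon log_transition_def power2_eq_square flip: exp_add)
  then show ?thesis by (simp add: power2_eq_iff_nonneg)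
qed

lemma in_unit_polydisc_if_Lg_nonpos:
  assumes "z \<in> orbit" "\<And>i. Lg z $ i \<le> 0"
  shows "z \<in> unit_polydisc"
proof -
  have "norm (z $ i) \<le> 1" for i
  proof -
    have "(norm (z $ i))\<^sup>2 \<le> 1"
      using assms(2)[of i] assms(1) by (simp add: Lg_def orbit_def)
    then show ?thesis by (simp add: power2_le_imp_le[of _ 1])
  qed
  then show ?thesis by (simp add: unit_polydisc_def)
qed

lemma section_bounded_on_unit_polydisc:
  assumes "s \<in> sections \<Sigma> a k" "w \<in> frames \<Sigma>"
  shows "\<exists>B\<ge>0. \<forall>z\<in>unit_polydisc. norm (s w z) \<le> B"
proof -
  have "continuous_on UNIV (s w)"
    using assms by (auto simp: sections_def intro: holomorphic_fun_imp_continuous)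
  then have "compact (s w ` unit_polydisc)"
    by (intro compact_continuous_image compact_unit_polydisc) (auto intro: continuous_on_subset)
  then obtain B where "\<forall>y\<in>s w ` unit_polydisc. norm y \<le> B" using compact_imp_bounded bounded_iff by metis
  then show ?thesis by (intro exI[of _ "max 0 B"]) (auto simp: le_max_iff_disj)
qed

text \<open>Every orbit point lies in the unit polydisc of one of finitely many charts, on which the
  local expression is bounded. Returning to \<open>v\<close> multiplies by a power of the transition
  function, at most exponential in \<open>norm (Lg z)\<close>. \<open>T\<close> is a natural number
  because \<open>2 * T\<close> becomes a degree bound.\<close>

lemma section_growth:
  assumes fan: "smooth_fan \<Sigma>" "complete_fan \<Sigma>" and v: "v \<in> frames \<Sigma>" and s: "s \<in> sections \<Sigma> a k"
  shows "\<exists>B\<ge>0. \<exists>T. \<forall>z\<in>orbit. norm (s v z) \<le> B * exp (real T * norm (Lg z))"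
proof -
  obtain W where W: "finite W" "W \<subseteq> frames \<Sigma>" "\<And>y. \<exists>w\<in>W. \<exists>x. (\<forall>i. x $ i \<le> 0) \<and> y = log_change w v x"
    using log_coordinates_cover[OF fan v] by blast
  have "\<forall>w\<in>W. \<exists>B\<ge>0. \<forall>z\<in>unit_polydisc. norm (s w z) \<le> B"
    using section_bounded_on_unit_polydisc[OF s] W(2) by blast
  then obtain B where B: "\<And>w. w \<in> W \<Longrightarrow> B w \<ge> 0" "\<And>w z. w \<in> W \<Longrightarrow> z \<in> unit_polydisc \<Longrightarrow> norm (s w z) \<le> B w"
    by metis
  define \<tau> where "\<tau> w = (\<Sum>i\<in>UNIV. \<bar>real_of_int (transition_exponent a v w i)\<bar>)" for w
  have \<tau>: "\<tau> w \<ge> 0" for w by (simp add: \<tau>_def sum_nonneg)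
  define T where "T = nat \<lceil>real k * (\<Sum>w\<in>W. \<tau> w)\<rceil>"
  have "norm (s v z) \<le> (\<Sum>w\<in>W. B w) * exp (real T * norm (Lg z))" if z: "z \<in> orbit" for z
  proof -
    obtain w x where wx: "w \<in> W" "\<forall>i. x $ i \<le> 0" "Lg z = log_change w v x" using W(3) by blast
    have w: "w \<in> frames \<Sigma>" using wx W by blast
    let ?z = "chart_change v w z"
    have "Lg ?z = x"
      by (simp add: Lg_chart_change[OF z] wx(3) log_change_inverse[OF frames_invertible[OF w] frames_invertible[OF v]])
    then have "?z \<in> unit_polydisc"
      using wx(2) by (intro in_unit_polydisc_if_Lg_nonpos chart_change_in_orbit z) auto
    then have 1: "norm (s w ?z) \<le> B w" by (rule B(2)[OF wx(1)])
    have "s v z = transition a v w z ^ k * s w ?z"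
      by (rule section_transition[OF s v w orbit_subset_chart_overlap[OF z]])
    then have "norm (s v z) = norm (s w ?z) * exp (log_transition a v w (Lg z) / 2) ^ k"
      by (simp add: norm_mult norm_power norm_transition[OF z])
    also have "exp (log_transition a v w (Lg z) / 2) ^ k = exp (real k * (log_transition a v w (Lg z) / 2))"
      by (simp only: exp_of_nat_mult)
    also have "norm (s w ?z) * \<dots> \<le> B w * exp (real T * norm (Lg z))"
    proof (intro mult_mono 1)
      have "log_transition a v w (Lg z) / 2 \<le> \<tau> w * norm (Lg z)"
      proof -
        have "log_transition a v w (Lg z) \<le> \<tau> w * norm (Lg z)" using abs_log_transition_le[of a v w "Lg z"] by (simp add: \<tau>_def)
        moreover have "0 \<le> \<tau> w * norm (Lg z)" using \<tau> by simp
        ultimately show ?thesis by linarith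
      qed
      also have "\<dots> \<le> (\<Sum>w\<in>W. \<tau> w) * norm (Lg z)"
        using member_le_sum[OF wx(1), of \<tau>] W(1) \<tau> by (intro mult_right_mono) auto
      finally have "real k * (log_transition a v w (Lg z) / 2) \<le> real k * ((\<Sum>w\<in>W. \<tau> w) * norm (Lg z))"
        by (rule mult_left_mono) simp
      also have "\<dots> = (real k * (\<Sum>w\<in>W. \<tau> w)) * norm (Lg z)" by simp
      also have "\<dots> \<le> real T * norm (Lg z)"
        by (intro mult_right_mono) (auto simp: T_def of_nat_ceiling)
      finally show "exp (real k * (log_transition a v w (Lg z) / 2)) \<le> exp (real T * norm (Lg z))" by simp
    qed (use B(1) wx in auto)
    also have "\<dots> \<le> (\<Sum>w\<in>W. B w) * exp (real T * norm (Lg z))"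
      using member_le_sum[OF wx(1), of B] W(1) B(1) by (intro mult_right_mono) auto
    finally show ?thesis .
  qed
  moreover have "(\<Sum>w\<in>W. B w) \<ge> 0" using B(1) by (simp add: sum_nonneg)
  ultimately show ?thesis by blast
qed

text \<open>Since \<open>Lg\<close> contains log |z_i|^2, the growth estimate is polynomial of
  degree \<open>2 * T\<close> in a single coordinate. By Liouville's theorem \<open>s v\<close> is a
  polynomial in each variable separately, with a degree bound independent of the other
  variables.\<close>

lemma section_laurent:
  assumes fan: "smooth_fan \<Sigma>" "complete_fan \<Sigma>" and v: "v \<in> frames \<Sigma>" and s: "s \<in> sections \<Sigma> a k"
  shows "laurent_on_orbit (s v)"
proof -
  obtain B T where BT: "B \<ge> 0" "\<And>z. z \<in> orbit \<Longrightarrow> norm (s v z) \<le> B * exp (real T * norm (Lg z))"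
    using section_growth[OF assms] by blast
  have hol: "holomorphic_fun (s v)" using s v by (simp add: sections_def)
  have "polynomial_along (Suc (2 * T)) (s v) i" for i
    unfolding polynomial_along_def
  proof
    fix z :: "complex ^ 'a" assume z: "z \<in> orbit"
    define B' where "B' = B * exp (real T * (\<Sum>j\<in>UNIV. \<bar>Lg z $ j\<bar>))"
    have bnd: "norm (s v (put z i \<xi>)) \<le> B' * norm \<xi> ^ (2 * T)" if \<xi>: "1 \<le> norm \<xi>" for \<xi>
    proof -
      have \<xi>0: "\<xi> \<noteq> 0" using \<xi> by auto
      have "norm (s v (put z i \<xi>)) \<le> B * exp (real T * norm (Lg (put z i \<xi>)))"
        using z \<xi>0 by (intro BT(2) put_in_orbit)
      also have "\<dots> \<le> B * exp (real T * ((\<Sum>j\<in>UNIV. \<bar>Lg z $ j\<bar>) + 2 * ln (norm \<xi>)))"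
        using norm_Lg_put[OF \<xi>, of z i] BT(1) by (intro mult_left_mono) (auto intro: mult_left_mono)
      also have "\<dots> = B' * exp (real (2 * T) * ln (norm \<xi>))"
        by (simp add: B'_def algebra_simps flip: exp_add)
      also have "exp (real (2 * T) * ln (norm \<xi>)) = norm \<xi> ^ (2 * T)"
        using \<xi>0 by (subst exp_of_nat_mult) simp
      finally show ?thesis .
    qed
    have "s v (put z i \<xi>) = (\<Sum>m<Suc (2 * T). ((deriv ^^ m) (\<lambda>\<xi>. s v (put z i \<xi>)) 0 / fact m) * \<xi> ^ m)" for \<xi>
      using Liouville_polynomial[OF holomorphic_along_coordinate[OF hol] bnd] by (simp add: lessThan_Suc_atMost)
    then show "\<exists>c. \<forall>\<xi>. \<xi> \<noteq> 0 \<longrightarrow> s v (put z i \<xi>) = (\<Sum>m<Suc (2 * T). c m * \<xi> ^ m)"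
      by (intro exI[of _ "\<lambda>m. (deriv ^^ m) (\<lambda>\<xi>. s v (put z i \<xi>)) 0 / fact m"] allI impI)
  qed
  then show ?thesis by (intro laurent_if_polynomial_along[where J = UNIV and N = "Suc (2 * T)"]) auto
qed

lemma shrink_in_unit_polydisc: "z \<in> unit_polydisc \<Longrightarrow> shrink i z \<in> unit_polydisc"
proof -
  assume z: "z \<in> unit_polydisc"
  have "norm (shrink i z $ j) \<le> norm (z $ j)" for j by (simp add: shrink_def norm_divide)
  with z show ?thesis unfolding unit_polydisc_def by (auto intro: order_trans)
qed

lemma mon_bounded_imp_nonneg:
  assumes "\<And>z. z \<in> orbit \<Longrightarrow> z \<in> unit_polydisc \<Longrightarrow> norm (mon e z) \<le> B"
  shows "e i \<ge> 0"
proof (rule ccontr)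
  assume "\<not> e i \<ge> 0"
  then have ei: "e i \<le> -1" by simp
  define x where "x = max 1 B"
  have x: "x > 0" "exp x > B" using exp_ge_add_one_self[of x] max.cobounded2[of B 1] max.cobounded1[of 1 B]
    unfolding x_def by linarith+
  \<comment> \<open>Only the \<open>i\<close>-th coordinate moves, to modulus
    \<open>exp (- x)\<close>; an exponent of at most -1 makes the monomial at least
    \<open>exp x > B\<close> in modulus.\<close>
  define y :: "real ^ 'a" where "y = (\<chi> j. if j = i then - 2 * x else 0)"
  have "norm (mon e (expv y)) \<le> B"
    using x(1) by (intro assms expv_in_unit_polydisc expv_in_orbit) (auto simp: y_def)
  moreover have "norm (mon e (expv y)) \<ge> exp x"
  proof -
    have "(norm (mon e (expv y)))\<^sup>2 = exp (of_int (e i) * (- 2 * x))"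
      unfolding norm_mon_squared[OF expv_in_orbit]
      by (simp add: y_def if_distrib[of "\<lambda>x. _ * x"] cong: if_cong)
    also have "\<dots> \<ge> (exp x)\<^sup>2"
    proof -
      have "of_int (e i) * (- 2 * x) \<ge> (-1) * (- 2 * x)" using ei x(1) by (intro mult_right_mono_neg) auto
      then show ?thesis by (simp add: power2_eq_square flip: exp_add)
    qed
    finally show ?thesis by (rule power2_le_imp_le) simp
  qed
  ultimately show False using x(2) by linarith
qed

text \<open>The Laurent expansion in the chart \<open>v\<close> is carried to any other chart by the
  transition functions, under which characters transform like sections; hence one \<open>S\<close>
  and one \<open>c\<close> for all charts. Boundedness of \<open>s w\<close> on the unit polydisc
  passes to each occurring character, which is therefore regular in every chart, and the identities
  extend from the orbit by continuity.\<close>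

lemma section_expansion:
  assumes fan: "smooth_fan \<Sigma>" "complete_fan \<Sigma>" and s: "s \<in> sections \<Sigma> a k" and v: "v \<in> frames \<Sigma>"
  shows "\<exists>S c. finite S \<and> (\<forall>m\<in>S. c m \<noteq> 0) \<and> (\<forall>m\<in>S. \<forall>w\<in>frames \<Sigma>. \<forall>i. expo a k w m i \<ge> 0) \<and>
     (\<forall>w\<in>frames \<Sigma>. \<forall>z. s w z = (\<Sum>m\<in>S. c m * mon (expo a k w m) z))"
proof -
  obtain S0 c0 where S0: "finite S0" "\<And>z. z \<in> orbit \<Longrightarrow> s v z = (\<Sum>e\<in>S0. c0 e * mon e z)"
    using section_laurent[OF fan v s] unfolding laurent_on_orbit_def by blast
  have inj: "inj (expo a k v)" using expo_inject[OF frames_invertible[OF v]] by (auto intro: injI)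
  define S where "S = {m. expo a k v m \<in> S0 \<and> c0 (expo a k v m) \<noteq> 0}"
  define c where "c m = c0 (expo a k v m)" for m
  have img: "expo a k v ` S = {e\<in>S0. c0 e \<noteq> 0}"
  proof (intro equalityI subsetI)
    fix e assume e: "e \<in> {e\<in>S0. c0 e \<noteq> 0}"
    obtain m where "expo a k v m = e" using expo_surj[OF frames_invertible[OF v]] by metis
    with e show "e \<in> expo a k v ` S" by (auto simp: S_def)
  qed (auto simp: S_def)
  have "finite (expo a k v ` S)" unfolding img using S0(1) by simp
  then have fin: "finite S" using inj by (simp add: finite_image_iff inj_on_subset)
  have ev: "s v z = (\<Sum>m\<in>S. c m * mon (expo a k v m) z)" if "z \<in> orbit" for z
  proof -
    have "s v z = (\<Sum>e\<in>expo a k v ` S. c0 e * mon e z)"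
      unfolding S0(2)[OF that] img using S0(1) by (intro sum.mono_neutral_right) auto
    also have "\<dots> = (\<Sum>m\<in>S. c m * mon (expo a k v m) z)"
      using inj by (subst sum.reindex) (auto simp: c_def intro: inj_on_subset)
    finally show ?thesis .
  qed
  have ew: "s w z = (\<Sum>m\<in>S. c m * mon (expo a k w m) z)" if w: "w \<in> frames \<Sigma>" and z: "z \<in> orbit" for w z
  proof -
    have "s w z = transition a w v z ^ k * s v (chart_change w v z)"
      by (rule section_transition[OF s w v orbit_subset_chart_overlap[OF z]])
    also have "\<dots> = (\<Sum>m\<in>S. c m * (transition a w v z ^ k * mon (expo a k v m) (chart_change w v z)))"
      by (simp add: ev[OF chart_change_in_orbit[OF z]] sum_distrib_left mult_ac)
    also have "\<dots> = (\<Sum>m\<in>S. c m * mon (expo a k w m) z)"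
      by (simp add: mon_transition[OF frames_invertible[OF v] orbit_subset_chart_overlap[OF z], symmetric])
    finally show ?thesis .
  qed
  have nonneg: "expo a k w m i \<ge> 0" if m: "m \<in> S" and w: "w \<in> frames \<Sigma>" for m w i
  proof -
    let ?P = "\<lambda>g :: complex ^ 'a \<Rightarrow> complex. \<exists>B. \<forall>z\<in>orbit \<inter> unit_polydisc. norm (g z) \<le> B"
    have "?P (mon (expo a k w m))"
    proof (rule monomial_extraction[where P = ?P and I = S and c = c and E = "expo a k w"])
      show "?P (\<lambda>z. b * g z)" if g: "?P g" for g b
      proof -
        obtain B where "\<forall>z\<in>orbit \<inter> unit_polydisc. norm (g z) \<le> B" using g by blast
        then have "\<forall>z\<in>orbit \<inter> unit_polydisc. norm (b * g z) \<le> norm b * B"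
          by (auto simp: norm_mult intro!: mult_left_mono)
        then show ?thesis by blast
      qed
      show "?P (\<lambda>z. g z - h z)" if gh: "?P g" "?P h" for g h
      proof -
        obtain A B where "\<forall>z\<in>orbit \<inter> unit_polydisc. norm (g z) \<le> A" "\<forall>z\<in>orbit \<inter> unit_polydisc. norm (h z) \<le> B"
          using gh by blast
        then have "\<forall>z\<in>orbit \<inter> unit_polydisc. norm (g z - h z) \<le> A + B"
          by (meson add_mono norm_triangle_ineq4 order_trans)
        then show ?thesis by blast
      qed
      show "?P (\<lambda>z. g (shrink i z))" if "?P g" for g i
        using that shrink_in_orbit shrink_in_unit_polydisc by (metis IntD1 IntD2 IntI)
      show "?P (\<lambda>z. \<Sum>m\<in>S. c m * mon (expo a k w m) z)"
        using section_bounded_on_unit_polydisc[OF s w] ew[OF w] by (metis IntD1 IntD2)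
      show "inj_on (expo a k w) S"
        using expo_inject[OF frames_invertible[OF w]] by (auto intro: inj_onI)
    qed (use fin m in \<open>auto simp: S_def c_def\<close>)
    then show ?thesis using mon_bounded_imp_nonneg by blast
  qed
  have all: "s w z = (\<Sum>m\<in>S. c m * mon (expo a k w m) z)" if w: "w \<in> frames \<Sigma>" for w z
  proof (rule continuous_eq_if_eq_on_orbit)
    show "continuous_on UNIV (s w)" using s w by (auto simp: sections_def intro: holomorphic_fun_imp_continuous)
    show "continuous_on UNIV (\<lambda>z. \<Sum>m\<in>S. c m * mon (expo a k w m) z)"
      using nonneg w by (intro holomorphic_fun_imp_continuous holomorphic_fun_sum fin holomorphic_fun_mult
        holomorphic_fun_const holomorphic_fun_mon)
  qed (rule ew[OF w])
  show ?thesis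
    using fin nonneg all by (intro exI[of _ S] exI[of _ c]) (auto simp: S_def c_def)
qed

lemma flag_valuation_expansion:
  fixes v :: "int ^ 'n::{finite,linorder} ^ 'n::{finite,linorder}"
  assumes "finite S" "S \<noteq> {}" "\<And>m. m \<in> S \<Longrightarrow> c m \<noteq> 0" "\<And>m i. m \<in> S \<Longrightarrow> expo a k v m i \<ge> 0"
    and v: "invertible v" and s: "\<And>z. s v z = (\<Sum>m\<in>S. c m * mon (expo a k v m) z)"
  shows "\<exists>m\<in>S. flag_valuation v s = (\<lambda>i. nat (expo a k v m i))"
proof -
  define g where "g m = (\<lambda>i. nat (expo a k v m i))" for m
  have gi: "(\<lambda>i. int (g m i)) = expo a k v m" if "m \<in> S" for m using assms(4)[OF that] by (simp add: g_def)
  have inj: "inj_on g S"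
  proof (rule inj_onI)
    fix m m' assume m: "m \<in> S" "m' \<in> S" and "g m = g m'"
    then have "expo a k v m = expo a k v m'" by (metis gi)
    then show "m = m'" using expo_inject[OF v] by blast
  qed
  have "s v = (\<lambda>z. \<Sum>\<alpha>\<in>g ` S. c (the_inv_into S g \<alpha>) * npow \<alpha> z)"
  proof
    fix z
    show "s v z = (\<Sum>\<alpha>\<in>g ` S. c (the_inv_into S g \<alpha>) * npow \<alpha> z)"
      unfolding s sum.reindex[OF inj]
      by (intro sum.cong) (auto simp: the_inv_into_f_f[OF inj] npow_eq_mon gi)
  qed
  moreover have "iterated_orders (sorted_list_of_set UNIV) (\<lambda>z. \<Sum>\<alpha>\<in>g ` S. c (the_inv_into S g \<alpha>) * npow \<alpha> z) \<in> g ` S"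
    using assms(1-3) by (intro iterated_orders_polynomial) (auto simp: the_inv_into_f_f[OF inj])
  ultimately show ?thesis by (auto simp: flag_valuation_def g_def)
qed

section \<open>Weighted square integrability of monomials\<close>

text \<open>Each locus \<open>z $ i = 0\<close> lies in the real hyperplane Re z_i = 0. Weights may
  be -\<infinity> off the orbit, so integrands are evaluated on the orbit.\<close>

lemma AE_orbit: "AE z in lborel. z \<in> (orbit :: (complex ^ 'n) set)"
proof -
  have "negligible {z :: complex ^ 'n. z $ i = 0}" for i
  proof -
    have "negligible {z :: complex ^ 'n. axis i 1 \<bullet> z = 0}"
      by (rule negligible_hyperplane) (simp add: axis_eq_0_iff)
    then show ?thesis by (rule negligible_subset) (auto simp: inner_axis inner_commute)
  qed
  then have "negligible (\<Union>i. {z :: complex ^ 'n. z $ i = 0})" by (intro negligible_Union) auto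
  moreover have "closed (\<Union>i. {z :: complex ^ 'n. z $ i = 0})"
  proof (intro closed_UN ballI)
    show "closed {z :: complex ^ 'n. z $ i = 0}" for i by (intro closed_Collect_eq continuous_intros)
  qed simp
  ultimately have "(\<Union>i. {z :: complex ^ 'n. z $ i = 0}) \<in> null_sets lborel"
    by (simp add: null_sets_completion_iff negligible_iff_null_sets)
  moreover have "- orbit = (\<Union>i. {z :: complex ^ 'n. z $ i = 0})" by (auto simp: orbit_def)
  ultimately have "- (orbit :: (complex ^ 'n) set) \<in> null_sets lborel" by simp
  then show ?thesis by (intro AE_I'[of "- orbit"]) auto
qed

lemma borel_measurable_vec_nth [measurable]: "(\<lambda>z :: complex ^ 'n. z $ i) \<in> borel_measurable borel"
  by (intro borel_measurable_continuous_onI continuous_intros)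

lemma orbit_borel [measurable]: "(orbit :: (complex ^ 'n) set) \<in> sets borel"
proof -
  have "open (\<Inter>i. {z :: complex ^ 'n. z $ i \<noteq> 0})"
    by (intro open_INT ballI open_Collect_neq continuous_intros) auto
  moreover have "(\<Inter>i. {z :: complex ^ 'n. z $ i \<noteq> 0}) = orbit" by (auto simp: orbit_def)
  ultimately show ?thesis by auto
qed

lemma Lg_measurable [measurable]: "(Lg :: complex ^ 'n \<Rightarrow> _) \<in> borel_measurable borel"
proof (subst borel_measurable_euclidean_space, intro ballI)
  fix b :: "real ^ 'n" assume "b \<in> Basis"
  then obtain i where b: "b = axis i 1" by (auto simp: Basis_vec_def)
  have "(\<lambda>z :: complex ^ 'n. ln ((norm (z $ i))\<^sup>2)) \<in> borel_measurable borel" by measurable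
  then show "(\<lambda>z :: complex ^ 'n. Lg z \<bullet> b) \<in> borel_measurable borel"
    by (simp add: b inner_axis Lg_def)
qed

lemma shrink_measurable [measurable]: "(shrink i :: complex ^ 'n \<Rightarrow> _) \<in> borel_measurable borel"
proof -
  have eq: "(shrink i :: complex ^ 'n \<Rightarrow> _) = (\<lambda>z. \<chi> j. (if j = i then 1 / 2 else 1) * z $ j)"
    by (auto simp: fun_eq_iff vec_eq_iff shrink_def)
  show ?thesis unfolding eq by (intro borel_measurable_continuous_onI continuous_intros)
qed

text \<open>The map halves the two real coordinates that belong to \<open>z $ i\<close>, so the
  factor is the inverse Jacobian 4. The function \<open>c\<close> gives its diagonal entries on the
  standard basis.\<close>

lemma nn_integral_shrink:
  fixes i :: "'n::finite"
  shows "\<exists>K>0. \<forall>h\<in>borel_measurable borel. (\<integral>\<^sup>+ z. h (shrink i z) \<partial>lborel) = ennreal K * (\<integral>\<^sup>+ z. h z \<partial>(lborel :: (complex ^ 'n) measure))"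
proof -
  define c :: "complex ^ 'n \<Rightarrow> real" where "c b = (if b $ i = 0 then 1 else 1 / 2)" for b
  define K where "K = (\<Prod>j\<in>Basis. \<bar>c j\<bar>)"
  have c0: "c j \<noteq> 0" for j by (simp add: c_def)
  have K: "K > 0" unfolding K_def by (intro prod_pos) (simp add: c_def)
  have T: "(\<lambda>x. 0 + (\<Sum>j\<in>Basis. (c j * (x \<bullet> j)) *\<^sub>R j)) = shrink i"
  proof
    fix z :: "complex ^ 'n"
    show "0 + (\<Sum>j\<in>Basis. (c j * (z \<bullet> j)) *\<^sub>R j) = shrink i z"
    proof (rule euclidean_eqI)
      fix b :: "complex ^ 'n" assume b: "b \<in> Basis"
      then obtain l u where lu: "b = axis l u" "u \<in> Basis" by (auto simp: Basis_vec_def)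
      then have u: "u \<noteq> 0" by auto
      have "(0 + (\<Sum>j\<in>Basis. (c j * (z \<bullet> j)) *\<^sub>R j)) \<bullet> b = c b * (z \<bullet> b)"
        using b by (simp add: inner_sum_left inner_Basis if_distrib[of "\<lambda>x. _ * x"] cong: if_cong)
      also have "\<dots> = shrink i z \<bullet> b"
      proof -
        have "c b = (if l = i then 1 / 2 else 1)" using u by (simp add: c_def lu axis_def)
        then show ?thesis by (auto simp: lu inner_axis shrink_def inner_complex_def field_simps)
      qed
      finally show "(0 + (\<Sum>j\<in>Basis. (c j * (z \<bullet> j)) *\<^sub>R j)) \<bullet> b = shrink i z \<bullet> b" .
    qed
  qed
  have lb: "lborel = density (distr lborel borel (shrink i)) (\<lambda>_. ennreal K)"
    using lborel_affine_euclidean[of c 0] c0 unfolding T K_def by auto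
  have "(\<integral>\<^sup>+ z. h (shrink i z) \<partial>lborel) = ennreal (1 / K) * (\<integral>\<^sup>+ z. h z \<partial>lborel)"
    if h[measurable]: "h \<in> borel_measurable borel" for h :: "complex ^ 'n \<Rightarrow> ennreal"
  proof -
    have "(\<integral>\<^sup>+ z. h z \<partial>lborel) = (\<integral>\<^sup>+ z. h z \<partial>(density (distr lborel borel (shrink i)) (\<lambda>_. ennreal K)))"
      using lb by simp
    also have "\<dots> = (\<integral>\<^sup>+ z. ennreal K * h z \<partial>(distr lborel borel (shrink i)))"
      by (intro nn_integral_density) auto
    also have "\<dots> = (\<integral>\<^sup>+ z. ennreal K * h (shrink i z) \<partial>lborel)"
      by (intro nn_integral_distr) auto
    also have "\<dots> = ennreal K * (\<integral>\<^sup>+ z. h (shrink i z) \<partial>lborel)"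
      by (intro nn_integral_cmult) auto
    finally have "ennreal (1 / K) * (\<integral>\<^sup>+ z. h z \<partial>lborel)
        = (ennreal (1 / K) * ennreal K) * (\<integral>\<^sup>+ z. h (shrink i z) \<partial>lborel)" by (simp add: mult.assoc)
    also have "ennreal (1 / K) * ennreal K = 1" using K by (simp flip: ennreal_mult)
    finally show ?thesis by simp
  qed
  with K show ?thesis by (intro exI[of _ "1 / K"]) auto
qed

text \<open>The radius 3/2 leaves room for balls of radius at most 1/2 around points of the unit
  polydisc; these are used to pass from integrals to values.\<close>

definition punctured_polydisc :: "(complex ^ 'n) set" where
  "punctured_polydisc = {z \<in> orbit. \<forall>i. norm (z $ i) \<le> 3 / 2}"

lemma punctured_polydisc_borel [measurable]: "(punctured_polydisc :: (complex ^ 'n) set) \<in> sets borel"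
proof -
  have "closed (\<Inter>i. {z :: complex ^ 'n. norm (z $ i) \<le> 3 / 2})"
    by (intro closed_INT ballI closed_Collect_le continuous_intros)
  then have meas: "(\<Inter>i. {z :: complex ^ 'n. norm (z $ i) \<le> 3 / 2}) \<inter> orbit \<in> sets borel" by auto
  have eq: "(punctured_polydisc :: (complex ^ 'n) set) = (\<Inter>i. {z :: complex ^ 'n. norm (z $ i) \<le> 3 / 2}) \<inter> orbit"
    by (auto simp: punctured_polydisc_def)
  show ?thesis unfolding eq by (rule meas)
qed

lemma shrink_in_punctured_polydisc: "z \<in> punctured_polydisc \<Longrightarrow> shrink i z \<in> punctured_polydisc"
proof -
  assume z: "z \<in> punctured_polydisc"
  have "norm (shrink i z $ j) \<le> norm (z $ j)" for j by (simp add: shrink_def norm_divide)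
  with z show ?thesis unfolding punctured_polydisc_def using order_trans by blast
qed

lemma norm_Lg_shrink:
  assumes "z \<in> orbit"
  shows "norm (Lg (shrink i z) - Lg z) \<le> 2 * ln 2"
proof -
  have "norm (Lg (shrink i z) - Lg z) \<le> (\<Sum>j\<in>UNIV. \<bar>(Lg (shrink i z) - Lg z) $ j\<bar>)" by (rule norm_le_l1_cart)
  also have "\<dots> \<le> (\<Sum>j\<in>UNIV. if j = i then 2 * ln 2 else 0)"
  proof (rule sum_mono)
    fix j
    have "z $ i \<noteq> 0" using assms by (simp add: orbit_def)
    then have "ln ((norm (z $ i) / 2)\<^sup>2) - ln ((norm (z $ i))\<^sup>2) = - 2 * ln 2"
      by (simp add: ln_realpow ln_div)
    then show "\<bar>(Lg (shrink i z) - Lg z) $ j\<bar> \<le> (if j = i then 2 * ln 2 else 0)"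
      by (auto simp: Lg_def shrink_def norm_divide)
  qed
  finally show ?thesis by simp
qed

text \<open>\<open>H\<close> stands for a multiple of a chart weight in logarithmic coordinates. The
  condition is stable under the three operations in \<open>monomial_extraction\<close>.\<close>

definition weighted_L2 :: "(real ^ 'n \<Rightarrow> real) \<Rightarrow> (complex ^ 'n \<Rightarrow> complex) \<Rightarrow> bool" where
  "weighted_L2 H g \<longleftrightarrow> g \<in> borel_measurable borel \<and>
     (\<integral>\<^sup>+ z\<in>punctured_polydisc. ennreal ((norm (g z))\<^sup>2 * exp (- H (Lg z))) \<partial>lborel) < \<infinity>"

lemma weighted_L2_scale:
  assumes "weighted_L2 H g" "H \<in> borel_measurable borel"
  shows "weighted_L2 H (\<lambda>z. b * g z)"
proof -
  have [measurable]: "g \<in> borel_measurable borel" "H \<in> borel_measurable borel" using assms by (auto simp: weighted_L2_def)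
  have "(\<integral>\<^sup>+ z\<in>punctured_polydisc. ennreal ((norm (b * g z))\<^sup>2 * exp (- H (Lg z))) \<partial>lborel)
      = (\<integral>\<^sup>+ z. ennreal ((norm b)\<^sup>2) * (ennreal ((norm (g z))\<^sup>2 * exp (- H (Lg z))) * indicator punctured_polydisc z) \<partial>lborel)"
    by (intro nn_integral_cong)
      (auto simp: norm_mult power_mult_distrib mult.assoc indicator_def ennreal_mult'[symmetric])
  also have "\<dots> = ennreal ((norm b)\<^sup>2) * (\<integral>\<^sup>+ z\<in>punctured_polydisc. ennreal ((norm (g z))\<^sup>2 * exp (- H (Lg z))) \<partial>lborel)"
    by (intro nn_integral_cmult) measurable
  also have "\<dots> < \<infinity>" using assms(1) by (simp add: weighted_L2_def ennreal_mult_less_top)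
  finally show ?thesis by (simp add: weighted_L2_def)
qed

lemma weighted_L2_diff:
  assumes "weighted_L2 H g" "weighted_L2 H h" "H \<in> borel_measurable borel"
  shows "weighted_L2 H (\<lambda>z. g z - h z)"
proof -
  have [measurable]: "g \<in> borel_measurable borel" "h \<in> borel_measurable borel" "H \<in> borel_measurable borel"
    using assms by (auto simp: weighted_L2_def)
  let ?e = "\<lambda>g z. (norm (g z))\<^sup>2 * exp (- H (Lg z))"
  have le: "?e (\<lambda>z. g z - h z) z \<le> 2 * ?e g z + 2 * ?e h z" for z
  proof -
    have "(norm (g z - h z))\<^sup>2 \<le> (norm (g z) + norm (h z))\<^sup>2"
      by (intro power_mono norm_triangle_ineq4) simp
    also have "\<dots> \<le> 2 * (norm (g z))\<^sup>2 + 2 * (norm (h z))\<^sup>2"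
      using sum_squares_bound[of "norm (g z)" "norm (h z)"] by (simp add: power2_sum)
    finally have "?e (\<lambda>z. g z - h z) z \<le> (2 * (norm (g z))\<^sup>2 + 2 * (norm (h z))\<^sup>2) * exp (- H (Lg z))"
      by (intro mult_right_mono) auto
    then show ?thesis by (simp add: algebra_simps)
  qed
  have "(\<integral>\<^sup>+ z\<in>punctured_polydisc. ennreal (?e (\<lambda>z. g z - h z) z) \<partial>lborel)
      \<le> (\<integral>\<^sup>+ z. 2 * (ennreal (?e g z) * indicator punctured_polydisc z) + 2 * (ennreal (?e h z) * indicator punctured_polydisc z) \<partial>lborel)"
  proof (intro nn_integral_mono)
    fix z
    have "ennreal (?e (\<lambda>z. g z - h z) z) \<le> ennreal (2 * ?e g z + 2 * ?e h z)" using le by (rule ennreal_leI)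
    also have "\<dots> = 2 * ennreal (?e g z) + 2 * ennreal (?e h z)"
      by (simp add: ennreal_plus ennreal_mult')
    finally show "ennreal (?e (\<lambda>z. g z - h z) z) * indicator punctured_polydisc z
        \<le> 2 * (ennreal (?e g z) * indicator punctured_polydisc z) + 2 * (ennreal (?e h z) * indicator punctured_polydisc z)"
      by (auto simp: indicator_def)
  qed
  also have "\<dots> = 2 * (\<integral>\<^sup>+ z\<in>punctured_polydisc. ennreal (?e g z) \<partial>lborel) + 2 * (\<integral>\<^sup>+ z\<in>punctured_polydisc. ennreal (?e h z) \<partial>lborel)"
    by (simp add: nn_integral_add nn_integral_cmult)
  also have "\<dots> < \<infinity>" using assms(1,2) by (simp add: weighted_L2_def ennreal_mult_less_top)
  finally show ?thesis by (simp add: weighted_L2_def)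
qed

text \<open>The punctured polydisc is mapped into itself, and \<open>Lg\<close> moves by at most
  \<open>2 * ln 2\<close>, so the Lipschitz bound on \<open>H\<close> limits the change of the
  weight to the factor \<open>C\<close>.\<close>

lemma weighted_L2_shrink:
  assumes g: "weighted_L2 H g" and H: "\<And>x y. H y - H x \<le> M * norm (y - x)" "M \<ge> 0" "H \<in> borel_measurable borel"
  shows "weighted_L2 H (\<lambda>z. g (shrink i z))"
proof -
  have [measurable]: "g \<in> borel_measurable borel" "H \<in> borel_measurable borel" using assms by (auto simp: weighted_L2_def)
  define C where "C = exp (M * (2 * ln 2))"
  let ?e = "\<lambda>z. (norm (g z))\<^sup>2 * exp (- H (Lg z))"
  obtain K where K: "K > 0" "\<forall>h\<in>borel_measurable borel. (\<integral>\<^sup>+ z. h (shrink i z) \<partial>lborel) = ennreal K * (\<integral>\<^sup>+ z. h z \<partial>(lborel :: (complex ^ 'a) measure))"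
    using nn_integral_shrink by blast
  have "(\<integral>\<^sup>+ z\<in>punctured_polydisc. ennreal ((norm (g (shrink i z)))\<^sup>2 * exp (- H (Lg z))) \<partial>lborel)
      \<le> (\<integral>\<^sup>+ z. ennreal C * (ennreal (?e (shrink i z)) * indicator punctured_polydisc (shrink i z)) \<partial>lborel)"
  proof (intro nn_integral_mono)
    fix z :: "complex ^ 'a"
    have "(norm (g (shrink i z)))\<^sup>2 * exp (- H (Lg z)) \<le> C * ?e (shrink i z)" if "z \<in> orbit"
    proof -
      have "H (Lg (shrink i z)) - H (Lg z) \<le> M * norm (Lg (shrink i z) - Lg z)" by (rule H)
      also have "\<dots> \<le> M * (2 * ln 2)" using norm_Lg_shrink[OF that] H(2) by (rule mult_left_mono)
      finally have "exp (- H (Lg z)) \<le> C * exp (- H (Lg (shrink i z)))"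
        by (simp add: C_def flip: exp_add)
      then have "(norm (g (shrink i z)))\<^sup>2 * exp (- H (Lg z)) \<le> (norm (g (shrink i z)))\<^sup>2 * (C * exp (- H (Lg (shrink i z))))"
        by (intro mult_left_mono) auto
      then show ?thesis by (simp add: mult_ac)
    qed
    then have "ennreal ((norm (g (shrink i z)))\<^sup>2 * exp (- H (Lg z))) \<le> ennreal C * ennreal (?e (shrink i z))" if "z \<in> punctured_polydisc"
      using that by (simp add: punctured_polydisc_def C_def flip: ennreal_mult')
    then show "ennreal ((norm (g (shrink i z)))\<^sup>2 * exp (- H (Lg z))) * indicator punctured_polydisc z
        \<le> ennreal C * (ennreal (?e (shrink i z)) * indicator punctured_polydisc (shrink i z))"
      using shrink_in_punctured_polydisc[of z i] by (auto simp: indicator_def)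
  qed
  also have "\<dots> = ennreal C * (\<integral>\<^sup>+ z. ennreal (?e (shrink i z)) * indicator punctured_polydisc (shrink i z) \<partial>lborel)"
    by (intro nn_integral_cmult) measurable
  also have "(\<integral>\<^sup>+ z. ennreal (?e (shrink i z)) * indicator punctured_polydisc (shrink i z) \<partial>lborel)
      = ennreal K * (\<integral>\<^sup>+ z\<in>punctured_polydisc. ennreal (?e z) \<partial>lborel)"
    by (rule bspec[OF K(2), of "\<lambda>z. ennreal (?e z) * indicator punctured_polydisc z"]) measurable
  also have "ennreal C * \<dots> < \<infinity>"
    using g by (simp add: weighted_L2_def ennreal_mult_less_top)
  finally show ?thesis by (simp add: weighted_L2_def)
qed

text \<open>Because \<open>- norm x \<le> x $ i\<close>, the radius is at most half the modulus of
  each coordinate of the centre. Every coordinate thus keeps its modulus up to a factor 2, and its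
  logarithmic coordinate up to \<open>2 * ln 2\<close>.\<close>

lemma ball_expv_subset_punctured_polydisc:
  assumes x: "\<And>i. x $ i \<le> 0" and z: "z \<in> ball (expv x) (exp (- norm x / 2) / 2)"
  shows "z \<in> punctured_polydisc" "\<bar>Lg z $ i - x $ i\<bar> \<le> 2 * ln 2"
proof -
  have comp: "exp (x $ i / 2) / 2 \<le> norm (z $ i) \<and> norm (z $ i) \<le> 3 / 2 * exp (x $ i / 2)" for i
  proof -
    have "- norm x \<le> x $ i" using component_le_norm_cart[of x i] by linarith
    then have "exp (- norm x / 2) / 2 \<le> exp (x $ i / 2) / 2" by simp
    moreover have "norm ((expv x - z) $ i) \<le> norm (expv x - z)" by (rule Finite_Cartesian_Product.norm_nth_le)
    moreover have "norm (expv x - z) < exp (- norm x / 2) / 2" using z by (simp add: dist_norm)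
    ultimately have "norm ((expv x - z) $ i) \<le> exp (x $ i / 2) / 2" by linarith
    then have d: "norm (expv x $ i - z $ i) \<le> exp (x $ i / 2) / 2" by simp
    have n: "norm (expv x $ i) = exp (x $ i / 2)" by (simp add: expv_def)
    show ?thesis
      using d n norm_triangle_ineq2[of "expv x $ i" "z $ i"] norm_triangle_ineq3[of "expv x $ i" "z $ i"] by simp
  qed
  have nz: "norm (z $ i) > 0" for i using comp[of i] by (metis exp_gt_zero half_gt_zero less_le_trans)
  then have "z \<in> orbit" by (simp add: orbit_def)
  moreover have "norm (z $ i) \<le> 3 / 2" for i
  proof -
    have "exp (x $ i / 2) \<le> 1" using x by simp
    then show ?thesis using comp[of i] by linarith
  qed
  ultimately show "z \<in> punctured_polydisc" by (simp add: punctured_polydisc_def)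
  have L: "Lg z $ i = 2 * ln (norm (z $ i))" using nz[of i] by (simp add: Lg_def ln_realpow)
  have "ln (exp (x $ i / 2) / 2) \<le> ln (norm (z $ i))" using comp[of i] nz[of i] by (subst ln_le_cancel_iff) auto
  then have 1: "x $ i / 2 - ln 2 \<le> ln (norm (z $ i))" by (simp add: ln_div)
  have "norm (z $ i) \<le> 2 * exp (x $ i / 2)" using comp[of i] by (simp add: order_trans)
  then have "ln (norm (z $ i)) \<le> ln (2 * exp (x $ i / 2))" using nz[of i] by (subst ln_le_cancel_iff) auto
  then have 2: "ln (norm (z $ i)) \<le> x $ i / 2 + ln 2" by (simp add: ln_mult)
  show "\<bar>Lg z $ i - x $ i\<bar> \<le> 2 * ln 2" unfolding L using 1 2 by linarith
qed

text \<open>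
  Integrability near the torus-fixed point controls the integrand pointwise, since its logarithm is a
  Lipschitz function of \<open>log|z|\<^sup>2\<close> and a ball of radius about \<open>min |z\<^sub>i|\<close> has volume at least
  \<open>exp (- c |log|z|\<^sup>2|)\<close>.
\<close>

lemma weighted_L2_mon_growth:
  fixes H :: "real ^ 'n \<Rightarrow> real"
  assumes L2: "weighted_L2 H (mon e)" and H: "\<And>x y. H y - H x \<le> M * norm (y - x)" "M \<ge> 0" "H \<in> borel_measurable borel"
  shows "\<exists>C. \<forall>x. (\<forall>i. x $ i \<le> 0) \<longrightarrow>
    (\<Sum>i\<in>UNIV. of_int (e i) * x $ i) - H x \<le> C + real DIM(complex ^ 'n) / 2 * norm x"
proof -
  define E where "E x = (\<Sum>i\<in>UNIV. of_int (e i) * x $ i) - H x" for x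
  define I where "I = (\<integral>\<^sup>+ z\<in>punctured_polydisc. ennreal ((norm (mon e z))\<^sup>2 * exp (- H (Lg z))) \<partial>lborel)"
  define d where "d = DIM(complex ^ 'n)"
  \<comment> \<open>A bound for the oscillation of \<open>E\<close> over the ball: the monomial
    contributes through its exponents, the weight through its Lipschitz constant.\<close>
  define A where "A = (\<Sum>i\<in>UNIV. \<bar>real_of_int (e i)\<bar>) * (2 * ln 2) + M * (real CARD('n) * (2 * ln 2))"
  have I: "I < \<infinity>" using L2 by (simp add: weighted_L2_def I_def)
  define V where "V = unit_ball_vol (real d) / 2 ^ d"
  have V: "V > 0" by (simp add: V_def unit_ball_vol_pos)
  \<comment> \<open>\<open>A\<close> and \<open>I\<close> depend on the exponent and the weight but
    enter the constant only; the coefficient \<open>d / 2\<close> comes from the radius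
    \<open>exp (- norm x / 2) / 2\<close> raised to the real dimension \<open>d\<close>. The summand
    1 keeps the argument of \<open>ln\<close> positive.\<close>
  have main: "E x \<le> ln (enn2real I / V + 1) + A + real d / 2 * norm x" if x: "\<forall>i. x $ i \<le> 0" for x
  proof -
    define \<rho> where "\<rho> = exp (- norm x / 2) / 2"
    have \<rho>: "\<rho> > 0" by (simp add: \<rho>_def)
    have near: "E x - A \<le> E (Lg z)" if z: "z \<in> ball (expv x) \<rho>" for z
    proof -
      note b = ball_expv_subset_punctured_polydisc(2)[OF x[rule_format] z[unfolded \<rho>_def]]
      have "\<bar>(\<Sum>i\<in>UNIV. of_int (e i) * x $ i) - (\<Sum>i\<in>UNIV. of_int (e i) * Lg z $ i)\<bar>
          = \<bar>\<Sum>i\<in>UNIV. of_int (e i) * (x $ i - Lg z $ i)\<bar>"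
        by (simp add: sum_subtractf algebra_simps)
      also have "\<dots> \<le> (\<Sum>i\<in>UNIV. \<bar>of_int (e i) * (x $ i - Lg z $ i)\<bar>)" by (rule sum_abs)
      also have "\<dots> \<le> (\<Sum>i\<in>UNIV. \<bar>real_of_int (e i)\<bar> * (2 * ln 2))"
        using b by (intro sum_mono) (auto simp: abs_mult abs_minus_commute intro!: mult_left_mono)
      finally have 1: "(\<Sum>i\<in>UNIV. of_int (e i) * x $ i) - (\<Sum>i\<in>UNIV. of_int (e i) * Lg z $ i)
          \<le> (\<Sum>i\<in>UNIV. \<bar>real_of_int (e i)\<bar>) * (2 * ln 2)" by (simp add: sum_distrib_right)
      have "norm (Lg z - x) \<le> (\<Sum>i\<in>UNIV. \<bar>(Lg z - x) $ i\<bar>)" by (rule norm_le_l1_cart)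
      also have "\<dots> \<le> (\<Sum>i\<in>(UNIV :: 'n set). 2 * ln 2)" using b by (intro sum_mono) simp
      finally have "M * norm (Lg z - x) \<le> M * (real CARD('n) * (2 * ln 2))" using H(2) by (intro mult_left_mono) auto
      then have 2: "H (Lg z) - H x \<le> M * (real CARD('n) * (2 * ln 2))" using H(1)[of "Lg z" x] by linarith
      show ?thesis using 1 2 unfolding E_def A_def by linarith
    qed
    have "ennreal (exp (E x - A) * (V * exp (- (real d / 2) * norm x))) = ennreal (exp (E x - A)) * emeasure lborel (ball (expv x) \<rho>)"
    proof -
      have "\<rho> ^ d = exp (- (real d / 2) * norm x) / 2 ^ d"
        by (simp add: \<rho>_def power_divide flip: exp_of_nat_mult)
      then have "emeasure lborel (ball (expv x) \<rho>) = ennreal (V * exp (- (real d / 2) * norm x))"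
        using \<rho> by (subst emeasure_ball) (simp_all add: d_def V_def)
      then show ?thesis by (simp add: ennreal_mult')
    qed
    also have "\<dots> = (\<integral>\<^sup>+ z. ennreal (exp (E x - A)) * indicator (ball (expv x) \<rho>) z \<partial>lborel)"
      by (subst nn_integral_cmult_indicator) auto
    also have "\<dots> \<le> I"
      unfolding I_def
    proof (intro nn_integral_mono)
      fix z :: "complex ^ 'n"
      have "exp (E x - A) \<le> (norm (mon e z))\<^sup>2 * exp (- H (Lg z)) \<and> z \<in> punctured_polydisc" if "z \<in> ball (expv x) \<rho>"
      proof
        show d: "z \<in> punctured_polydisc" using ball_expv_subset_punctured_polydisc(1)[OF x[rule_format]] that unfolding \<rho>_def by blast
        then have "(norm (mon e z))\<^sup>2 * exp (- H (Lg z)) = exp (E (Lg z))"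
          by (simp add: norm_mon_squared punctured_polydisc_def E_def flip: exp_add)
        then show "exp (E x - A) \<le> (norm (mon e z))\<^sup>2 * exp (- H (Lg z))" using near[OF that] by simp
      qed
      then show "ennreal (exp (E x - A)) * indicator (ball (expv x) \<rho>) z
          \<le> ennreal ((norm (mon e z))\<^sup>2 * exp (- H (Lg z))) * indicator punctured_polydisc z"
        by (auto simp: indicator_def intro!: ennreal_leI)
    qed
    finally have "ennreal (exp (E x - A) * (V * exp (- (real d / 2) * norm x))) \<le> ennreal (enn2real I)"
      using I by simp
    then have V_le: "exp (E x - A) * (V * exp (- (real d / 2) * norm x)) \<le> enn2real I"
      by (simp add: ennreal_le_iff)
    have "E x - A - real d / 2 * norm x = (E x - A) + (- (real d / 2) * norm x)" by simp
    then have "exp (E x - A - real d / 2 * norm x) * V = exp (E x - A) * (V * exp (- (real d / 2) * norm x))"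
      by (simp only: exp_add mult_ac)
    with V_le have "exp (E x - A - real d / 2 * norm x) * V \<le> enn2real I" by (simp only:)
    then have "exp (E x - A - real d / 2 * norm x) \<le> enn2real I / V + 1"
      using V by (simp add: pos_le_divide_eq[symmetric] add_increasing2)
    then have "E x - A - real d / 2 * norm x \<le> ln (enn2real I / V + 1)"
      by (metis exp_gt_zero less_le_trans ln_ge_iff)
    then show ?thesis by linarith
  qed
  then show ?thesis unfolding E_def d_def[symmetric]
    by (intro exI[of _ "ln (enn2real I / V + 1) + A"]) auto
qed

section \<open>The partial Okounkov body\<close>

text \<open>The logarithmic form of \<open>expo_change\<close>. It shows that log |z^m|^2 minus the
  \<open>k\<close>-fold weight is the same function in every chart, so estimates can be moved to the
  coordinates of \<open>v\<close>.\<close>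

lemma expo_pairing:
  assumes "invertible v"
  shows "(\<Sum>i\<in>UNIV. real_of_int (expo a k w m i) * x $ i) - real k * log_transition a w v x
    = (\<Sum>j\<in>UNIV. real_of_int (expo a k v m j) * log_change w v x $ j)"
proof -
  have "(\<Sum>i\<in>UNIV. real_of_int (expo a k w m i) * x $ i)
      = real k * log_transition a w v x + (\<Sum>i\<in>UNIV. \<Sum>j\<in>UNIV. of_int (frame_change w v $ i $ j) * of_int (expo a k v m j) * x $ i)"
    unfolding expo_change[OF assms, of a k w m] log_transition_def
    by (simp add: sum.distrib sum_distrib_left sum_distrib_right distrib_right mult.assoc)
  moreover have "(\<Sum>i\<in>UNIV. \<Sum>j\<in>UNIV. of_int (frame_change w v $ i $ j) * of_int (expo a k v m j) * x $ i)
      = (\<Sum>j\<in>UNIV. real_of_int (expo a k v m j) * log_change w v x $ j)"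
    by (subst sum.swap) (simp add: log_change_def sum_distrib_left mult_ac)
  ultimately show ?thesis by simp
qed

text \<open>By \<open>weight_in_frame\<close> this is \<open>k\<close> times the weight of the chart
  \<open>w\<close> in logarithmic coordinates.\<close>

definition frame_weight ::
    "(int ^ 'n \<Rightarrow> int) \<Rightarrow> (int ^ 'n ^ 'n \<Rightarrow> complex ^ 'n \<Rightarrow> ereal) \<Rightarrow> int ^ 'n ^ 'n \<Rightarrow> nat \<Rightarrow> int ^ 'n ^ 'n \<Rightarrow> real ^ 'n \<Rightarrow> real" where
  "frame_weight a \<phi> v k w x = real k * (potential a \<phi> v (log_change w v x) + log_transition a w v x)"

lemma exp_ereal_weight:
  assumes "toric_hermitian_big \<Sigma> a \<phi>" "v \<in> frames \<Sigma>" "w \<in> frames \<Sigma>" "z \<in> orbit"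
  shows "exp_ereal (- (ereal (real k) * \<phi> w z)) = ennreal (exp (- frame_weight a \<phi> v k w (Lg z)))"
  by (simp add: weight_in_frame[OF assms] frame_weight_def)

lemma frame_weight_lipschitz:
  assumes "smooth_fan \<Sigma>" "complete_fan \<Sigma>" "toric_hermitian_big \<Sigma> a \<phi>" "v \<in> frames \<Sigma>"
  shows "\<exists>M\<ge>0. \<forall>x y. frame_weight a \<phi> v k w y - frame_weight a \<phi> v k w x \<le> M * norm (y - x)"
proof -
  obtain L where L: "L \<ge> 0" "\<And>x y. potential a \<phi> v y - potential a \<phi> v x \<le> L * norm (y - x)"
    using potential_lipschitz[OF assms] by blast
  obtain B where B: "B > 0" "\<And>x. norm (log_change w v x) \<le> B * norm x" using log_change_bounded[of w v] by blast
  define T where "T = (\<Sum>i\<in>UNIV. \<bar>real_of_int (transition_exponent a w v i)\<bar>)"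
  have T: "T \<ge> 0" by (simp add: T_def sum_nonneg)
  have "frame_weight a \<phi> v k w y - frame_weight a \<phi> v k w x \<le> (real k * (L * B + T)) * norm (y - x)" for x y
  proof -
    have "log_change w v y - log_change w v x = log_change w v (y - x)" by (simp add: linear_diff[OF linear_log_change])
    then have "L * norm (log_change w v y - log_change w v x) \<le> L * (B * norm (y - x))"
      using B(2) L(1) by (auto intro: mult_left_mono)
    then have 1: "potential a \<phi> v (log_change w v y) - potential a \<phi> v (log_change w v x) \<le> L * B * norm (y - x)"
      using L(2)[of "log_change w v y" "log_change w v x"] by simp
    have "log_transition a w v y - log_transition a w v x = log_transition a w v (y - x)"
      by (simp add: log_transition_def sum_subtractf algebra_simps)
    then have 2: "log_transition a w v y - log_transition a w v x \<le> T * norm (y - x)"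
      using abs_log_transition_le[of a w v "y - x"] by (simp add: T_def)
    have "real k * ((potential a \<phi> v (log_change w v y) - potential a \<phi> v (log_change w v x)) + (log_transition a w v y - log_transition a w v x))
        \<le> real k * (L * B * norm (y - x) + T * norm (y - x))"
      using 1 2 by (intro mult_left_mono add_mono) auto
    then show ?thesis by (simp add: frame_weight_def algebra_simps)
  qed
  then show ?thesis using L(1) B(1) T by (intro exI[of _ "real k * (L * B + T)"]) auto
qed

lemma frame_weight_measurable:
  assumes "toric_hermitian_big \<Sigma> a \<phi>" "v \<in> frames \<Sigma>"
  shows "frame_weight a \<phi> v k w \<in> borel_measurable borel"
proof -
  have "continuous_on UNIV (potential a \<phi> v)"
    using convex_on_continuous[OF open_UNIV convex_potential[OF assms]] .
  moreover have "continuous_on UNIV (log_change w v)" by (rule linear_continuous_on) (simp add: linear_log_change linear_conv_bounded_linear[symmetric])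
  ultimately have "continuous_on UNIV (\<lambda>x. potential a \<phi> v (log_change w v x))"
    by (metis continuous_on_compose2 subset_UNIV)
  then have "continuous_on UNIV (frame_weight a \<phi> v k w)"
    unfolding frame_weight_def log_transition_def by (intro continuous_intros)
  then show ?thesis by (rule borel_measurable_continuous_onI)
qed

text \<open>The multiplier ideal condition gives a neighbourhood of integrability at every point of
  the chart, those on the coordinate hyperplanes included. A closed ball containing the punctured
  polydisc is compact, so finitely many of these neighbourhoods cover it.\<close>

lemma multiplier_section_weighted_L2:
  assumes big: "toric_hermitian_big \<Sigma> a \<phi>" and v: "v \<in> frames \<Sigma>" and w: "w \<in> frames \<Sigma>"
    and s: "s \<in> multiplier_sections \<Sigma> a \<phi> k"
  shows "weighted_L2 (frame_weight a \<phi> v k w) (s w)"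
proof -
  let ?H = "frame_weight a \<phi> v k w"
  have [measurable]: "s w \<in> borel_measurable borel"
    using s w by (auto simp: multiplier_sections_def sections_def
        intro: borel_measurable_continuous_onI holomorphic_fun_imp_continuous)
  have [measurable]: "?H \<in> borel_measurable borel" by (rule frame_weight_measurable[OF big v])
  define M where "M z = ennreal ((norm (s w z))\<^sup>2 * exp (- ?H (Lg z)))" for z
  have [measurable]: "M \<in> borel_measurable borel" unfolding M_def by measurable
  have "\<exists>r>0. (\<integral>\<^sup>+ z\<in>ball p r. M z \<partial>lborel) < \<infinity>" for p
  proof -
    have "in_multiplier_ideal (\<lambda>z. ereal (real k) * \<phi> w z) p (s w)"
      using s w by (simp add: multiplier_sections_def)
    then obtain r where r: "r > 0"
      "(\<integral>\<^sup>+ z\<in>ball p r. ennreal ((norm (s w z))\<^sup>2) * exp_ereal (- (ereal (real k) * \<phi> w z)) \<partial>lborel) < \<infinity>"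
      unfolding in_multiplier_ideal_def by blast
    have "(\<integral>\<^sup>+ z\<in>ball p r. M z \<partial>lborel)
        = (\<integral>\<^sup>+ z\<in>ball p r. ennreal ((norm (s w z))\<^sup>2) * exp_ereal (- (ereal (real k) * \<phi> w z)) \<partial>lborel)"
      using AE_orbit
      by (intro nn_integral_cong_AE) (auto elim!: eventually_mono simp: M_def exp_ereal_weight[OF big v w] ennreal_mult')
    with r show ?thesis by (intro exI[of _ r]) simp
  qed
  then obtain r where r: "\<And>p. r p > 0" "\<And>p. (\<integral>\<^sup>+ z\<in>ball p (r p). M z \<partial>lborel) < \<infinity>" by metis
  define R where "R = 3 / 2 * real CARD('a)"
  have sub: "punctured_polydisc \<subseteq> cball (0 :: complex ^ 'a) R"
  proof
    fix z :: "complex ^ 'a" assume z: "z \<in> punctured_polydisc"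
    have "norm z \<le> (\<Sum>i\<in>UNIV. norm (z $ i))" unfolding norm_vec_def by (rule L2_set_le_sum) simp
    also have "\<dots> \<le> (\<Sum>i\<in>(UNIV::'a set). 3 / 2)" using z by (intro sum_mono) (simp add: punctured_polydisc_def)
    finally show "z \<in> cball 0 R" by (simp add: R_def)
  qed
  have cover: "cball (0 :: complex ^ 'a) R \<subseteq> (\<Union>p\<in>UNIV. ball p (r p))"
    using r(1) by (meson UNIV_I UN_I centre_in_ball subsetI)
  obtain T where T: "finite T" "cball (0 :: complex ^ 'a) R \<subseteq> (\<Union>p\<in>T. ball p (r p))"
    by (rule compactE_image[OF compact_cball _ cover]) auto
  have "(\<integral>\<^sup>+ z\<in>punctured_polydisc. M z \<partial>lborel) \<le> (\<integral>\<^sup>+ z. (\<Sum>p\<in>T. M z * indicator (ball p (r p)) z) \<partial>lborel)"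
  proof (intro nn_integral_mono)
    fix z :: "complex ^ 'a"
    show "M z * indicator punctured_polydisc z \<le> (\<Sum>p\<in>T. M z * indicator (ball p (r p)) z)"
    proof (cases "z \<in> punctured_polydisc")
      case True
      then obtain p where p: "p \<in> T" "z \<in> ball p (r p)" using sub T(2) by blast
      have "M z * indicator (ball p (r p)) z \<le> (\<Sum>p\<in>T. M z * indicator (ball p (r p)) z)"
        using T(1) p by (intro member_le_sum) auto
      then show ?thesis using p(2) True by simp
    qed simp
  qed
  also have "\<dots> = (\<Sum>p\<in>T. \<integral>\<^sup>+ z\<in>ball p (r p). M z \<partial>lborel)"
    by (intro nn_integral_sum borel_measurable_times_ennreal borel_measurable_indicator) auto
  also have "\<dots> < \<infinity>" using T(1) r(2) by simp
  finally show ?thesis by (simp add: weighted_L2_def M_def)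
qed

section \<open>Exponents occurring in sections of the multiplier ideal\<close>

text \<open>One expansion, common to all charts, that contains \<open>m\<close> with nonzero
  coefficient; quantifying over expansions avoids choosing one.\<close>

definition occurs ::
    "(real ^ 'n) set set \<Rightarrow> (int ^ 'n \<Rightarrow> int) \<Rightarrow> nat \<Rightarrow> (int ^ 'n ^ 'n \<Rightarrow> complex ^ 'n \<Rightarrow> complex) \<Rightarrow> int ^ 'n \<Rightarrow> bool" where
  "occurs \<Sigma> a k s m \<longleftrightarrow>
     (\<exists>S c. finite S \<and> m \<in> S \<and> (\<forall>m\<in>S. c m \<noteq> 0) \<and> (\<forall>m\<in>S. \<forall>w\<in>frames \<Sigma>. \<forall>i. expo a k w m i \<ge> 0) \<and>
       (\<forall>w\<in>frames \<Sigma>. \<forall>z. s w z = (\<Sum>m\<in>S. c m * mon (expo a k w m) z)))"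

text \<open>The coefficient \<open>c\<close> is fixed before \<open>k\<close>, \<open>s\<close> and
  \<open>m\<close>: it is half the real dimension, from \<open>weighted_L2_mon_growth\<close>, times
  the distortion of norms by the charts in \<open>W\<close>. Only \<open>C\<close> depends on the
  section.\<close>

lemma occurring_exponent_growth:
  assumes fan: "smooth_fan \<Sigma>" "complete_fan \<Sigma>" and big: "toric_hermitian_big \<Sigma> a \<phi>" and v: "v \<in> frames \<Sigma>"
  shows "\<exists>c\<ge>0. \<forall>k s m. s \<in> multiplier_sections \<Sigma> a \<phi> k \<longrightarrow> occurs \<Sigma> a k s m \<longrightarrow>
    (\<exists>C. \<forall>y. (\<Sum>j\<in>UNIV. of_int (expo a k v m j) * y $ j) - real k * potential a \<phi> v y \<le> C + c * norm y)"
proof -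
  obtain W where W: "finite W" "W \<subseteq> frames \<Sigma>" "\<And>y. \<exists>w\<in>W. \<exists>x. (\<forall>i. x $ i \<le> 0) \<and> y = log_change w v x"
    using log_coordinates_cover[OF fan v] by blast
  have "\<forall>w. \<exists>B>0. \<forall>x. norm (log_change v w x) \<le> B * norm x" using log_change_bounded by blast
  then obtain B where B: "\<And>w. B w > 0" "\<And>w x. norm (log_change v w x) \<le> B w * norm x" by metis
  define d where "d = real DIM(complex ^ 'a) / 2"
  have d: "d \<ge> 0" by (simp add: d_def)
  define c where "c = d * (\<Sum>w\<in>W. B w)"
  have "\<exists>C. \<forall>y. (\<Sum>j\<in>UNIV. of_int (expo a k v m j) * y $ j) - real k * potential a \<phi> v y \<le> C + c * norm y"
    if s: "s \<in> multiplier_sections \<Sigma> a \<phi> k" and m: "occurs \<Sigma> a k s m" for k s m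
  proof -
    obtain S cf where S: "finite S" "m \<in> S" "\<forall>m\<in>S. cf m \<noteq> 0"
      "\<And>w z. w \<in> frames \<Sigma> \<Longrightarrow> s w z = (\<Sum>m\<in>S. cf m * mon (expo a k w m) z)"
      using m unfolding occurs_def by blast
    have "\<forall>w\<in>W. \<exists>C. \<forall>x. (\<forall>i. x $ i \<le> 0) \<longrightarrow>
        (\<Sum>i\<in>UNIV. of_int (expo a k w m i) * x $ i) - frame_weight a \<phi> v k w x \<le> C + d * norm x"
    proof
      fix w assume "w \<in> W"
      then have w: "w \<in> frames \<Sigma>" using W by blast
      let ?H = "frame_weight a \<phi> v k w"
      obtain M where M: "M \<ge> 0" "\<And>x y. ?H y - ?H x \<le> M * norm (y - x)"
        using frame_weight_lipschitz[OF fan big v] by blast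
      have meas: "?H \<in> borel_measurable borel" by (rule frame_weight_measurable[OF big v])
      have "s w = (\<lambda>z. \<Sum>m\<in>S. cf m * mon (expo a k w m) z)" using S(4)[OF w] by auto
      then have sum: "weighted_L2 ?H (\<lambda>z. \<Sum>m\<in>S. cf m * mon (expo a k w m) z)"
        using multiplier_section_weighted_L2[OF big v w s] by simp
      have "inj_on (expo a k w) S" using expo_inject[OF frames_invertible[OF w]] by (auto intro: inj_onI)
      then have "weighted_L2 ?H (mon (expo a k w m))"
        using S by (intro monomial_extraction[where P = "weighted_L2 ?H", OF _ _ _ S(1) _ sum])
          (auto intro: weighted_L2_scale weighted_L2_diff weighted_L2_shrink meas M)
      then show "\<exists>C. \<forall>x. (\<forall>i. x $ i \<le> 0) \<longrightarrow>
        (\<Sum>i\<in>UNIV. of_int (expo a k w m i) * x $ i) - ?H x \<le> C + d * norm x"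
        unfolding d_def by (rule weighted_L2_mon_growth[OF _ M(2,1) meas])
    qed
    then obtain C where C: "\<And>w x. w \<in> W \<Longrightarrow> (\<forall>i. x $ i \<le> 0) \<Longrightarrow>
        (\<Sum>i\<in>UNIV. of_int (expo a k w m i) * x $ i) - frame_weight a \<phi> v k w x \<le> C w + d * norm x" by metis
    have "(\<Sum>j\<in>UNIV. of_int (expo a k v m j) * y $ j) - real k * potential a \<phi> v y \<le> (\<Sum>w\<in>W. \<bar>C w\<bar>) + c * norm y" for y
    proof -
      obtain w x where wx: "w \<in> W" "\<forall>i. x $ i \<le> 0" "y = log_change w v x" using W(3) by blast
      have w: "w \<in> frames \<Sigma>" using wx W by blast
      have "log_change v w y = x" unfolding wx(3) by (rule log_change_inverse[OF frames_invertible[OF w] frames_invertible[OF v]])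
      then have "norm x \<le> B w * norm y" using B(2)[of w y] by simp
      also have "\<dots> \<le> (\<Sum>w\<in>W. B w) * norm y"
        using member_le_sum[OF wx(1), of B] W(1) B(1) by (intro mult_right_mono) (auto intro: less_imp_le)
      finally have "d * norm x \<le> c * norm y" using d by (simp add: c_def mult.assoc mult_left_mono)
      moreover have "C w \<le> (\<Sum>w\<in>W. \<bar>C w\<bar>)" using member_le_sum[OF wx(1), of "\<lambda>w. \<bar>C w\<bar>"] W(1) by simp
      moreover have "(\<Sum>j\<in>UNIV. of_int (expo a k v m j) * y $ j) - real k * potential a \<phi> v y
          = (\<Sum>i\<in>UNIV. of_int (expo a k w m i) * x $ i) - frame_weight a \<phi> v k w x"
        unfolding wx(3) frame_weight_def
        using expo_pairing[OF frames_invertible[OF v], of a k w m x] by (simp add: algebra_simps)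
      ultimately show ?thesis using C[OF wx(1,2)] by linarith
    qed
    then show ?thesis by blast
  qed
  moreover have "c \<ge> 0" using d B(1) by (simp add: c_def sum_nonneg less_imp_le)
  ultimately show ?thesis by blast
qed

text \<open>Regularity in each chart is \<open>minorant_slopes_polytope\<close> multiplied by
  \<open>k\<close>. The pairing identity carries the minorant to every chart, where it bounds the
  integrand by \<open>exp (k * D)\<close> almost everywhere, also near the boundary
  divisors.\<close>

lemma lattice_point_sections:
  assumes big: "toric_hermitian_big \<Sigma> a \<phi>" and v: "v \<in> frames \<Sigma>" and k: "k > 0"
    and p: "(\<chi> i. real_of_int (expo a k v m i) / real k) \<in> minorant_slopes (potential a \<phi> v)"
  shows "char_section \<Sigma> a k m \<in> multiplier_sections \<Sigma> a \<phi> k" "\<And>w i. w \<in> frames \<Sigma> \<Longrightarrow> expo a k w m i \<ge> 0"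
proof -
  show nonneg: "expo a k w m i \<ge> 0" if w: "w \<in> frames \<Sigma>" for w i
  proof -
    have "0 \<le> of_int (transition_exponent a w v i) + (\<Sum>j\<in>UNIV. of_int (frame_change w v $ i $ j) * (of_int (expo a k v m j) / real k))"
      using minorant_slopes_polytope[OF big v w p, of i] by simp
    then have "0 \<le> real k * (of_int (transition_exponent a w v i) + (\<Sum>j\<in>UNIV. of_int (frame_change w v $ i $ j) * (of_int (expo a k v m j) / real k)))"
      by (intro mult_nonneg_nonneg) auto
    also have "\<dots> = of_int (expo a k w m i)"
      unfolding expo_change[OF frames_invertible[OF v], of a k w m i]
      using k by (simp add: distrib_left sum_distrib_left)
    finally show ?thesis by simp
  qed
  obtain D where D: "\<And>y. potential a \<phi> v y \<ge> (\<chi> i. real_of_int (expo a k v m i) / real k) \<bullet> y - D"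
    using p by (auto simp: minorant_slopes_def)
  have "in_multiplier_ideal (\<lambda>z. ereal (real k) * \<phi> w z) q (char_section \<Sigma> a k m w)" if w: "w \<in> frames \<Sigma>" for w q
    unfolding in_multiplier_ideal_def
  proof (intro exI[of _ 1] conjI)
    have le: "ennreal ((norm (char_section \<Sigma> a k m w z))\<^sup>2) * exp_ereal (- (ereal (real k) * \<phi> w z)) \<le> ennreal (exp (real k * D))"
      if z: "z \<in> orbit" for z
    proof -
      define y where "y = log_change w v (Lg z)"
      have "(\<Sum>j\<in>UNIV. of_int (expo a k v m j) * y $ j) = real k * ((\<chi> i. real_of_int (expo a k v m i) / real k) \<bullet> y)"
        using k by (simp add: inner_vec_def sum_distrib_left)
      also have "\<dots> \<le> real k * (potential a \<phi> v y + D)" using D[of y] by (intro mult_left_mono) auto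
      finally have "(\<Sum>i\<in>UNIV. of_int (expo a k w m i) * Lg z $ i) - frame_weight a \<phi> v k w (Lg z) \<le> real k * D"
        using expo_pairing[OF frames_invertible[OF v], of a k w m "Lg z"]
        by (simp add: frame_weight_def y_def algebra_simps)
      moreover have "ennreal ((norm (char_section \<Sigma> a k m w z))\<^sup>2) * exp_ereal (- (ereal (real k) * \<phi> w z))
          = ennreal (exp ((\<Sum>i\<in>UNIV. of_int (expo a k w m i) * Lg z $ i) - frame_weight a \<phi> v k w (Lg z)))"
        using w by (simp add: char_section_def exp_ereal_weight[OF big v w z] norm_mon_squared[OF z]
            exp_diff exp_minus divide_inverse flip: ennreal_mult')
      ultimately show ?thesis by (simp add: ennreal_leI)
    qed
    have "(\<integral>\<^sup>+ z\<in>ball q 1. ennreal ((norm (char_section \<Sigma> a k m w z))\<^sup>2) * exp_ereal (- (ereal (real k) * \<phi> w z)) \<partial>lborel)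
        \<le> (\<integral>\<^sup>+ z. ennreal (exp (real k * D)) * indicator (ball q 1) z \<partial>lborel)"
      using AE_orbit by (intro nn_integral_mono_AE) (auto elim!: eventually_mono simp: indicator_def le)
    also have "\<dots> = ennreal (exp (real k * D)) * emeasure lborel (ball q 1)"
      by (intro nn_integral_cmult_indicator) auto
    also have "\<dots> < \<infinity>" by (simp add: ennreal_mult_less_top emeasure_ball)
    finally show "(\<integral>\<^sup>+ z\<in>ball q 1. ennreal ((norm (char_section \<Sigma> a k m w z))\<^sup>2) * exp_ereal (- (ereal (real k) * \<phi> w z)) \<partial>lborel) < \<infinity>" .
  qed simp
  moreover have "char_section \<Sigma> a k m \<in> sections \<Sigma> a k" using nonneg by (intro char_section_in_sections)
  ultimately show "char_section \<Sigma> a k m \<in> multiplier_sections \<Sigma> a \<phi> k" by (simp add: multiplier_sections_def)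
qed

lemma nonzero_section_valuation:
  fixes v :: "int ^ 'n::{finite,linorder} ^ 'n::{finite,linorder}"
  assumes fan: "smooth_fan \<Sigma>" "complete_fan \<Sigma>" and s: "s \<in> sections \<Sigma> a k" "s \<noteq> 0" and v: "v \<in> frames \<Sigma>"
  shows "\<exists>m. occurs \<Sigma> a k s m \<and> (\<forall>i. real (flag_valuation v s i) = of_int (expo a k v m i))"
proof -
  obtain S c where S': "finite S" "\<forall>m\<in>S. c m \<noteq> 0"
    "\<forall>m\<in>S. \<forall>w\<in>frames \<Sigma>. \<forall>i. expo a k w m i \<ge> 0"
    "\<forall>w\<in>frames \<Sigma>. \<forall>z. s w z = (\<Sum>m\<in>S. c m * mon (expo a k w m) z)"
    using section_expansion[OF fan s(1) v] by (elim exE conjE) (rule that)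
  then have S: "finite S" "\<And>m. m \<in> S \<Longrightarrow> c m \<noteq> 0" "\<And>m w i. m \<in> S \<Longrightarrow> w \<in> frames \<Sigma> \<Longrightarrow> expo a k w m i \<ge> 0"
    "\<And>w z. w \<in> frames \<Sigma> \<Longrightarrow> s w z = (\<Sum>m\<in>S. c m * mon (expo a k w m) z)"
    by auto
  have "S \<noteq> {}"
  proof
    assume "S = {}"
    then have "s w z = 0" for w z using S(4) s(1) by (cases "w \<in> frames \<Sigma>") (auto simp: sections_def)
    then show False using s(2) by (simp add: fun_eq_iff)
  qed
  then obtain m where m: "m \<in> S" "flag_valuation v s = (\<lambda>i. nat (expo a k v m i))"
    using flag_valuation_expansion[where S = S and c = c and a = a and k = k and v = v and s = s,
        OF S(1) _ S(2) S(3)[OF _ v] frames_invertible[OF v] S(4)[OF v]] by blast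
  have "occurs \<Sigma> a k s m"
    unfolding occurs_def by (intro exI[of _ S] exI[of _ c] conjI S' m(1))
  moreover have "real (flag_valuation v s i) = of_int (expo a k v m i)" for i
    using S(3)[OF m(1) v, of i] by (simp add: m(2))
  ultimately show ?thesis by blast
qed

lemma lattice_point_valuation:
  fixes v :: "int ^ 'n::{finite,linorder} ^ 'n::{finite,linorder}"
  assumes v: "v \<in> frames \<Sigma>" and nonneg: "\<And>i. expo a k v m i \<ge> 0"
  shows "char_section \<Sigma> a k m \<noteq> 0" "\<And>i. real (flag_valuation v (char_section \<Sigma> a k m) i) = of_int (expo a k v m i)"
proof -
  have "char_section \<Sigma> a k m v (expv 0) \<noteq> 0" using v by (simp add: char_section_def mon_nonzero)
  then show "char_section \<Sigma> a k m \<noteq> 0" by auto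
  have "\<exists>m'\<in>{m}. flag_valuation v (char_section \<Sigma> a k m) = (\<lambda>i. nat (expo a k v m' i))"
    using nonneg v by (intro flag_valuation_expansion[where c = "\<lambda>_. 1"]) (auto simp: char_section_def frames_invertible)
  then show "real (flag_valuation v (char_section \<Sigma> a k m) i) = of_int (expo a k v m i)" for i
    using nonneg[of i] by simp
qed

lemma sum_fun_apply: "(\<Sum>a\<in>A. f a) x = (\<Sum>a\<in>A. f a x)"
  by (induction A rule: infinite_finite_induct) auto

text \<open>The characters indexed by \<open>X\<close> span a space containing \<open>V\<close>,
  because each section is the combination of the characters in its expansion.\<close>

lemma section_dim_le_card:
  assumes fan: "smooth_fan \<Sigma>" "complete_fan \<Sigma>" and v: "v \<in> frames \<Sigma>"
    and V: "V \<subseteq> sections \<Sigma> a k" and X: "finite X" "\<And>s m. s \<in> V \<Longrightarrow> occurs \<Sigma> a k s m \<Longrightarrow> m \<in> X"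
  shows "section_dim V \<le> card X"
proof -
  interpret vs: vector_space "scale_section :: complex \<Rightarrow> (int ^ 'a ^ 'a \<Rightarrow> complex ^ 'a \<Rightarrow> complex) \<Rightarrow> _"
    by (rule vector_space_scale_section)
  have "V \<subseteq> vs.span (char_section \<Sigma> a k ` X)"
  proof
    fix s assume s: "s \<in> V"
    then have sec: "s \<in> sections \<Sigma> a k" using V by blast
    obtain S c where S': "finite S" "\<forall>m\<in>S. c m \<noteq> 0"
      "\<forall>m\<in>S. \<forall>w\<in>frames \<Sigma>. \<forall>i. expo a k w m i \<ge> 0"
      "\<forall>w\<in>frames \<Sigma>. \<forall>z. s w z = (\<Sum>m\<in>S. c m * mon (expo a k w m) z)"
      using section_expansion[OF fan sec v] by (elim exE conjE) (rule that)
    then have S: "finite S" "\<And>m. m \<in> S \<Longrightarrow> c m \<noteq> 0" "\<And>m w i. m \<in> S \<Longrightarrow> w \<in> frames \<Sigma> \<Longrightarrow> expo a k w m i \<ge> 0"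
      "\<And>w z. w \<in> frames \<Sigma> \<Longrightarrow> s w z = (\<Sum>m\<in>S. c m * mon (expo a k w m) z)"
      by auto
    have "m \<in> X" if "m \<in> S" for m
    proof (rule X(2)[OF s])
      show "occurs \<Sigma> a k s m"
        unfolding occurs_def by (intro exI[of _ S] exI[of _ c] conjI S' that)
    qed
    moreover have "s = (\<Sum>m\<in>S. scale_section (c m) (char_section \<Sigma> a k m))"
    proof (intro ext)
      fix w z
      show "s w z = (\<Sum>m\<in>S. scale_section (c m) (char_section \<Sigma> a k m)) w z"
        using S(4)[of w z] sec
        by (cases "w \<in> frames \<Sigma>") (auto simp: sum_fun_apply scale_section_def char_section_def sections_def)
    qed
    moreover have "(\<Sum>m\<in>S. scale_section (c m) (char_section \<Sigma> a k m)) \<in> vs.span (char_section \<Sigma> a k ` X)"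
      using calculation(1) by (intro vs.span_sum vs.span_scale vs.span_base imageI)
    ultimately show "s \<in> vs.span (char_section \<Sigma> a k ` X)" by simp
  qed
  then have "vs.dim V \<le> card (char_section \<Sigma> a k ` X)" using X(1) by (intro vs.dim_le_card) auto
  also have "\<dots> \<le> card X" using X(1) by (rule card_image_le)
  finally show ?thesis by (simp add: section_dim_def)
qed

text \<open>Division by \<open>k\<close> turns the growth estimate into an approximate minorant with
  slope error \<open>c / k\<close>. The perturbation lemma asks for a distance larger than twice
  that error; in \<open>2 * c + 1\<close> the 1 makes the inequality strict.\<close>

lemma occurring_exponent_near_slopes:
  assumes fan: "smooth_fan \<Sigma>" "complete_fan \<Sigma>" and big: "toric_hermitian_big \<Sigma> a \<phi>" and v: "v \<in> frames \<Sigma>"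
  shows "\<exists>c\<ge>0. \<forall>k s m. k > 0 \<longrightarrow> s \<in> multiplier_sections \<Sigma> a \<phi> k \<longrightarrow> occurs \<Sigma> a k s m \<longrightarrow>
    (\<exists>y\<in>minorant_slopes (potential a \<phi> v). dist (\<chi> i. real_of_int (expo a k v m i) / real k) y \<le> c / real k)"
proof -
  obtain c where c: "c \<ge> 0" "\<forall>k s m. s \<in> multiplier_sections \<Sigma> a \<phi> k \<longrightarrow> occurs \<Sigma> a k s m \<longrightarrow>
      (\<exists>C. \<forall>y. (\<Sum>j\<in>UNIV. of_int (expo a k v m j) * y $ j) - real k * potential a \<phi> v y \<le> C + c * norm y)"
    using occurring_exponent_growth[OF assms] by (elim exE conjE) (rule that)
  have "\<exists>y\<in>minorant_slopes (potential a \<phi> v). dist (\<chi> i. real_of_int (expo a k v m i) / real k) y \<le> (2 * c + 1) / real k"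
    if k: "k > 0" and s: "s \<in> multiplier_sections \<Sigma> a \<phi> k" "occurs \<Sigma> a k s m" for k s m
  proof -
    define p where "p = (\<chi> i. real_of_int (expo a k v m i) / real k)"
    obtain C where C: "\<And>y. (\<Sum>j\<in>UNIV. of_int (expo a k v m j) * y $ j) - real k * potential a \<phi> v y \<le> C + c * norm y"
      using c(2)[rule_format, OF s] by blast
    have "potential a \<phi> v y \<ge> p \<bullet> y - c / real k * norm y - C / real k" for y
    proof -
      have "(\<Sum>j\<in>UNIV. of_int (expo a k v m j) * y $ j) = real k * (p \<bullet> y)"
        using k by (simp add: p_def inner_vec_def sum_distrib_left)
      with C[of y] have "real k * (p \<bullet> y - c / real k * norm y - C / real k) \<le> real k * potential a \<phi> v y"
        using k by (simp add: algebra_simps)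
      then show ?thesis using k by simp
    qed
    then obtain q where "q \<in> subgradient_image (potential a \<phi> v)" "dist p q < (2 * c + 1) / real k"
      using subgradient_near_approximate_minorant[OF convex_potential[OF big v], of "c / real k" "(2 * c + 1) / real k" p "C / real k"]
        c(1) k by (auto simp: divide_strict_right_mono)
    then show ?thesis
      using subgradient_image_subset_minorant_slopes unfolding p_def by (meson less_imp_le subsetD)
  qed
  then show ?thesis using c(1) by (intro exI[of _ "2 * c + 1"]) auto
qed

text \<open>The slab around the hyperplane that contains the exponents has thickness independent of
  \<open>k\<close>, while the box containing them has sides growing linearly. Counting gives
  dimensions of order k^(n-1), so the normalized dimensions converge to 0, which is then the value
  of \<open>lim\<close>.\<close>

lemma interior_minorant_slopes:
  fixes \<Sigma> :: "(real ^ 'n::finite) set set"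
  assumes fan: "smooth_fan \<Sigma>" "complete_fan \<Sigma>" and big: "toric_hermitian_big \<Sigma> a \<phi>" and v: "v \<in> frames \<Sigma>"
    and vol: "metric_volume \<Sigma> a \<phi> > 0"
  shows "interior (minorant_slopes (potential a \<phi> v)) \<noteq> {}"
proof
  let ?D = "minorant_slopes (potential a \<phi> v)"
  assume "interior ?D = {}"
  then obtain h b where h: "h \<noteq> 0" "?D \<subseteq> {x. h \<bullet> x = b}"
    using empty_interior_subset_hyperplane[OF convex_minorant_slopes] by metis
  then obtain i where i: "h $ i \<noteq> 0" by (auto simp: vec_eq_iff)
  obtain c where c0: "c \<ge> 0" "\<forall>k s m. k > 0 \<longrightarrow> s \<in> multiplier_sections \<Sigma> a \<phi> k \<longrightarrow> occurs \<Sigma> a k s m \<longrightarrow>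
      (\<exists>y\<in>?D. dist (\<chi> i. real_of_int (expo a k v m i) / real k) y \<le> c / real k)"
    using occurring_exponent_near_slopes[OF fan big v] by (elim exE conjE) (rule that)
  note c = c0(1) c0(2)[rule_format]
  obtain C L where "L \<ge> 0" "\<And>x. potential a \<phi> v x \<le> C + L * norm x"
    using potential_linear_growth[OF fan big v] by blast
  then have "bounded ?D" by (intro bounded_minorant_slopes)
  then obtain R where R: "R > 0" "\<And>y. y \<in> ?D \<Longrightarrow> norm y \<le> R" using bounded_pos by metis
  \<comment> \<open>\<open>E\<close> is the half-thickness of the slab before division by
    \<open>k\<close>, and \<open>D\<close> the resulting spread in coordinate \<open>i\<close>.
    \<open>M k\<close> bounds the exponents, since slopes have norm at most \<open>R\<close> and the
    error is \<open>c / k\<close>.\<close>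
  define E where "E = norm h * c"
  define D where "D = nat \<lceil>2 * E / \<bar>h $ i\<bar>\<rceil>"
  define M where "M k = nat \<lceil>real k * R + c\<rceil>" for k :: nat
  define n where "n = CARD('n)"
  have n: "n > 0" by (simp add: n_def)
  have dim: "section_dim (multiplier_sections \<Sigma> a \<phi> k) \<le> (M k + 1) ^ (n - 1) * (D + 1)" if k: "k > 0" for k
  proof -
    define Y where "Y = {\<alpha> :: 'n \<Rightarrow> nat. (\<forall>j. \<alpha> j \<le> M k) \<and> \<bar>(\<Sum>j\<in>UNIV. h $ j * real (\<alpha> j)) - real k * b\<bar> \<le> E}"
    have Y: "finite Y" "card Y \<le> (M k + 1) ^ (n - 1) * (D + 1)"
      unfolding Y_def n_def
      by (rule card_lattice_points_near_hyperplane[of "\<lambda>j. h $ j" i E D]; use i in \<open>simp add: D_def of_nat_ceiling\<close>)+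
    define X where "X = {m. \<exists>s\<in>multiplier_sections \<Sigma> a \<phi> k. occurs \<Sigma> a k s m}"
    define g where "g m = (\<lambda>j. nat (expo a k v m j))" for m
    have nonneg: "expo a k v m j \<ge> 0" if "m \<in> X" for m j
      using that v by (auto simp: X_def occurs_def)
    have inj: "inj_on g X"
    proof (rule inj_onI)
      fix m m' assume m: "m \<in> X" "m' \<in> X" "g m = g m'"
      have "expo a k v m j = expo a k v m' j" for j
        using fun_cong[OF m(3), of j] nonneg[OF m(1), of j] nonneg[OF m(2), of j] by (simp add: g_def)
      then show "m = m'" using expo_inject[OF frames_invertible[OF v]] by blast
    qed
    have "g m \<in> Y" if m: "m \<in> X" for m
    proof -
      define p where "p = (\<chi> i. real_of_int (expo a k v m i) / real k)"
      obtain y where y: "y \<in> ?D" "dist p y \<le> c / real k"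
        using m c(2)[OF k] unfolding X_def p_def by blast
      have gp: "real (g m j) = real k * p $ j" for j using nonneg[OF m, of j] k by (simp add: g_def p_def)
      have "g m j \<le> M k" for j
      proof -
        have "p $ j \<le> norm p" using component_le_norm_cart[of p j] by linarith
        also have "norm p \<le> norm y + norm (p - y)" using norm_triangle_ineq[of y "p - y"] by simp
        also have "\<dots> \<le> R + c / real k" using R(2)[OF y(1)] y(2) by (simp add: dist_norm)
        finally have "real k * p $ j \<le> real k * (R + c / real k)" by (intro mult_left_mono) auto
        then have "real (g m j) \<le> real k * R + c" using k by (simp add: gp distrib_left)
        then show ?thesis unfolding M_def by linarith
      qed
      moreover have "\<bar>(\<Sum>j\<in>UNIV. h $ j * real (g m j)) - real k * b\<bar> \<le> E"
      proof -
        have "h \<bullet> y = b" using h(2) y(1) by blast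
        moreover have "(\<Sum>j\<in>UNIV. h $ j * real (g m j)) = real k * (h \<bullet> p)"
          by (simp add: gp inner_vec_def sum_distrib_left mult_ac)
        ultimately have "(\<Sum>j\<in>UNIV. h $ j * real (g m j)) - real k * b = real k * (h \<bullet> (p - y))"
          by (simp add: inner_diff_right algebra_simps)
        also have "\<bar>\<dots>\<bar> \<le> real k * (norm h * norm (p - y))"
          unfolding abs_mult by (simp add: mult_left_mono Cauchy_Schwarz_ineq2)
        also have "\<dots> \<le> real k * (norm h * (c / real k))"
          using y(2) by (intro mult_left_mono) (auto simp: dist_norm)
        also have "\<dots> = E" using k by (simp add: E_def)
        finally show ?thesis .
      qed
      ultimately show ?thesis by (simp add: Y_def)
    qed
    then have "g ` X \<subseteq> Y" by blast
    then have "finite X" "card X \<le> card Y"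
      using Y(1) inj by (auto intro: inj_on_finite card_inj_on_le)
    moreover have "section_dim (multiplier_sections \<Sigma> a \<phi> k) \<le> card X"
      using \<open>finite X\<close> by (intro section_dim_le_card[OF fan v]) (auto simp: multiplier_sections_def X_def)
    ultimately show ?thesis using Y(2) by linarith
  qed
  \<comment> \<open>Chosen so that \<open>M k + 1 \<le> k * B\<close> for \<open>k > 0\<close>:
    rounding up adds at most 1, and \<open>c + 2 \<le> k * (c + 2)\<close>.\<close>
  define B where "B = R + c + 2"
  have B: "B > 0" using R c by (simp add: B_def)
  have bound: "real (section_dim (multiplier_sections \<Sigma> a \<phi> k)) / real k ^ n \<le> B ^ (n - 1) * real (D + 1) / real k" if k: "k > 0" for k
  proof -
    have "real k * (c + 2) \<ge> 1 * (c + 2)" using k c(1) by (intro mult_right_mono) auto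
    moreover have "real (M k) \<le> real k * R + c + 1"
    proof -
      have "0 \<le> real k * R + c" using R c by simp
      then show ?thesis unfolding M_def by linarith
    qed
    ultimately have Mk: "real (M k) + 1 \<le> real k * B" by (simp add: B_def algebra_simps)
    have "real (section_dim (multiplier_sections \<Sigma> a \<phi> k)) \<le> real ((M k + 1) ^ (n - 1) * (D + 1))"
      using dim[OF k] by (simp only: of_nat_le_iff)
    also have "\<dots> = (real (M k) + 1) ^ (n - 1) * real (D + 1)"
      by (simp only: of_nat_mult of_nat_power of_nat_add of_nat_1)
    also have "\<dots> \<le> (real k * B) ^ (n - 1) * real (D + 1)"
      using Mk by (intro mult_right_mono power_mono) auto
    finally have "real (section_dim (multiplier_sections \<Sigma> a \<phi> k)) / real k ^ n \<le> (real k * B) ^ (n - 1) * real (D + 1) / real k ^ n"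
      by (intro divide_right_mono) auto
    also have "(real k * B) ^ (n - 1) * real (D + 1) / real k ^ n = B ^ (n - 1) * real (D + 1) / real k"
    proof -
      have "real k ^ n = real k ^ (n - 1) * real k" using n by (metis power_minus_mult)
      then show ?thesis using k by (simp add: power_mult_distrib)
    qed
    finally show ?thesis .
  qed
  have "(\<lambda>k. real (section_dim (multiplier_sections \<Sigma> a \<phi> k)) / real k ^ n) \<longlonglongrightarrow> 0"
  proof (rule Lim_null_comparison)
    show "\<forall>\<^sub>F k in sequentially. norm (real (section_dim (multiplier_sections \<Sigma> a \<phi> k)) / real k ^ n) \<le> B ^ (n - 1) * real (D + 1) / real k"
      using eventually_gt_at_top[of 0] by eventually_elim (use bound in simp)
    show "(\<lambda>k. B ^ (n - 1) * real (D + 1) / real k) \<longlonglongrightarrow> 0" by (rule lim_const_over_n)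
  qed
  then have "metric_volume \<Sigma> a \<phi> = 0" unfolding metric_volume_def n_def[symmetric] by (rule limI)
  with vol show False by simp
qed

theorem theorem1p3:
  fixes \<Sigma> :: "(real ^ 'n::{finite,linorder}) set set"
    and a :: "int ^ 'n::{finite,linorder} \<Rightarrow> int"
    and \<phi> :: "int ^ 'n::{finite,linorder} ^ 'n::{finite,linorder} \<Rightarrow> complex ^ 'n::{finite,linorder} \<Rightarrow> ereal"
    and v :: "int ^ 'n::{finite,linorder} ^ 'n::{finite,linorder}"
  assumes "smooth_projective_fan \<Sigma>"
    and "toric_hermitian_big \<Sigma> a \<phi>"
    and "metric_volume \<Sigma> a \<phi> > 0"
    and "v \<in> frames \<Sigma>"
  shows "partial_okounkov_body \<Sigma> a \<phi> v = closure (subgradient_image (potential a \<phi> v))"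
proof -
  note big = assms(2) and v = assms(4)
  have fan: "smooth_fan \<Sigma>" "complete_fan \<Sigma>" using assms(1) by (auto simp: smooth_projective_fan_def)
  let ?D = "minorant_slopes (potential a \<phi> v)"
  let ?P = "\<lambda>k. (\<lambda>s. \<chi> i. real (flag_valuation v s i) / real k) ` (multiplier_sections \<Sigma> a \<phi> k - {0})"
  obtain C L where "L \<ge> 0" "\<And>x. potential a \<phi> v x \<le> C + L * norm x"
    using potential_linear_growth[OF fan big v] by blast
  then have bnd: "bounded ?D" by (intro bounded_minorant_slopes)
  obtain c where c0: "c \<ge> 0" "\<forall>k s m. k > 0 \<longrightarrow> s \<in> multiplier_sections \<Sigma> a \<phi> k \<longrightarrow> occurs \<Sigma> a k s m \<longrightarrow>
      (\<exists>y\<in>?D. dist (\<chi> i. real_of_int (expo a k v m i) / real k) y \<le> c / real k)"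
    using occurring_exponent_near_slopes[OF fan big v] by (elim exE conjE) (rule that)
  note c = c0(2)[rule_format]
  have "hausdorff_converges (\<lambda>k. convex hull (?P k)) (closure ?D)"
  proof (rule hausdorff_converges_lattice_hulls[OF convex_minorant_slopes bnd interior_minorant_slopes[OF fan big v assms(3)]])
    fix k :: nat and x assume k: "k > 0" and "x \<in> ?P k"
    then obtain s where s: "s \<in> multiplier_sections \<Sigma> a \<phi> k" "s \<noteq> 0" "x = (\<chi> i. real (flag_valuation v s i) / real k)"
      by blast
    have "s \<in> sections \<Sigma> a k" using s(1) by (simp add: multiplier_sections_def)
    from nonzero_section_valuation[OF fan this s(2) v]
    obtain m where m: "occurs \<Sigma> a k s m" "\<And>i. real (flag_valuation v s i) = of_int (expo a k v m i)"
      by blast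
    obtain y where "y \<in> ?D" "dist x y \<le> c / real k"
      using c[OF k s(1) m(1)] unfolding s(3) m(2) by blast
    then show "\<exists>y\<in>closure ?D. dist x y \<le> c / real k" using closure_subset by blast
  next
    fix k :: nat and \<alpha> :: "'n \<Rightarrow> int" assume k: "k > 0" and \<alpha>: "(\<chi> i. real_of_int (\<alpha> i) / real k) \<in> ?D"
    \<comment> \<open>The lattice point becomes a character, which lies in the multiplier sections
      because its slope is in \<open>?D\<close>; having a single term, it has valuation exactly
      \<alpha>.\<close>
    obtain m where m: "expo a k v m = \<alpha>" using expo_surj[OF frames_invertible[OF v]] by blast
    note sec = lattice_point_sections[OF big v k, of m, unfolded m, OF \<alpha>]
    have nn: "expo a k v m i \<ge> 0" for i using sec(2)[OF v] .
    show "(\<chi> i. real_of_int (\<alpha> i) / real k) \<in> ?P k"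
      using sec(1) lattice_point_valuation[OF v nn] m
      by (intro image_eqI[of _ _ "char_section \<Sigma> a k m"]) (auto simp: vec_eq_iff)
  qed
  then have "hausdorff_converges (okounkov_level \<Sigma> a \<phi> v) (closure ?D)"
    by (simp add: okounkov_level_def[abs_def])
  then have "partial_okounkov_body \<Sigma> a \<phi> v = closure ?D" by (rule partial_okounkov_body_eqI)
  also have "\<dots> = closure (subgradient_image (potential a \<phi> v))"
    by (rule closure_subgradient_image[OF convex_potential[OF big v], symmetric])
  finally show ?thesis .
qed

end
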